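(* Let $0\le\beta\le\alpha\le 1$ with $\beta<1$, and let $(\chi,(\psi_i)_{i\in I_\ast})$ be a wave-packet scattering bank subordinate to the covering $\mathcal Q^{(\alpha,\beta)}$ which satisfies the active core condition (AC) and the uniform active-core regularity condition (R). Then there exist functions $f_j\in\mathcal S(\mathbb R^2)$ with $\|f_j\|_{L^2}=1$, compactly supported smooth deformations $\tau_j\in C_c^\infty(\mathbb R^2;\mathbb R^2)$, and a constant $c>0$ independent of $j$, such that, for all sufficiently large $j$, $$\|\tau_j\|_{C^m}\le C_m\,2^{-(1-\beta)j}\qquad\text{for all } m\in\{0,1,2,\dots\},$$ with constants $C_m<\infty$ independent of $j$, and $$\|\mathsf S_{\chi,1}(L_{\tau_j}f_j)-\mathsf S_{\chi,1}f_j\|_{\ell^2(L^2)}\ge c .$$ Moreover, for the associated linear filter transform $\mathcal W$ one also has, for all sufficiently large $j$, $$\|[\mathcal W,L_{\tau_j}]f_j\|_{\ell^2(L^2)}\ge c .$$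
   Context: Notation: $\mathbb N=\{1,2,\dots\}$, $\mathbb N_0=\{0,1,2,\dots\}$; $\widehat f(\xi)=\int_{\mathbb R^2}e^{-2\pi \mathrm i x\cdot\xi}f(x)\,dx$; $B_r(x_0)$ is the open ball; $X\asymp Y$ means two-sided bounds with constants independent of $j$. For a vector field $\tau:\mathbb R^2\to\mathbb R^2$, $L_\tau f(x)=f(x-\tau(x))$ (applied componentwise to families of functions), and $\|\tau\|_{C^m}=\sum_{|\nu|\le m}\|\partial^\nu\tau\|_{L^\infty}$. For a countable family $q=(q_p)_p$, $\|q\|_{\ell^2(L^2)}=(\sum_p\|q_p\|_{L^2}^2)^{1/2}$. Covering. Fix $0\le\beta\le\alpha\le1$ and $\varepsilon_0\in(0,1/32)$. Let $Q=(-\varepsilon_0,1+\varepsilon_0)\times(-1-\varepsilon_0,1+\varepsilon_0)$ and $P=[0,1]\times[-1,1]$. For $j\in\mathbb N$ let $m_j^{\max}=\lceil 2^{(1-\alpha)j-1}\rceil$, $\ell_j^{\max}=\lceil 10\cdot2^{(1-\beta)j}\rceil$, $A_j=\mathrm{diag}(2^{\alpha j},2^{\beta j})$, $c_{j,m}=(2^{j-1}+m2^{\alpha j},0)^\top$, and let $R_{j,\ell}$ be the rotation matrix by the angle $\theta_{j,\ell}=2\ell\cdot\frac{\pi}{10}2^{(\beta-1)j}$. Put $I_\ast=\{(j,m,\ell)\in\mathbb N\times\mathbb N_0\times\mathbb N_0: m\le m_j^{\max},\ \ell\le\ell_j^{\max}\}$, $I=\{0\}\cup I_\ast$, and for $i=(j,m,\ell)\in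 I_\ast$, $Q_i=R_{j,\ell}(A_jQ+c_{j,m})$, $P_i=R_{j,\ell}(A_jP+c_{j,m})$; also $Q_0=B_4(0)$, $P_0=B_3(0)$. The covering is $\mathcal Q^{(\alpha,\beta)}=(Q_i)_{i\in I}$. Filter bank. A wave-packet scattering bank subordinate to $\mathcal Q^{(\alpha,\beta)}$ consists of $\chi\in L^1\cap L^2(\mathbb R^2)$ and $\psi_i\in L^1\cap L^2(\mathbb R^2)$, $i\in I_\ast$, with $m_i:=\widehat\psi_i$, such that $|\widehat\chi(\xi)|^2+\sum_{i\in I_\ast}|m_i(\xi)|^2=1$ for a.e. $\xi$, $\operatorname{supp}\widehat\chi\subset Q_0$ and $\operatorname{supp}m_i\subset Q_i$ for all $i\in I_\ast$. First-layer scattering: $\mathsf S_{\chi,1}f=(|f*\psi_i|*\chi)_{i\in I_\ast}$. Linear filter transform: $\mathcal Wf=(f*\chi,(f*\psi_i)_{i\in I_\ast})$, and $[\mathcal W,L_\tau]f=\mathcal W(L_\tau f)-L_\tau(\mathcal Wf)$. Active-core system (exists whenever $\beta<1$; one is fixed): $j_0\in\mathbb N$, $r_0>0$, indices $i_j\in I_\ast$, points $\xi_j\in P_{i_j}$ and matrices $M_j\in\mathbb R^{2\times2}$, $j\ge j_0$, with $|\xi_j|\asymp2^j$, $B_{r_0}(\xi_j)\subset P_{i_j}\subset Q_{i_j}$, $\|M_j\|\asymp2^{-(1-\beta)j}$, $\mathrm{Id}-M_j$ invertible, and, for every $0<\rho\le r_0$ and $i\in I$: $Q_i\cap B_\rho(\xi_j)\ne\varnothing$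 implies $Q_i\cap(\mathrm{Id}-M_j)B_\rho(\xi_j)=\varnothing$. (AC): there is $c_{\rm act}>0$ with $|m_{i_j}(\xi)|\ge c_{\rm act}$ for all $\xi\in B_{r_0}(\xi_j)$ and all $j\ge j_0$. (R): there is $C_{\rm reg}<\infty$ with $\sup_{j\ge j_0}\|\nabla m_{i_j}\|_{L^\infty(B_{r_0}(\xi_j))}\le C_{\rm reg}$. *)

theory Defs
  imports "HOL-Analysis.Analysis" "HOL-Probability.Essential_Supremum"
begin

section \<open>Smooth functions on the plane\<close>

definition partial :: "2 \<Rightarrow> (real^2 \<Rightarrow> 'b::real_normed_vector) \<Rightarrow> real^2 \<Rightarrow> 'b" where
  "partial k f x = frechet_derivative f (at x) (axis k 1)"

text \<open>Since \<^const>\<open>frechet_derivative\<close> is arbitrary where no derivative exists, smoothness asks every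
  iterated partial derivative to be (Frechet) differentiable everywhere.\<close>

definition smooth :: "(real^2 \<Rightarrow> 'b::real_normed_vector) \<Rightarrow> bool" where
  "smooth f \<longleftrightarrow> (\<forall>ks. foldr partial ks f differentiable_on UNIV)"

definition multi_partial ::
    "nat \<times> nat \<Rightarrow> (real^2 \<Rightarrow> 'b::real_normed_vector) \<Rightarrow> real^2 \<Rightarrow> 'b" where
  "multi_partial \<nu> f = (partial 1 ^^ fst \<nu>) ((partial 2 ^^ snd \<nu>) f)"

definition supp :: "('a::topological_space \<Rightarrow> 'b::zero) \<Rightarrow> 'a set" where
  "supp f = closure {x. f x \<noteq> 0}"

definition test_function :: "(real^2 \<Rightarrow> 'b::real_normed_vector) \<Rightarrow> bool" where
  "test_function f \<longleftrightarrow> smooth f \<and> compact (supp f)"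

definition schwartz :: "(real^2 \<Rightarrow> complex) \<Rightarrow> bool" where
  "schwartz f \<longleftrightarrow> smooth f \<and>
     (\<forall>n \<nu>. bounded (range (\<lambda>x. norm x ^ n *\<^sub>R multi_partial \<nu> f x)))"

section \<open>Norms\<close>

text \<open>All norms take values in \<open>[0, \<infinity>]\<close>, so that they are meaningful without any prior
  integrability or summability assumption.\<close>

definition sqrt_ennreal :: "ennreal \<Rightarrow> ennreal" where
  "sqrt_ennreal x = (if x = top then top else ennreal (sqrt (enn2real x)))"

definition L2_norm :: "(real^2 \<Rightarrow> 'b::real_normed_vector) \<Rightarrow> ennreal" where
  "L2_norm f = sqrt_ennreal (\<integral>\<^sup>+x. (ennreal (norm (f x)))\<^sup>2 \<partial>lborel)"

definition l2L2_norm :: "'i set \<Rightarrow> ('i \<Rightarrow> real^2 \<Rightarrow> complex) \<Rightarrow> ennreal" where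
  "l2L2_norm J q = sqrt_ennreal (\<Sum>\<^sub>\<infinity>p\<in>J. (L2_norm (q p))\<^sup>2)"

definition Linf_norm :: "(real^2) set \<Rightarrow> (real^2 \<Rightarrow> 'b::real_normed_vector) \<Rightarrow> ennreal" where
  "Linf_norm B f = esssup (restrict_space lborel B) (\<lambda>x. ennreal (norm (f x)))"

definition C_norm :: "nat \<Rightarrow> (real^2 \<Rightarrow> real^2) \<Rightarrow> ennreal" where
  "C_norm m \<tau> = (\<Sum>\<nu> | fst \<nu> + snd \<nu> \<le> m. Linf_norm UNIV (multi_partial \<nu> \<tau>))"

definition in_L1_L2 :: "(real^2 \<Rightarrow> complex) \<Rightarrow> bool" where
  "in_L1_L2 f \<longleftrightarrow> integrable lborel f \<and> integrable lborel (\<lambda>x. (norm (f x))\<^sup>2)"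

text \<open>\<open>G\<close> is the distributional gradient of \<open>m\<close> on the open set \<open>B\<close>.\<close>

definition has_weak_gradient ::
    "(real^2 \<Rightarrow> complex) \<Rightarrow> (real^2 \<Rightarrow> complex^2) \<Rightarrow> (real^2) set \<Rightarrow> bool" where
  "has_weak_gradient m G B \<longleftrightarrow>
     (\<forall>K. compact K \<and> K \<subseteq> B \<longrightarrow> set_integrable lborel K m \<and> set_integrable lborel K G) \<and>
     (\<forall>\<phi> :: real^2 \<Rightarrow> real. test_function \<phi> \<and> supp \<phi> \<subseteq> B \<longrightarrow>
        (\<forall>k. (LINT \<xi>:B|lborel. partial k \<phi> \<xi> *\<^sub>R m \<xi>)
              = - (LINT \<xi>:B|lborel. \<phi> \<xi> *\<^sub>R (G \<xi> $ k))))"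

section \<open>Fourier transform, convolution, deformation\<close>

definition fourier :: "(real^2 \<Rightarrow> complex) \<Rightarrow> real^2 \<Rightarrow> complex" where
  "fourier f \<xi> = (LINT x|lborel. exp (- (2 * of_real pi * \<i> * of_real (x \<bullet> \<xi>))) * f x)"

definition conv :: "(real^2 \<Rightarrow> complex) \<Rightarrow> (real^2 \<Rightarrow> complex) \<Rightarrow> real^2 \<Rightarrow> complex" where
  "conv f g x = (LINT y|lborel. f (x - y) * g y)"

definition deform :: "(real^2 \<Rightarrow> real^2) \<Rightarrow> (real^2 \<Rightarrow> complex) \<Rightarrow> real^2 \<Rightarrow> complex" where
  "deform \<tau> f x = f (x - \<tau> x)"

section \<open>The covering\<close>

type_synonym tile = "nat \<times> nat \<times> nat"

definition m_max :: "real \<Rightarrow> nat \<Rightarrow> nat" where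
  "m_max \<alpha> j = nat \<lceil>2 powr ((1 - \<alpha>) * real j - 1)\<rceil>"

definition l_max :: "real \<Rightarrow> nat \<Rightarrow> nat" where
  "l_max \<beta> j = nat \<lceil>10 * 2 powr ((1 - \<beta>) * real j)\<rceil>"

definition I_star :: "real \<Rightarrow> real \<Rightarrow> tile set" where
  "I_star \<alpha> \<beta> = {(j, m, l). 1 \<le> j \<and> m \<le> m_max \<alpha> j \<and> l \<le> l_max \<beta> j}"

text \<open>The low-pass index \<open>0\<close> of the covering is \<^const>\<open>None\<close>.\<close>

definition I_all :: "real \<Rightarrow> real \<Rightarrow> tile option set" where
  "I_all \<alpha> \<beta> = insert None (Some ` I_star \<alpha> \<beta>)"

definition dil :: "real \<Rightarrow> real \<Rightarrow> nat \<Rightarrow> real^2^2" where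
  "dil \<alpha> \<beta> j = vector [vector [2 powr (\<alpha> * real j), 0], vector [0, 2 powr (\<beta> * real j)]]"

definition centre :: "real \<Rightarrow> nat \<Rightarrow> nat \<Rightarrow> real^2" where
  "centre \<alpha> j m = vector [2 powr (real j - 1) + real m * 2 powr (\<alpha> * real j), 0]"

definition angle :: "real \<Rightarrow> nat \<Rightarrow> nat \<Rightarrow> real" where
  "angle \<beta> j l = 2 * real l * (pi / 10) * 2 powr ((\<beta> - 1) * real j)"

definition rot :: "real \<Rightarrow> real^2^2" where
  "rot \<theta> = vector [vector [cos \<theta>, - sin \<theta>], vector [sin \<theta>, cos \<theta>]]"

definition Q_ref :: "real \<Rightarrow> (real^2) set" where
  "Q_ref \<epsilon>0 = box (vector [- \<epsilon>0, -1 - \<epsilon>0]) (vector [1 + \<epsilon>0, 1 + \<epsilon>0])"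

definition P_ref :: "(real^2) set" where
  "P_ref = cbox (vector [0, -1]) (vector [1, 1])"

definition place :: "real \<Rightarrow> real \<Rightarrow> tile \<Rightarrow> (real^2) set \<Rightarrow> (real^2) set" where
  "place \<alpha> \<beta> i S = (case i of (j, m, l) \<Rightarrow>
     (\<lambda>x. rot (angle \<beta> j l) *v (dil \<alpha> \<beta> j *v x + centre \<alpha> j m)) ` S)"

fun Q_set :: "real \<Rightarrow> real \<Rightarrow> real \<Rightarrow> tile option \<Rightarrow> (real^2) set" where
  "Q_set \<alpha> \<beta> \<epsilon>0 None = ball 0 4"
| "Q_set \<alpha> \<beta> \<epsilon>0 (Some i) = place \<alpha> \<beta> i (Q_ref \<epsilon>0)"

fun P_set :: "real \<Rightarrow> real \<Rightarrow> tile option \<Rightarrow> (real^2) set" where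
  "P_set \<alpha> \<beta> None = ball 0 3"
| "P_set \<alpha> \<beta> (Some i) = place \<alpha> \<beta> i P_ref"

section \<open>Filter bank, scattering and the linear filter transform\<close>

definition scattering_bank ::
    "real \<Rightarrow> real \<Rightarrow> real \<Rightarrow> (real^2 \<Rightarrow> complex) \<Rightarrow> (tile \<Rightarrow> real^2 \<Rightarrow> complex) \<Rightarrow> bool" where
  "scattering_bank \<alpha> \<beta> \<epsilon>0 chi \<psi> \<longleftrightarrow>
     in_L1_L2 chi \<and> (\<forall>i \<in> I_star \<alpha> \<beta>. in_L1_L2 (\<psi> i)) \<and>
     (AE \<xi> in lborel.
        ((\<lambda>i. (norm (fourier (\<psi> i) \<xi>))\<^sup>2) has_sum (1 - (norm (fourier chi \<xi>))\<^sup>2)) (I_star \<alpha> \<beta>)) \<and>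
     supp (fourier chi) \<subseteq> Q_set \<alpha> \<beta> \<epsilon>0 None \<and>
     (\<forall>i \<in> I_star \<alpha> \<beta>. supp (fourier (\<psi> i)) \<subseteq> Q_set \<alpha> \<beta> \<epsilon>0 (Some i))"

definition scat1 ::
    "(real^2 \<Rightarrow> complex) \<Rightarrow> (tile \<Rightarrow> real^2 \<Rightarrow> complex) \<Rightarrow> (real^2 \<Rightarrow> complex)
       \<Rightarrow> tile \<Rightarrow> real^2 \<Rightarrow> complex" where
  "scat1 chi \<psi> f i = conv (\<lambda>x. complex_of_real (norm (conv f (\<psi> i) x))) chi"

definition filter_transform ::
    "(real^2 \<Rightarrow> complex) \<Rightarrow> (tile \<Rightarrow> real^2 \<Rightarrow> complex) \<Rightarrow> (real^2 \<Rightarrow> complex)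
       \<Rightarrow> tile option \<Rightarrow> real^2 \<Rightarrow> complex" where
  "filter_transform chi \<psi> f p = (case p of None \<Rightarrow> conv f chi | Some i \<Rightarrow> conv f (\<psi> i))"

definition filter_commutator ::
    "(real^2 \<Rightarrow> complex) \<Rightarrow> (tile \<Rightarrow> real^2 \<Rightarrow> complex) \<Rightarrow> (real^2 \<Rightarrow> real^2)
       \<Rightarrow> (real^2 \<Rightarrow> complex) \<Rightarrow> tile option \<Rightarrow> real^2 \<Rightarrow> complex" where
  "filter_commutator chi \<psi> \<tau> f p =
     (\<lambda>x. filter_transform chi \<psi> (deform \<tau> f) p x - deform \<tau> (filter_transform chi \<psi> f p) x)"

section \<open>Active cores\<close>

definition comparable_from :: "nat \<Rightarrow> (nat \<Rightarrow> real) \<Rightarrow> (nat \<Rightarrow> real) \<Rightarrow> bool" where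
  "comparable_from j0 X Y \<longleftrightarrow>
     (\<exists>a > 0. \<exists>b > 0. \<forall>j \<ge> j0. a * Y j \<le> X j \<and> X j \<le> b * Y j)"

text \<open>The matrix norm is the operator norm.\<close>

definition active_core_system ::
    "real \<Rightarrow> real \<Rightarrow> real \<Rightarrow> nat \<Rightarrow> real \<Rightarrow> (nat \<Rightarrow> tile) \<Rightarrow> (nat \<Rightarrow> real^2) \<Rightarrow> (nat \<Rightarrow> real^2^2) \<Rightarrow> bool"
  where
  "active_core_system \<alpha> \<beta> \<epsilon>0 j0 r0 idx \<zeta> M \<longleftrightarrow>
     1 \<le> j0 \<and> 0 < r0 \<and>
     comparable_from j0 (\<lambda>j. norm (\<zeta> j)) (\<lambda>j. 2 ^ j) \<and>
     comparable_from j0 (\<lambda>j. onorm ((*v) (M j))) (\<lambda>j. 2 powr (- (1 - \<beta>) * real j)) \<and>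
     (\<forall>j \<ge> j0.
        idx j \<in> I_star \<alpha> \<beta> \<and>
        \<zeta> j \<in> P_set \<alpha> \<beta> (Some (idx j)) \<and>
        ball (\<zeta> j) r0 \<subseteq> P_set \<alpha> \<beta> (Some (idx j)) \<and>
        P_set \<alpha> \<beta> (Some (idx j)) \<subseteq> Q_set \<alpha> \<beta> \<epsilon>0 (Some (idx j)) \<and>
        invertible (mat 1 - M j) \<and>
        (\<forall>\<rho> p. 0 < \<rho> \<and> \<rho> \<le> r0 \<and> p \<in> I_all \<alpha> \<beta> \<and>
           Q_set \<alpha> \<beta> \<epsilon>0 p \<inter> ball (\<zeta> j) \<rho> \<noteq> {} \<longrightarrow>
           Q_set \<alpha> \<beta> \<epsilon>0 p \<inter> (*v) (mat 1 - M j) ` ball (\<zeta> j) \<rho> = {}))"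

definition active_core_condition ::
    "nat \<Rightarrow> real \<Rightarrow> (nat \<Rightarrow> tile) \<Rightarrow> (nat \<Rightarrow> real^2) \<Rightarrow> (tile \<Rightarrow> real^2 \<Rightarrow> complex) \<Rightarrow> bool" where
  "active_core_condition j0 r0 idx \<zeta> \<psi> \<longleftrightarrow>
     (\<exists>c > 0. \<forall>j \<ge> j0. \<forall>\<xi> \<in> ball (\<zeta> j) r0. c \<le> norm (fourier (\<psi> (idx j)) \<xi>))"

text \<open>The gradient is taken in the distributional sense, which includes every multiplier that is
  differentiable on the ball with bounded classical gradient.\<close>

definition active_core_regularity ::
    "nat \<Rightarrow> real \<Rightarrow> (nat \<Rightarrow> tile) \<Rightarrow> (nat \<Rightarrow> real^2) \<Rightarrow> (tile \<Rightarrow> real^2 \<Rightarrow> complex) \<Rightarrow> bool" where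
  "active_core_regularity j0 r0 idx \<zeta> \<psi> \<longleftrightarrow>
     (\<exists>C :: real. \<forall>j \<ge> j0. \<exists>G. has_weak_gradient (fourier (\<psi> (idx j))) G (ball (\<zeta> j) r0) \<and>
        Linf_norm (ball (\<zeta> j) r0) G \<le> ennreal C)"

end

theory Submission
  imports Defs "HOL-Probability.Characteristic_Functions" "HOL-Computational_Algebra.Polynomial"
begin

text \<open>The test functions are wave packets
\<open>f\<^sub>j(x) = sqrt(2 a) exp(2 \<pi> i x \<bullet> \<zeta>\<^sub>j) exp(- \<pi> a |x|\<^sup>2)\<close> centred at the active frequencies \<open>\<zeta>\<^sub>j\<close>,
and the deformations are localised linear maps \<open>\<tau>\<^sub>j(x) = M\<^sub>j\<^sup>T (\<kappa>(|x|\<^sup>2) x)\<close>, where the smooth cutoff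
\<open>\<kappa>(|x|\<^sup>2)\<close> equals 1 for \<open>|x| \<le> R\<close>. The parameters \<open>a\<close>, \<open>R\<close> and the cutoff do not depend on \<open>j\<close>, so
all derivatives of \<open>\<tau>\<^sub>j\<close> are bounded by a constant times the norm of \<open>M\<^sub>j\<close>.

\<^bold>\<open>The deformed packet leaves the tile.\<close> Where the cutoff is 1, deforming replaces \<open>x\<close> by
\<open>(Id - M\<^sub>j)\<^sup>T x\<close>, which maps the spectrum by \<open>Id - M\<^sub>j\<close>. For small \<open>a\<close> nearly all of the spectrum of
\<open>f\<^sub>j\<close> lies in a small ball around \<open>\<zeta>\<^sub>j\<close>, and the tile \<open>Q\<close> of the active filter \<open>\<psi>\<close> misses the image
of this ball. For large \<open>R\<close> the cutoff only affects the Gaussian tail, and it does so uniformly in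
\<open>j\<close>, because a modulus estimate ignores the rapidly varying phases. Hence the convolution of the
deformed packet with \<open>\<psi>\<close> has as little energy as desired (\<open>deformed_packet_leak\<close>).

\<^bold>\<open>The original packet stays visible after modulus and averaging.\<close> The function \<open>F = f\<^sub>j * \<psi>\<close> has
energy bounded below, since the multiplier is bounded below on the active core. The modulus destroys
the frequency localisation of \<open>F\<close>, but it cannot remove the energy from the low frequencies passed by
\<open>\<chi>\<close>: for a kernel \<open>G \<ge> 0\<close> and the character \<open>e(x) = exp(2 \<pi> i x \<bullet> \<zeta>\<^sub>j)\<close> one has
\<open>|F * (e G)| \<le> |F| * G\<close> pointwise. If \<open>G\<close> is a Gaussian, then by Plancherel the left-hand side keeps
the part of \<open>F\<close> with frequencies near \<open>\<zeta>\<^sub>j\<close>, while the right-hand side contains only low frequencies of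
\<open>|F|\<close>, up to an exponentially small error. No band-pass tile meets the ball of radius 15/16 around the origin, so
the Fourier transform of \<open>\<chi>\<close> has modulus 1 there, and the energy of \<open>|F| * \<chi>\<close> is bounded below
(\<open>modulus_lowpass_lower_bound\<close>, \<open>core_modulus_lower_bound\<close>).

The two facts together separate the scattering coefficients at the active index. For the commutator,
the change of variables \<open>x \<mapsto> x - \<tau>\<^sub>j(x)\<close> distorts energies by at most a constant factor
(\<open>sq_mass_le_deform\<close>). So deforming \<open>F\<close> keeps its energy, whereas filtering the deformed packet loses
it.

Two tools carry this. Plancherel's theorem is proved for functions that are continuous, bounded and
integrable; this class contains the packets, their deformations and all convolutions that occur, and it
is stable under taking the modulus. Smoothness is handled through spans of functions
\<open>p(x) \<phi>\<^sub>n(|x|\<^sup>2) e(x)\<close>, where \<open>\<phi>\<^sub>n\<close> is the \<open>n\<close>-th derivative of a profile; these spans are closed under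
partial derivatives and contain both the packets and the localised linear maps.\<close>

section \<open>Plane waves and symmetries of Lebesgue measure\<close>

definition wave :: "real^2 \<Rightarrow> real^2 \<Rightarrow> complex" where
  "wave \<xi> x = cis (2 * pi * (x \<bullet> \<xi>))"

lemma norm_wave [simp]: "norm (wave \<xi> x) = 1"
  by (simp add: wave_def)

lemma continuous_wave [continuous_intros]:
  "continuous_on S f \<Longrightarrow> continuous_on S g \<Longrightarrow> continuous_on S (\<lambda>x. wave (f x) (g x))"
  unfolding wave_def by (intro continuous_intros)

lemma measurable_wave [measurable]:
  assumes [measurable]: "f \<in> borel_measurable N" "g \<in> borel_measurable N"
  shows "(\<lambda>x. wave (f x) (g x)) \<in> borel_measurable N"
  unfolding wave_def cis_conv_exp by measurable

lemma wave_add: "wave \<xi> (x + y) = wave \<xi> x * wave \<xi> y"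
  by (simp add: wave_def cis_mult inner_simps algebra_simps)

lemma wave_add_left: "wave (\<xi> + \<eta>) x = wave \<xi> x * wave \<eta> x"
  by (simp add: wave_def cis_mult inner_simps algebra_simps)

lemma wave_minus_left: "wave (- \<xi>) x = cnj (wave \<xi> x)"
  by (simp add: wave_def cis_cnj)

lemma wave_flip: "wave (- \<xi>) x = wave (- x) \<xi>"
  by (simp add: wave_def inner_commute)

lemma wave_minus: "wave \<xi> (- x) = cnj (wave \<xi> x)"
  by (simp add: wave_def cis_cnj)

lemma wave_0 [simp]: "wave 0 x = 1" "wave \<xi> 0 = 1"
  by (simp_all add: wave_def)

lemma fourier_wave: "fourier f \<xi> = (LINT x|lborel. wave (- \<xi>) x * f x)"
  by (simp add: fourier_def wave_def cis_conv_exp mult_ac)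

lemma integral_lborel_shift:
  fixes f :: "real^2 \<Rightarrow> 'b::{banach,second_countable_topology}"
  assumes [measurable]: "f \<in> borel_measurable borel"
  shows "(LINT x|lborel. f (x + c)) = (LINT x|lborel. f x)"
  by (subst (2) lborel_distr_plus[of c, symmetric]) (simp add: integral_distr add.commute)

lemma integrable_lborel_shift:
  fixes f :: "real^2 \<Rightarrow> 'b::{banach,second_countable_topology}"
  assumes "integrable lborel f"
  shows "integrable lborel (\<lambda>x. f (x + c))"
proof -
  have "integrable (distr lborel borel ((+) c)) f"
    using assms by (simp add: lborel_distr_plus)
  then show ?thesis
    by (subst (asm) integrable_distr_eq) (use assms in \<open>auto simp: add.commute\<close>)
qed

lemma lborel_distr_uminus_plane: "distr lborel borel uminus = (lborel :: (real^2) measure)"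
  by (subst (2) lborel_affine[of "-1" 0]) (auto simp: density_1)

lemma integral_lborel_reflect:
  fixes f :: "real^2 \<Rightarrow> 'b::{banach,second_countable_topology}"
  assumes [measurable]: "f \<in> borel_measurable borel"
  shows "(LINT x|lborel. f (- x)) = (LINT x|lborel. f x)"
  by (subst (2) lborel_distr_uminus_plane[symmetric]) (simp add: integral_distr)

lemma integrable_lborel_reflect:
  fixes f :: "real^2 \<Rightarrow> 'b::{banach,second_countable_topology}"
  assumes "integrable lborel f"
  shows "integrable lborel (\<lambda>x. f (- x))"
proof -
  have "integrable (distr lborel borel uminus) f"
    using assms by (simp add: lborel_distr_uminus_plane)
  then show ?thesis
    by (subst (asm) integrable_distr_eq) (use assms in auto)
qed

lemma nn_integral_lborel_shift:
  fixes f :: "real^2 \<Rightarrow> ennreal"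
  assumes [measurable]: "f \<in> borel_measurable borel"
  shows "(\<integral>\<^sup>+x. f (x + c) \<partial>lborel) = (\<integral>\<^sup>+x. f x \<partial>lborel)"
  by (subst (2) lborel_distr_plus[of c, symmetric]) (simp add: nn_integral_distr add.commute)

section \<open>Fourier transform and convolution\<close>

lemma integrable_wave_mult:
  assumes "integrable lborel f"
  shows "integrable lborel (\<lambda>x. wave \<xi> x * f x)"
  by (rule Bochner_Integration.integrable_bound[OF assms]) (use assms in \<open>auto simp: norm_mult\<close>)

lemma norm_fourier_le: "norm (fourier f \<xi>) \<le> (LINT x|lborel. norm (f x))"
  unfolding fourier_wave by (rule order_trans[OF integral_norm_bound]) (simp add: norm_mult)

text \<open>Dominated convergence, with the modulus of the function itself as the majorant.\<close>

lemma continuous_on_fourier: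
  assumes f: "integrable lborel f"
  shows "continuous_on UNIV (fourier f)"
proof -
  have [measurable]: "f \<in> borel_measurable borel"
    using f by auto
  show ?thesis
    unfolding continuous_on_sequentially fourier_wave comp_def
  proof safe
    fix X :: "nat \<Rightarrow> real^2" and \<xi> assume X: "X \<longlonglongrightarrow> \<xi>"
    show "(\<lambda>n. LINT x|lborel. wave (- X n) x * f x) \<longlonglongrightarrow> (LINT x|lborel. wave (- \<xi>) x * f x)"
    proof (rule integral_dominated_convergence[where w = "\<lambda>x. norm (f x)"])
      show "AE x in lborel. (\<lambda>n. wave (- X n) x * f x) \<longlonglongrightarrow> wave (- \<xi>) x * f x"
        unfolding wave_def cis_conv_exp by (intro AE_I2 tendsto_intros X)
    qed (use f in \<open>auto simp: norm_mult\<close>)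
  qed
qed

lemma measurable_fourier [measurable (raw)]:
  assumes "integrable lborel f"
  shows "fourier f \<in> borel_measurable borel"
  using continuous_on_fourier[OF assms] by (rule borel_measurable_continuous_onI)

text \<open>Integrating first in \<open>x\<close> gives the product of the two \<open>L\<^sup>1\<close> norms, by translation invariance; Fubini
  and Tonelli then apply in either order.\<close>

lemma integrable_conv_pair:
  fixes f g :: "real^2 \<Rightarrow> complex"
  assumes f: "integrable lborel f" and g: "integrable lborel g"
  shows "integrable (lborel \<Otimes>\<^sub>M lborel) (\<lambda>(x, y). f (x - y) * g y :: complex)"
proof -
  have [measurable]: "f \<in> borel_measurable borel" "g \<in> borel_measurable borel"
    using f g by auto
  have "integrable (lborel \<Otimes>\<^sub>M lborel) (\<lambda>(y, x). f (x - y) * g y)"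
  proof (rule lborel_pair.Fubini_integrable)
    have "(LINT x|lborel. norm (f (x - y) * g y)) = (LINT x|lborel. norm (f x)) * norm (g y)" for y
      using integral_lborel_shift[of "\<lambda>x. norm (f x)" "- y"] by (simp add: norm_mult)
    then show "integrable lborel (\<lambda>y. LINT x|lborel. norm (case (y, x) of (y, x) \<Rightarrow> f (x - y) * g y))"
      using g by simp
    show "AE y in lborel. integrable lborel (\<lambda>x. case (y, x) of (y, x) \<Rightarrow> f (x - y) * g y)"
      using integrable_lborel_shift[OF f, of "- y" for y] by auto
  qed measurable
  then show ?thesis
    by (subst lborel_pair.integrable_product_swap_iff[symmetric]) (simp add: case_prod_unfold)
qed

lemma integrable_conv:
  assumes "integrable lborel f" "integrable lborel g"
  shows "integrable lborel (conv f g)"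
  using lborel_pair.integrable_fst'[OF integrable_conv_pair[OF assms]]
  unfolding conv_def[abs_def] by simp

lemma fourier_conv:
  assumes f: "integrable lborel f" and g: "integrable lborel g"
  shows "fourier (conv f g) \<xi> = fourier f \<xi> * fourier g \<xi>"
proof -
  have [measurable]: "f \<in> borel_measurable borel" "g \<in> borel_measurable borel"
    using f g by auto
  let ?w = "\<lambda>x. wave (- \<xi>) x"
  have int: "integrable (lborel \<Otimes>\<^sub>M lborel) (\<lambda>(x, y). ?w x * (f (x - y) * g y))"
    by (rule Bochner_Integration.integrable_bound[OF integrable_conv_pair[OF f g]])
       (auto simp: norm_mult)
  have "fourier (conv f g) \<xi> = (LINT x|lborel. LINT y|lborel. ?w x * (f (x - y) * g y))"
    unfolding fourier_wave conv_def by simp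
  also have "\<dots> = (LINT y|lborel. LINT x|lborel. ?w x * (f (x - y) * g y))"
    using lborel_pair.Fubini_integral[OF int] by simp
  also have "(\<lambda>y. LINT x|lborel. ?w x * (f (x - y) * g y)) = (\<lambda>y. fourier f \<xi> * (?w y * g y))"
  proof
    fix y
    have "(LINT x|lborel. ?w x * (f (x - y) * g y)) = (LINT x|lborel. ?w (x + y) * (f x * g y))"
      using integral_lborel_shift[of "\<lambda>x. ?w x * (f (x - y) * g y)" y] by simp
    also have "\<dots> = (LINT x|lborel. (?w x * f x) * (?w y * g y))"
      by (simp add: wave_add mult_ac)
    finally show "(LINT x|lborel. ?w x * (f (x - y) * g y)) = fourier f \<xi> * (?w y * g y)"
      by (simp add: fourier_wave)
  qed
  finally show ?thesis
    by (simp add: fourier_wave)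
qed

text \<open>This is Fubini for the symmetric kernel \<open>exp(- 2 \<pi> i x \<bullet> \<xi>)\<close>. It stands in for Fourier inversion in the
  proof of Plancherel's theorem: with a Gaussian \<open>v\<close> both sides are explicit averages.\<close>

lemma fourier_multiplication_formula:
  assumes u: "integrable lborel u" and v: "integrable lborel v"
  shows "(LINT \<xi>|lborel. fourier u \<xi> * v \<xi>) = (LINT x|lborel. u x * fourier v x)"
proof -
  have [measurable]: "u \<in> borel_measurable borel" "v \<in> borel_measurable borel"
    using u v by auto
  let ?K = "\<lambda>\<xi> x. wave (- \<xi>) x * (u x * v \<xi>)"
  have int: "integrable (lborel \<Otimes>\<^sub>M lborel) (\<lambda>(\<xi>, x). ?K \<xi> x)"
  proof (rule lborel_pair.Fubini_integrable)
    show "integrable lborel (\<lambda>\<xi>. LINT x|lborel. norm (case (\<xi>, x) of (\<xi>, x) \<Rightarrow> ?K \<xi> x))"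
      using v by (simp add: norm_mult)
    have "integrable lborel (\<lambda>x. wave (- \<xi>) x * u x * v \<xi>)" for \<xi>
      using integrable_wave_mult[OF u, of "- \<xi>"] by simp
    then show "AE \<xi> in lborel. integrable lborel (\<lambda>x. case (\<xi>, x) of (\<xi>, x) \<Rightarrow> ?K \<xi> x)"
      by (auto simp: mult_ac)
  qed measurable
  have "(LINT \<xi>|lborel. fourier u \<xi> * v \<xi>) = (LINT \<xi>|lborel. LINT x|lborel. ?K \<xi> x)"
    unfolding fourier_wave by (simp flip: mult.assoc)
  also have "\<dots> = (LINT x|lborel. LINT \<xi>|lborel. ?K \<xi> x)"
    using lborel_pair.Fubini_integral[OF int] by simp
  also have "\<dots> = (LINT x|lborel. u x * fourier v x)"
    unfolding fourier_wave
    by (simp flip: integral_mult_right_zero add: mult_ac wave_flip[of _ x for x])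
  finally show ?thesis .
qed

lemma fourier_modulate: "fourier (\<lambda>x. wave \<zeta> x * f x) \<xi> = fourier f (\<xi> - \<zeta>)"
proof -
  have "wave (- \<xi>) x * (wave \<zeta> x * f x) = wave (- (\<xi> - \<zeta>)) x * f x" for x
    unfolding mult.assoc[symmetric] wave_add_left[symmetric] by simp
  then show ?thesis
    by (simp only: fourier_wave)
qed

section \<open>Gaussians\<close>

definition gauss :: "real \<Rightarrow> real^2 \<Rightarrow> real" where
  "gauss a x = exp (- (pi * a * (x \<bullet> x)))"

lemma gauss_pos [simp]: "0 < gauss a x" "0 \<le> gauss a x"
  by (simp_all add: gauss_def)

lemma measurable_gauss [measurable]: "gauss a \<in> borel_measurable borel"
  unfolding gauss_def[abs_def] by measurable

text \<open>The characteristic function of the standard normal distribution, rescaled.\<close>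

lemma gaussian_fourier_1d:
  fixes a t :: real
  assumes a: "0 < a"
  shows "integrable lborel (\<lambda>x. cis (- (2 * pi * (x * t))) * complex_of_real (exp (- (pi * a * x\<^sup>2))))" (is "integrable _ ?f")
    and "(LINT x|lborel. cis (- (2 * pi * (x * t))) * complex_of_real (exp (- (pi * a * x\<^sup>2))))
           = complex_of_real (exp (- (pi * t\<^sup>2 / a)) / sqrt a)"
proof -
  define c where "c = sqrt (2 * pi * a)"
  have c: "c > 0" "c\<^sup>2 = 2 * pi * a"
    using a by (auto simp: c_def)
  define s where "s = - (2 * pi * t / c)"
  let ?g = "\<lambda>y. std_normal_density y *\<^sub>R iexp (s * y) :: complex"
  have int: "integrable lborel ?g"
  proof (rule Bochner_Integration.integrable_bound[of _ std_normal_density])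
    show "integrable lborel std_normal_density"
      by simp
  qed auto
  have val: "(LINT y|lborel. ?g y) = complex_of_real (exp (- (s\<^sup>2) / 2))"
    using fun_cong[OF char_std_normal_distribution, of s]
    by (simp add: char_def integral_density normal_density_nonneg)
  have s2: "s\<^sup>2 / 2 = pi * t\<^sup>2 / a"
    using a c by (simp add: s_def power_divide power2_eq_square field_simps)
  have gf: "?g (c * x) = (1 / sqrt (2 * pi)) *\<^sub>R ?f x" for x
  proof -
    have "s * (c * x) = - (2 * pi * (x * t))"
      using c by (simp add: s_def)
    moreover have "(c * x)\<^sup>2 / 2 = pi * a * x\<^sup>2"
      using c by (simp add: power_mult_distrib)
    ultimately show ?thesis
      by (simp add: normal_density_def cis_conv_exp scaleR_conv_of_real)
  qed
  have "integrable lborel (\<lambda>x. ?g (0 + c * x))"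
    using int c by (subst lborel_integrable_real_affine_iff) auto
  then have "integrable lborel (\<lambda>x. (1 / sqrt (2 * pi)) *\<^sub>R ?f x)"
    by (simp only: gf add_0)
  then have "integrable lborel (\<lambda>x. sqrt (2 * pi) *\<^sub>R ((1 / sqrt (2 * pi)) *\<^sub>R ?f x))"
    by (rule integrable_scaleR_right)
  then show "integrable lborel ?f"
    by simp
  have "(LINT y|lborel. ?g y) = \<bar>c\<bar> *\<^sub>R (LINT x|lborel. ?g (0 + c * x))"
    using c by (intro lborel_integral_real_affine) auto
  also have "\<dots> = (c / sqrt (2 * pi)) *\<^sub>R (LINT x|lborel. ?f x)"
    using c by (simp only: gf add_0 integral_scaleR_right) simp
  also have "c / sqrt (2 * pi) = sqrt a"
    using a by (simp add: c_def real_sqrt_mult)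
  finally have "sqrt a *\<^sub>R (LINT x|lborel. ?f x) = complex_of_real (exp (- (pi * t\<^sup>2 / a)))"
    using val s2 by simp
  then show "(LINT x|lborel. ?f x) = complex_of_real (exp (- (pi * t\<^sup>2 / a)) / sqrt a)"
    using a by (simp add: scaleR_conv_of_real field_simps)
qed

lemma Basis_plane: "(Basis :: (real^2) set) = {axis 1 1, axis 2 1}"
  by (auto simp: Basis_vec_def) (metis exhaust_2)

lemma axis_1_neq_2: "axis 1 1 \<noteq> (axis 2 1 :: real^2)"
  by (simp add: axis_eq_axis)

text \<open>Lebesgue measure on the plane is the product of two copies of the measure on the line, here in the
  form needed for integrands that separate in the two coordinates.\<close>

lemma lborel_plane_prod:
  fixes F :: "2 \<Rightarrow> real \<Rightarrow> complex"
  assumes int: "\<And>k. integrable lborel (F k)"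
  shows "integrable lborel (\<lambda>x::real^2. F 1 (x $ 1) * F 2 (x $ 2))" 
    and "(LINT x::real^2|lborel. F 1 (x $ 1) * F 2 (x $ 2)) = (LINT t|lborel. F 1 t) * (LINT t|lborel. F 2 t)"
proof -
  have [measurable]: "F k \<in> borel_measurable borel" for k
    using int[of k] by auto
  interpret product_sigma_finite "\<lambda>_::real^2. lborel :: real measure" ..
  define G where "G b = F (if b = axis 1 1 then 1 else 2)" for b :: "real^2"
  have G: "integrable lborel (G b)" for b
    by (simp add: G_def int)
  have prod: "(\<Prod>b\<in>Basis. G b (f b)) = F 1 (f (axis 1 1)) * F 2 (f (axis 2 1))" for f
    using axis_1_neq_2 by (simp add: Basis_plane G_def)
  have nth: "(\<Sum>b\<in>Basis. f b *\<^sub>R b) $ 1 = f (axis 1 1)" "(\<Sum>b\<in>Basis. f b *\<^sub>R b) $ 2 = f (axis 2 1)"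
    for f :: "real^2 \<Rightarrow> real"
    using axis_1_neq_2 by (simp_all add: Basis_plane, simp_all add: axis_def)
  show "integrable lborel (\<lambda>x::real^2. F 1 (x $ 1) * F 2 (x $ 2))"
    using product_integrable_prod[of Basis G] G
    by (subst lborel_eq, subst integrable_distr_eq) (simp_all only: nth prod, simp_all)
  show "(LINT x::real^2|lborel. F 1 (x $ 1) * F 2 (x $ 2)) = (LINT t|lborel. F 1 t) * (LINT t|lborel. F 2 t)"
    using product_integral_prod[of Basis G] G axis_1_neq_2
    by (subst lborel_eq, subst integral_distr) (simp_all only: nth prod, simp_all, simp add: Basis_plane G_def)
qed

lemma
  assumes a: "0 < a"
  shows integrable_gauss_complex: "integrable lborel (\<lambda>x. complex_of_real (gauss a x))"
    and fourier_gauss: "fourier (\<lambda>x. complex_of_real (gauss a x)) \<xi> = complex_of_real (gauss (1 / a) \<xi> / a)"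
proof -
  define F where "F \<xi> k = (\<lambda>x. cis (- (2 * pi * (x * (\<xi> $ k)))) * complex_of_real (exp (- (pi * a * x\<^sup>2))))" for \<xi> :: "real^2" and k
  have eq: "wave (- \<xi>) x * complex_of_real (gauss a x) = F \<xi> 1 (x $ 1) * F \<xi> 2 (x $ 2)" for x \<xi>
  proof -
    have "F \<xi> 1 (x $ 1) * F \<xi> 2 (x $ 2) = cis (- (2 * pi * (x$1 * (\<xi> $ 1))) + - (2 * pi * (x$2 * (\<xi> $ 2))))
       * complex_of_real (exp (- (pi * a * (x$1)\<^sup>2) + - (pi * a * (x$2)\<^sup>2)))"
      unfolding F_def exp_add cis_mult[symmetric] by simp
    also have "\<dots> = wave (- \<xi>) x * complex_of_real (gauss a x)"
      by (simp add: wave_def gauss_def inner_vec_def sum_2 power2_eq_square algebra_simps)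
    finally show ?thesis ..
  qed
  have F: "integrable lborel (F \<xi> k)" for \<xi> k
    using gaussian_fourier_1d(1)[OF a] by (simp add: F_def)
  show "integrable lborel (\<lambda>x. complex_of_real (gauss a x))"
    using lborel_plane_prod(1)[of "F 0", OF F] by (simp flip: eq)
  have "fourier (\<lambda>x. complex_of_real (gauss a x)) \<xi> = (LINT t|lborel. F \<xi> 1 t) * (LINT t|lborel. F \<xi> 2 t)"
    unfolding fourier_wave eq by (rule lborel_plane_prod(2)[OF F])
  also have "\<dots> = complex_of_real (exp (- (pi * (\<xi> $ 1)\<^sup>2 / a)) / sqrt a) *
      complex_of_real (exp (- (pi * (\<xi> $ 2)\<^sup>2 / a)) / sqrt a)"
    unfolding F_def gaussian_fourier_1d(2)[OF a] ..
  also have "\<dots> = complex_of_real (exp (- (pi * (\<xi> $ 1)\<^sup>2 / a) + - (pi * (\<xi> $ 2)\<^sup>2 / a)) / (sqrt a * sqrt a))"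
    unfolding exp_add of_real_mult[symmetric] by simp
  also have "sqrt a * sqrt a = a"
    using a by simp
  also have "exp (- (pi * (\<xi> $ 1)\<^sup>2 / a) + - (pi * (\<xi> $ 2)\<^sup>2 / a)) = gauss (1 / a) \<xi>"
    by (simp add: gauss_def inner_vec_def sum_2 power2_eq_square add_divide_distrib algebra_simps)
  finally show "fourier (\<lambda>x. complex_of_real (gauss a x)) \<xi> = complex_of_real (gauss (1 / a) \<xi> / a)" .
qed

lemma integrable_gauss: "0 < a \<Longrightarrow> integrable lborel (gauss a)"
  using integrable_gauss_complex[of a] by (simp add: complex_of_real_integrable_eq)

lemma integral_gauss: "0 < a \<Longrightarrow> (LINT x|lborel. gauss a x) = 1 / a"
  using fourier_gauss[of a 0] unfolding fourier_wave
  by (simp add: gauss_def integral_complex_of_real del: of_real_divide flip: of_real_exp)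

lemma nn_integral_gauss: "0 < a \<Longrightarrow> (\<integral>\<^sup>+x. ennreal (gauss a x) \<partial>lborel) = ennreal (1 / a)"
  by (subst nn_integral_eq_integral) (simp_all add: integrable_gauss integral_gauss)

lemma gauss_mult: "gauss a x * gauss b x = gauss (a + b) x"
  by (simp add: gauss_def exp_add[symmetric] algebra_simps)

lemma gauss_scale: "gauss a (r *\<^sub>R x) = gauss (a * r\<^sup>2) x"
  by (simp add: gauss_def power2_eq_square mult_ac)

section \<open>Plancherel's theorem\<close>

definition sq_mass :: "(real^2 \<Rightarrow> 'b::real_normed_vector) \<Rightarrow> ennreal" where
  "sq_mass f = (\<integral>\<^sup>+x. (ennreal (norm (f x)))\<^sup>2 \<partial>lborel)"

text \<open>The class on which Plancherel's theorem is proved. Boundedness and integrability give square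
  integrability; continuity and boundedness make autocorrelations continuous, which lets Gaussian
  averages converge to the value at the origin without any density argument.\<close>

definition tame :: "(real^2 \<Rightarrow> complex) \<Rightarrow> bool" where
  "tame u \<longleftrightarrow> continuous_on UNIV u \<and> bounded (range u) \<and> integrable lborel u"

lemma tame_integrable: "tame u \<Longrightarrow> integrable lborel u"
  by (simp add: tame_def)

lemma tame_measurable: "tame u \<Longrightarrow> u \<in> borel_measurable borel"
  by (simp add: tame_def borel_measurable_continuous_onI)

lemma tame_bound:
  assumes "tame u"
  obtains B where "0 < B" "\<And>x. norm (u x) \<le> B"
  using assms unfolding tame_def bounded_pos by auto

lemma tame_norm: "tame u \<Longrightarrow> tame (\<lambda>x. complex_of_real (norm (u x)))"
  unfolding tame_def
  by (auto intro!: continuous_intros simp: bounded_iff complex_of_real_integrable_eq)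

lemma tame_diff:
  assumes "tame u" "tame v"
  shows "tame (\<lambda>x. u x - v x)"
proof -
  obtain B C where "\<And>x. norm (u x) \<le> B" "\<And>x. norm (v x) \<le> C"
    using assms by (metis tame_bound)
  then have "norm (u x - v x) \<le> B + C" for x
    by (rule order_trans[OF norm_triangle_ineq4 add_mono])
  then show ?thesis
    using assms unfolding tame_def bounded_iff by (auto intro!: continuous_intros)
qed

text \<open>Convolving with a function that is merely integrable stays in the class: all three properties pass
  through dominated convergence, the bound \<open>sup |u|\<close> times the \<open>L\<^sup>1\<close> norm, and Fubini.\<close>

lemma tame_conv:
  assumes u: "tame u" and g: "integrable lborel g"
  shows "tame (conv u g)"
  unfolding tame_def
proof (intro conjI)
  obtain B where B: "\<And>x. norm (u x) \<le> B" "B > 0"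
    using tame_bound[OF u] by metis
  have [measurable]: "u \<in> borel_measurable borel" "g \<in> borel_measurable borel"
    using tame_measurable[OF u] g by auto
  have cont: "isCont u x" for x
    using u by (simp add: tame_def continuous_on_eq_continuous_at)
  show "continuous_on UNIV (conv u g)"
    unfolding continuous_on_sequentially conv_def comp_def
  proof safe
    fix X :: "nat \<Rightarrow> real^2" and x assume X: "X \<longlonglongrightarrow> x"
    show "(\<lambda>n. LINT y|lborel. u (X n - y) * g y) \<longlonglongrightarrow> (LINT y|lborel. u (x - y) * g y)"
    proof (rule integral_dominated_convergence[where w = "\<lambda>y. B * norm (g y)"])
      show "AE y in lborel. (\<lambda>n. u (X n - y) * g y) \<longlonglongrightarrow> u (x - y) * g y"
        by (intro AE_I2 tendsto_intros isCont_tendsto_compose[OF cont] X)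
    qed (use g B in \<open>auto simp: norm_mult mult_right_mono\<close>)
  qed
  have "norm (conv u g x) \<le> B * (LINT y|lborel. norm (g y))" for x
  proof -
    have "norm (conv u g x) \<le> (LINT y|lborel. norm (u (x - y) * g y))"
      unfolding conv_def by (rule integral_norm_bound)
    also have "\<dots> \<le> (LINT y|lborel. B * norm (g y))"
    proof (rule integral_mono)
      show "integrable lborel (\<lambda>y. norm (u (x - y) * g y))"
        by (rule Bochner_Integration.integrable_bound[of _ "\<lambda>y. B * norm (g y)"])
           (use g B in \<open>auto simp: norm_mult mult_right_mono\<close>)
    qed (use g B in \<open>auto simp: norm_mult mult_right_mono\<close>)
    finally show ?thesis by simp
  qed
  then show "bounded (range (conv u g))"
    unfolding bounded_iff by blast
  show "integrable lborel (conv u g)"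
    using integrable_conv tame_integrable[OF u] g by blast
qed

lemma integrable_tame_sq:
  assumes u: "tame u"
  shows "integrable lborel (\<lambda>x. (norm (u x))\<^sup>2)" 
    and "sq_mass u = ennreal (LINT x|lborel. (norm (u x))\<^sup>2)"
proof -
  obtain B where B: "\<And>x. norm (u x) \<le> B" "B > 0"
    using tame_bound[OF u] by metis
  have [measurable]: "u \<in> borel_measurable borel"
    using tame_measurable[OF u] .
  show int: "integrable lborel (\<lambda>x. (norm (u x))\<^sup>2)"
    by (rule Bochner_Integration.integrable_bound[of _ "\<lambda>y. B * norm (u y)"])
       (use tame_integrable[OF u] B in \<open>auto simp: power2_eq_square mult_right_mono abs_mult\<close>)
  show "sq_mass u = ennreal (LINT x|lborel. (norm (u x))\<^sup>2)"
    unfolding sq_mass_def using nn_integral_eq_integral[OF int] by (simp add: ennreal_power)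
qed

lemma fourier_cnj_reflect:
  assumes [measurable]: "u \<in> borel_measurable borel"
  shows "fourier (\<lambda>x. cnj (u (- x))) \<xi> = cnj (fourier u \<xi>)"
proof -
  have "fourier (\<lambda>x. cnj (u (- x))) \<xi> = (LINT x|lborel. cnj (wave (- \<xi>) (- x) * u (- x)))"
    by (simp add: fourier_wave wave_minus wave_minus_left)
  also have "\<dots> = cnj (LINT x|lborel. wave (- \<xi>) (- x) * u (- x))"
    by (rule Bochner_Integration.integral_cnj)
  also have "\<dots> = cnj (fourier u \<xi>)"
    using integral_lborel_reflect[of "\<lambda>x. wave (- \<xi>) x * u x"] by (simp add: fourier_wave)
  finally show ?thesis .
qed

text \<open>Let \<open>w\<close> be the convolution of \<open>u\<close> with the reflected conjugate of \<open>u\<close>. Its Fourier transform is the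
  squared modulus of that of \<open>u\<close>, and \<open>w(0)\<close> is the energy of \<open>u\<close>. The multiplication formula with a
  Gaussian of parameter \<open>\<epsilon>\<close> turns the damped energy of the transform into a Gaussian average of \<open>w\<close> at
  scale \<open>sqrt \<epsilon>\<close>. As \<open>\<epsilon> \<rightarrow> 0\<close> the former increases to the full energy and the latter tends to \<open>w(0)\<close>.\<close>

theorem plancherel:
  assumes u: "tame u"
  shows "sq_mass (fourier u) = sq_mass u"
proof -
  have [measurable]: "u \<in> borel_measurable borel"
    using tame_measurable[OF u] .
  note int_u = tame_integrable[OF u]
  define v where "v = (\<lambda>x. cnj (u (- x)))"
  have int_v: "integrable lborel v"
    unfolding v_def using integrable_lborel_reflect[OF int_u] by simp
  define w where "w = conv u v"
  have tame_w: "tame w"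
    unfolding w_def by (rule tame_conv[OF u int_v])
  obtain B where B: "\<And>x. norm (w x) \<le> B" "B > 0"
    using tame_bound[OF tame_w] by metis
  have [measurable]: "w \<in> borel_measurable borel"
    using tame_measurable[OF tame_w] .
  have fw: "fourier w \<xi> = complex_of_real ((norm (fourier u \<xi>))\<^sup>2)" for \<xi>
    unfolding w_def fourier_conv[OF int_u int_v] 
    by (simp add: v_def fourier_cnj_reflect complex_norm_square del: of_real_power)
  have w0: "w 0 = complex_of_real (LINT x|lborel. (norm (u x))\<^sup>2)"
  proof -
    have "w 0 = (LINT y|lborel. complex_of_real ((norm (u (- y)))\<^sup>2))"
      unfolding w_def conv_def v_def by (simp add: complex_norm_square del: of_real_power)
    also have "\<dots> = (LINT y|lborel. complex_of_real ((norm (u y))\<^sup>2))"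
      by (rule integral_lborel_reflect) measurable
    finally show ?thesis
      by (simp add: integral_complex_of_real del: of_real_power)
  qed
  define a where "a n = 1 / real (Suc n)" for n
  have a: "a n > 0" "a \<longlonglongrightarrow> 0" for n
    unfolding a_def using LIMSEQ_inverse_real_of_nat by (simp_all add: inverse_eq_divide)
  define D where "D n = (LINT x|lborel. w (sqrt (a n) *\<^sub>R x) * complex_of_real (gauss 1 x))" for n
  have D: "(LINT \<xi>|lborel. (norm (fourier u \<xi>))\<^sup>2 * gauss (a n) \<xi>) = Re (D n)"
    "integrable lborel (\<lambda>\<xi>. (norm (fourier u \<xi>))\<^sup>2 * gauss (a n) \<xi>)" for n
  proof -
    have "complex_of_real (LINT \<xi>|lborel. (norm (fourier u \<xi>))\<^sup>2 * gauss (a n) \<xi>)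
        = (LINT \<xi>|lborel. fourier w \<xi> * complex_of_real (gauss (a n) \<xi>))"
      unfolding fw by (simp flip: integral_complex_of_real)
    also have "\<dots> = (LINT x|lborel. w x * complex_of_real (gauss (1 / a n) x / a n))"
      using fourier_multiplication_formula[OF tame_integrable[OF tame_w] integrable_gauss_complex[OF a(1)]]
      by (simp add: fourier_gauss[OF a(1)])
    \<comment> \<open>The substitution \<open>x = sqrt(a n) y\<close> turns the narrow Gaussian into the standard one.\<close>
    also have "\<dots> = D n"
    proof -
      define r where "r = sqrt (a n)"
      have r: "r > 0" "r * r = a n"
        using a(1)[of n] by (simp_all add: r_def)
      have "(LINT x|lborel. w x * complex_of_real (gauss (1 / a n) x / a n))
        = (LINT x|density (distr lborel borel (\<lambda>x. 0 + r *\<^sub>R x)) (\<lambda>_. ennreal (\<bar>r\<bar> ^ DIM(real^2))).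
              w x * complex_of_real (gauss (1 / a n) x / a n))"
        using r by (subst lborel_affine[of r 0]) (simp_all add: ennreal_power)
      also have "\<dots> = (LINT x|lborel. (r^2) *\<^sub>R (w (r *\<^sub>R x) * complex_of_real (gauss (1 / a n) (r *\<^sub>R x) / a n)))"
        using r by (subst integral_density) (simp_all add: integral_distr DIM_cart)
      also have "\<dots> = D n"
        unfolding D_def r_def[symmetric] gauss_scale using r a(1)[of n]
        by (intro Bochner_Integration.integral_cong) (simp_all add: power2_eq_square scaleR_conv_of_real)
      finally show ?thesis .
    qed
    finally have "complex_of_real (LINT \<xi>|lborel. (norm (fourier u \<xi>))\<^sup>2 * gauss (a n) \<xi>) = D n" .
    then show "(LINT \<xi>|lborel. (norm (fourier u \<xi>))\<^sup>2 * gauss (a n) \<xi>) = Re (D n)"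
      by (metis Re_complex_of_real)
    let ?K = "LINT x|lborel. norm (u x)"
    show "integrable lborel (\<lambda>\<xi>. (norm (fourier u \<xi>))\<^sup>2 * gauss (a n) \<xi>)"
    proof (rule Bochner_Integration.integrable_bound[of _ "\<lambda>\<xi>. ?K\<^sup>2 * gauss (a n) \<xi>"])
      show "(\<lambda>\<xi>. (norm (fourier u \<xi>))\<^sup>2 * gauss (a n) \<xi>) \<in> borel_measurable lborel"
        using measurable_fourier[OF int_u] by measurable
    qed (use a integrable_gauss norm_fourier_le[of u] in \<open>auto simp: power_mono mult_right_mono\<close>)
  qed
  have "D \<longlonglongrightarrow> (LINT x|lborel. w 0 * complex_of_real (gauss 1 x))"
    unfolding D_def
  proof (rule integral_dominated_convergence[where w = "\<lambda>x. B * gauss 1 x"])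
    have cont: "isCont w x" for x
      using tame_w by (simp add: tame_def continuous_on_eq_continuous_at)
    have "(\<lambda>n. sqrt (a n) *\<^sub>R x) \<longlonglongrightarrow> sqrt 0 *\<^sub>R x" for x :: "real^2"
      by (intro tendsto_intros a)
    then show "AE x in lborel. (\<lambda>n. w (sqrt (a n) *\<^sub>R x) * complex_of_real (gauss 1 x))
         \<longlonglongrightarrow> w 0 * complex_of_real (gauss 1 x)"
      by (intro AE_I2 tendsto_intros isCont_tendsto_compose[OF cont]) simp
  qed (use B integrable_gauss[of 1] in \<open>auto simp: norm_mult mult_right_mono\<close>)
  also have "(LINT x|lborel. w 0 * complex_of_real (gauss 1 x)) = w 0"
    using integral_gauss[of 1] by (simp add: integral_complex_of_real)
  finally have "(\<lambda>n. Re (D n)) \<longlonglongrightarrow> (LINT x|lborel. (norm (u x))\<^sup>2)"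
    using tendsto_Re[of D "w 0"] by (simp add: w0)
  then have lim1: "(\<lambda>n. ennreal (Re (D n))) \<longlonglongrightarrow> sq_mass u"
    unfolding integrable_tame_sq(2)[OF u] by (rule tendsto_ennrealI)
  have lim2: "(\<lambda>n. \<integral>\<^sup>+\<xi>. ennreal ((norm (fourier u \<xi>))\<^sup>2 * gauss (a n) \<xi>) \<partial>lborel)
         \<longlonglongrightarrow> (\<integral>\<^sup>+\<xi>. ennreal ((norm (fourier u \<xi>))\<^sup>2) \<partial>lborel)"
  proof (rule nn_integral_LIMSEQ)
    show "incseq (\<lambda>n \<xi>. ennreal ((norm (fourier u \<xi>))\<^sup>2 * gauss (a n) \<xi>))"
    proof (rule incseq_SucI, rule le_funI, rule ennreal_leI, rule mult_left_mono)
      fix n \<xi>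
      have "a (Suc n) \<le> a n"
        by (simp add: a_def field_simps)
      then show "gauss (a n) \<xi> \<le> gauss (a (Suc n)) \<xi>"
        by (simp add: gauss_def mult_left_mono mult_right_mono)
    qed simp
    show "(\<lambda>n. ennreal ((norm (fourier u \<xi>))\<^sup>2 * gauss (a n) \<xi>)) \<longlonglongrightarrow> ennreal ((norm (fourier u \<xi>))\<^sup>2)" for \<xi>
    proof (rule tendsto_ennrealI)
      have "(\<lambda>n. (norm (fourier u \<xi>))\<^sup>2 * gauss (a n) \<xi>) \<longlonglongrightarrow> (norm (fourier u \<xi>))\<^sup>2 * gauss 0 \<xi>"
        unfolding gauss_def by (intro tendsto_intros a)
      then show "(\<lambda>n. (norm (fourier u \<xi>))\<^sup>2 * gauss (a n) \<xi>) \<longlonglongrightarrow> (norm (fourier u \<xi>))\<^sup>2"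
        by (simp add: gauss_def)
    qed
  qed (use D(2) in auto)
  have "(\<integral>\<^sup>+\<xi>. ennreal ((norm (fourier u \<xi>))\<^sup>2 * gauss (a n) \<xi>) \<partial>lborel) = ennreal (Re (D n))" for n
    using D by (subst nn_integral_eq_integral) auto
  with lim2 have "(\<lambda>n. ennreal (Re (D n))) \<longlonglongrightarrow> sq_mass (fourier u)"
    by (simp add: sq_mass_def ennreal_power)
  then show ?thesis
    using lim1 by (rule LIMSEQ_unique)
qed

section \<open>Change of variables\<close>

text \<open>It suffices to compare both measures on boxes, and the measure of the preimage of a box with density
  \<open>|det \<phi>'|\<close> is the measure of the box by the change of variables formula for sets. In this form the
  result serves complex integrals and extended nonnegative integrals alike.\<close>

lemma distr_density_diffeo:
  fixes \<phi> :: "real^2 \<Rightarrow> real^2"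
  assumes der: "\<And>x. (\<phi> has_derivative \<phi>' x) (at x)" and bij: "bij \<phi>"
    and meas [measurable]: "(\<lambda>x. det (matrix (\<phi>' x))) \<in> borel_measurable borel"
  shows "distr (density lborel (\<lambda>x. ennreal \<bar>det (matrix (\<phi>' x))\<bar>)) borel \<phi> = lborel"
proof (rule lborel_eqI[symmetric])
  have cont: "continuous_on UNIV \<phi>"
    using has_derivative_continuous[OF der] by (simp add: continuous_on_eq_continuous_at)
  then have \<phi>_meas [measurable]: "\<phi> \<in> borel_measurable borel"
    by (rule borel_measurable_continuous_onI)
  fix l u :: "real^2" assume le: "\<And>b. b \<in> Basis \<Longrightarrow> l \<bullet> b \<le> u \<bullet> b"
  let ?S = "\<phi> -` box l u"
  have "open ?S"
    by (rule open_vimage[OF open_box cont])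
  then have S: "?S \<in> sets borel" by simp
  have img: "\<phi> ` ?S = box l u"
    using bij by (simp add: bij_def surj_image_vimage_eq)
  have "\<phi> ` ?S \<in> lmeasurable \<and> measure lebesgue (\<phi> ` ?S) = (\<Prod>b\<in>Basis. (u - l) \<bullet> b)"
    unfolding img using le by (auto simp: measure_lborel_box_eq inner_diff_left)
  then have "((\<lambda>x. \<bar>det (matrix (\<phi>' x))\<bar>) has_integral (\<Prod>b\<in>Basis. (u - l) \<bullet> b)) ?S"
    by (subst (asm) has_measure_differentiable_image[where f' = \<phi>'])
       (use der bij S in \<open>auto simp: bij_def intro: has_derivative_at_withinI inj_on_subset\<close>)
  then have "(\<integral>\<^sup>+x. ennreal \<bar>det (matrix (\<phi>' x))\<bar> * indicator ?S x \<partial>lborel) = ennreal (\<Prod>b\<in>Basis. (u - l) \<bullet> b)"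
    by (intro nn_integral_has_integral_lebesgue') auto
  then show "emeasure (distr (density lborel (\<lambda>x. ennreal \<bar>det (matrix (\<phi>' x))\<bar>)) borel \<phi>) (box l u)
      = ennreal (\<Prod>b\<in>Basis. (u - l) \<bullet> b)"
    using S by (simp add: emeasure_distr emeasure_density)
qed simp

lemma distr_density_linear:
  fixes A :: "real^2^2"
  assumes "invertible A"
  shows "distr (density lborel (\<lambda>_. ennreal \<bar>det A\<bar>)) borel ((*v) A) = lborel"
  using distr_density_diffeo[of "(*v) A" "\<lambda>_. (*v) A"] assms
  by (simp add: invertible_eq_bij bounded_linear_imp_has_derivative matrix_vector_mul_bounded_linear)

lemma nn_integral_linear:
  fixes A :: "real^2^2" and f :: "real^2 \<Rightarrow> ennreal"
  assumes A: "invertible A" and [measurable]: "f \<in> borel_measurable borel"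
  shows "(\<integral>\<^sup>+x. f x \<partial>lborel) = ennreal \<bar>det A\<bar> * (\<integral>\<^sup>+x. f (A *v x) \<partial>lborel)"
proof -
  have [measurable]: "(*v) A \<in> borel_measurable borel"
    by (intro borel_measurable_continuous_onI linear_continuous_on matrix_vector_mul_bounded_linear)
  show ?thesis
    by (subst distr_density_linear[OF A, symmetric])
       (simp add: nn_integral_distr nn_integral_density nn_integral_cmult)
qed

lemma integral_linear:
  fixes A :: "real^2^2" and f :: "real^2 \<Rightarrow> complex"
  assumes A: "invertible A" and [measurable]: "f \<in> borel_measurable borel"
  shows "(LINT x|lborel. f x) = \<bar>det A\<bar> *\<^sub>R (LINT x|lborel. f (A *v x))"
proof -
  have [measurable]: "(*v) A \<in> borel_measurable borel"
    by (intro borel_measurable_continuous_onI linear_continuous_on matrix_vector_mul_bounded_linear)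
  show ?thesis
    by (subst distr_density_linear[OF A, symmetric])
       (simp add: integral_distr integral_density)
qed

text \<open>The equation \<open>x - \<tau> x = y\<close> is a fixed point problem for the contraction \<open>x \<mapsto> y + \<tau> x\<close>.\<close>

lemma bij_id_minus_contraction:
  fixes \<tau> :: "'a::banach \<Rightarrow> 'a"
  assumes lip: "\<And>x y. norm (\<tau> x - \<tau> y) \<le> c * norm (x - y)" and c: "c < 1" "0 \<le> c"
  shows "bij (\<lambda>x. x - \<tau> x)"
proof (rule bijI)
  show "inj (\<lambda>x. x - \<tau> x)"
  proof (rule injI)
    fix x y assume "x - \<tau> x = y - \<tau> y"
    then have "x - y = \<tau> x - \<tau> y" by (simp add: algebra_simps)
    then have "norm (x - y) \<le> c * norm (x - y)" using lip[of x y] by simp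
    then have "(1 - c) * norm (x - y) \<le> 0" by (simp add: algebra_simps)
    then have "norm (x - y) \<le> 0" using c by (simp add: mult_le_0_iff)
    then show "x = y" by simp
  qed
  show "surj (\<lambda>x. x - \<tau> x)"
  proof (rule surjI)
    fix y
    have "\<exists>!x. y + \<tau> x = x"
      using lip c by (intro banach_fix_type[of c]) (auto simp: dist_norm)
    then have "\<exists>x. y + \<tau> x = x" by blast
    then have "y + \<tau> (SOME x. y + \<tau> x = x) = (SOME x. y + \<tau> x = x)" by (rule someI_ex)
    then show "(SOME x. y + \<tau> x = x) - \<tau> (SOME x. y + \<tau> x = x) = y"
      by (metis add_diff_cancel_right')
  qed
qed

lemma abs_matrix_entry_le:
  fixes A :: "real^2^2"
  assumes "\<And>x. norm (A *v x) \<le> c * norm x"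
  shows "\<bar>A $ i $ k\<bar> \<le> c"
proof -
  have "\<bar>A $ i $ k\<bar> = \<bar>(A *v axis k 1) $ i\<bar>"
    by (simp add: matrix_vector_mult_basis column_def)
  also have "\<dots> \<le> c"
    using component_le_norm_cart[of "A *v axis k 1" i] assms[of "axis k 1"] by simp
  finally show ?thesis .
qed

lemma abs_det_le:
  fixes A :: "real^2^2"
  assumes "\<And>x. norm (A *v x) \<le> 2 * norm x"
  shows "\<bar>det A\<bar> \<le> 8"
proof -
  note e = abs_matrix_entry_le[OF assms]
  have "\<bar>A$1$1 * A$2$2\<bar> \<le> 2 * 2" "\<bar>A$1$2 * A$2$1\<bar> \<le> 2 * 2"
    unfolding abs_mult by (intro mult_mono e; simp)+
  then show ?thesis by (simp add: det_2)
qed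

lemma abs_det_id_minus_ge:
  fixes M :: "real^2^2"
  assumes "\<And>x. norm (M *v x) \<le> norm x / 10"
  shows "\<bar>det (mat 1 - M)\<bar> \<ge> 1 / 2"
proof -
  have e: "\<bar>M $ i $ k\<bar> \<le> 1 / 10" for i k
    by (rule abs_matrix_entry_le) (use assms in simp)
  have "\<bar>M$1$1 * M$2$2\<bar> \<le> 1 / 10 * (1 / 10)" "\<bar>M$1$2 * M$2$1\<bar> \<le> 1 / 10 * (1 / 10)"
    unfolding abs_mult by (intro mult_mono e; simp)+
  moreover have "det (mat 1 - M) = 1 - M$1$1 - M$2$2 + M$1$1 * M$2$2 - M$1$2 * M$2$1"
    by (simp add: det_2 mat_def algebra_simps)
  ultimately show ?thesis using e[of 1 1] e[of 2 2] by (simp add: abs_if split: if_splits)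
qed

lemma norm_transpose_le:
  fixes M :: "real^2^2"
  assumes "\<And>x. norm (M *v x) \<le> c * norm x"
  shows "norm (transpose M *v x) \<le> c * norm x"
proof (cases "transpose M *v x = 0")
  case False
  let ?y = "transpose M *v x"
  have "(norm ?y)\<^sup>2 = x \<bullet> (M *v ?y)"
    by (simp add: power2_norm_eq_inner dot_lmul_matrix)
  also have "\<dots> \<le> norm x * norm (M *v ?y)" by (rule norm_cauchy_schwarz)
  also have "\<dots> \<le> norm x * (c * norm ?y)" by (intro mult_left_mono assms) simp
  finally have "norm ?y * norm ?y \<le> (c * norm x) * norm ?y" by (simp add: power2_eq_square mult_ac)
  then show ?thesis using False by simp
next
  case True
  have "0 \<le> c * norm x" using assms[of x] norm_ge_zero order_trans by blast
  then show ?thesis using True by simp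
qed

section \<open>Frequency localisation of the filter bank\<close>

lemma rot_norm: "norm (rot \<theta> *v x) = norm x"
proof -
  have "(c * a - s * b)\<^sup>2 + (s * a + c * b)\<^sup>2 = (s\<^sup>2 + c\<^sup>2) * (a\<^sup>2 + b\<^sup>2)" for a b c s :: real
    by algebra
  from this[of "cos \<theta>" "x $ 1" "sin \<theta>" "x $ 2"]
  have "(norm (rot \<theta> *v x))\<^sup>2 = (norm x)\<^sup>2"
    unfolding power2_norm_eq_inner
    by (simp add: rot_def inner_vec_def sum_2 matrix_vector_mult_def flip: power2_eq_square)
  then show ?thesis by simp
qed

text \<open>The first coordinate before rotation is at least
  \<open>2\<^sup>j\<^sup>-\<^sup>1 - \<epsilon>0 2\<^sup>\<alpha>\<^sup>j \<ge> (1/2 - 1/32) 2\<^sup>j \<ge> 15/16\<close>, and rotations preserve the norm.\<close>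

lemma tile_away_from_origin:
  assumes \<alpha>: "\<alpha> \<le> 1" and \<epsilon>: "0 < \<epsilon>0" "\<epsilon>0 < 1 / 32" and i: "i \<in> I_star \<alpha> \<beta>"
    and \<xi>: "\<xi> \<in> Q_set \<alpha> \<beta> \<epsilon>0 (Some i)"
  shows "15 / 16 \<le> norm \<xi>"
proof -
  obtain j m l where jml: "i = (j, m, l)" "1 \<le> j"
    using i by (auto simp: I_star_def)
  obtain x where x: "x \<in> Q_ref \<epsilon>0" "\<xi> = rot (angle \<beta> j l) *v (dil \<alpha> \<beta> j *v x + centre \<alpha> j m)"
    using \<xi> by (auto simp: jml place_def)
  let ?y = "dil \<alpha> \<beta> j *v x + centre \<alpha> j m"
  have "x $ 1 > - \<epsilon>0"
    using x(1) by (simp add: Q_ref_def mem_box_cart forall_2)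
  have pw: "2 powr (\<alpha> * real j) \<le> 2 powr real j"
    using mult_right_mono[OF \<alpha>, of "real j"] by (intro powr_mono) simp_all
  have two: "2 \<le> (2::real) powr real j"
    using powr_mono[of 1 "real j" 2] jml(2) by simp
  have "- (1 / 32) * 2 powr real j \<le> x $ 1 * 2 powr (\<alpha> * real j)"
  proof -
    have "- (1 / 32) * 2 powr real j \<le> - (1 / 32) * 2 powr (\<alpha> * real j)" using pw by simp
    also have "\<dots> \<le> x $ 1 * 2 powr (\<alpha> * real j)"
      using \<open>x $ 1 > - \<epsilon>0\<close> \<epsilon> by (intro mult_right_mono) auto
    finally show ?thesis .
  qed
  moreover have "?y $ 1 = x $ 1 * 2 powr (\<alpha> * real j) + (2 powr (real j - 1) + real m * 2 powr (\<alpha> * real j))"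
    by (simp add: dil_def centre_def matrix_vector_mult_def sum_2)
  moreover have "(2::real) powr (real j - 1) = 2 powr real j / 2"
    by (simp add: powr_diff)
  moreover have "0 \<le> real m * 2 powr (\<alpha> * real j)" by simp
  ultimately have "15 / 16 \<le> ?y $ 1"
    using two by linarith
  also have "\<dots> \<le> norm ?y"
    using component_le_norm_cart[of ?y 1] by simp
  finally show ?thesis
    using rot_norm[of "angle \<beta> j l" ?y] x(2) by simp
qed

lemma zero_outside_supp: "x \<notin> supp f \<Longrightarrow> f x = 0"
  using closure_subset[of "{x. f x \<noteq> 0}"] by (auto simp: supp_def)

text \<open>All summands of the partition of unity are nonnegative, so each is at most 1; near the origin all
  band-pass summands vanish, so the low-pass filter alone makes up the sum.\<close>

lemma bank_multiplier_bounds: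
  assumes \<alpha>: "\<alpha> \<le> 1" and \<epsilon>: "0 < \<epsilon>0" "\<epsilon>0 < 1 / 32" and bank: "scattering_bank \<alpha> \<beta> \<epsilon>0 chi \<psi>"
  shows "AE \<xi> in lborel. norm (fourier chi \<xi>) \<le> 1 \<and>
       (\<forall>i\<in>I_star \<alpha> \<beta>. norm (fourier (\<psi> i) \<xi>) \<le> 1) \<and>
       (norm \<xi> < 15 / 16 \<longrightarrow> norm (fourier chi \<xi>) = 1)"
proof -
  have "AE \<xi> in lborel.
        ((\<lambda>i. (norm (fourier (\<psi> i) \<xi>))\<^sup>2) has_sum (1 - (norm (fourier chi \<xi>))\<^sup>2)) (I_star \<alpha> \<beta>)"
    using bank by (simp add: scattering_bank_def)
  then show ?thesis
  proof (rule eventually_mono, intro conjI ballI impI)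
    fix \<xi>
    assume S: "((\<lambda>i. (norm (fourier (\<psi> i) \<xi>))\<^sup>2) has_sum (1 - (norm (fourier chi \<xi>))\<^sup>2)) (I_star \<alpha> \<beta>)"
    have nn: "0 \<le> 1 - (norm (fourier chi \<xi>))\<^sup>2"
      by (rule has_sum_nonneg[OF S]) simp
    then show "norm (fourier chi \<xi>) \<le> 1"
      using power2_le_imp_le[of "norm (fourier chi \<xi>)" 1] by simp
    {
      fix i assume "i \<in> I_star \<alpha> \<beta>"
      then have "(\<Sum>i\<in>{i}. (norm (fourier (\<psi> i) \<xi>))\<^sup>2) \<le> 1 - (norm (fourier chi \<xi>))\<^sup>2"
        by (intro finite_sum_le_has_sum[OF S]) auto
      also have "\<dots> \<le> 1" by simp
      finally show "norm (fourier (\<psi> i) \<xi>) \<le> 1"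
        using power2_le_imp_le[of "norm (fourier (\<psi> i) \<xi>)" 1] by simp
    }
    assume \<xi>: "norm \<xi> < 15 / 16"
    have "fourier (\<psi> i) \<xi> = 0" if i: "i \<in> I_star \<alpha> \<beta>" for i
    proof (rule zero_outside_supp[of \<xi> "fourier (\<psi> i)"])
      show "\<xi> \<notin> supp (fourier (\<psi> i))"
        using tile_away_from_origin[OF \<alpha> \<epsilon> i] bank i \<xi> unfolding scattering_bank_def by force
    qed
    then have "((\<lambda>i. (norm (fourier (\<psi> i) \<xi>))\<^sup>2) has_sum 0) (I_star \<alpha> \<beta>)"
      by (intro has_sum_0) simp
    with S have "1 - (norm (fourier chi \<xi>))\<^sup>2 = 0"
      using has_sum_unique by blast
    then show "norm (fourier chi \<xi>) = 1"
      using power2_eq_1_iff[of "norm (fourier chi \<xi>)"] norm_ge_zero[of "fourier chi \<xi>"] by auto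
  qed
qed

section \<open>Smooth functions built from radial profiles\<close>

lemma has_derivative_partial:
  assumes "(f has_derivative f') (at x)"
  shows "partial k f x = f' (axis k 1)"
  using frechet_derivative_at[OF assms] by (simp add: partial_def)

lemma has_derivative_plane:
  assumes "f differentiable at x"
  shows "(f has_derivative (\<lambda>v. \<Sum>k\<in>UNIV. (v $ k) *\<^sub>R partial k f x)) (at x)"
proof -
  let ?D = "frechet_derivative f (at x)"
  have D: "(f has_derivative ?D) (at x)"
    using assms frechet_derivative_works by blast
  have "?D v = (\<Sum>k\<in>UNIV. (v $ k) *\<^sub>R partial k f x)" for v
  proof -
    have "?D v = ?D (\<Sum>k\<in>UNIV. (v $ k) *\<^sub>R axis k 1)"
      by (simp add: basis_expansion flip: scalar_mult_eq_scaleR)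
    also have "\<dots> = (\<Sum>k\<in>UNIV. (v $ k) *\<^sub>R ?D (axis k 1))"
      using has_derivative_linear[OF D] by (simp add: linear_sum linear_cmul)
    finally show ?thesis by (simp add: partial_def)
  qed
  then have "?D = (\<lambda>v. \<Sum>k\<in>UNIV. (v $ k) *\<^sub>R partial k f x)"
    by (rule ext)
  then show ?thesis
    using D by simp
qed

lemma differentiable_has_partial:
  assumes "f differentiable at x"
  shows "(f has_derivative frechet_derivative f (at x)) (at x)" 
    and "frechet_derivative f (at x) (axis k 1) = partial k f x"
  using assms by (simp_all add: frechet_derivative_works partial_def)

lemma partial_add:
  assumes "f differentiable at x" "g differentiable at x"
  shows "partial k (\<lambda>x. f x + g x) x = partial k f x + partial k g x"
  using has_derivative_partial[OF has_derivative_add[OF assms[THEN differentiable_has_partial(1)]]]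
  by (simp add: differentiable_has_partial(2) assms)

lemma partial_mult:
  fixes f g :: "real^2 \<Rightarrow> real"
  assumes "f differentiable at x" "g differentiable at x"
  shows "partial k (\<lambda>x. f x * g x) x = f x * partial k g x + partial k f x * g x"
  using has_derivative_partial[OF has_derivative_mult[OF assms[THEN differentiable_has_partial(1)]]]
  by (simp add: differentiable_has_partial(2) assms)

lemma real_polynomial_function_partial:
  assumes "real_polynomial_function p"
  shows "real_polynomial_function (partial k p)"
  using assms
proof induction
  case (linear f)
  then have "partial k f = (\<lambda>_. f (axis k 1))"
    by (intro ext has_derivative_partial) (rule bounded_linear.has_derivative[OF _ has_derivative_ident])
  then show ?case by (simp add: real_polynomial_function.intros(2))
next
  case (const c)
  have "partial k (\<lambda>_. c) = (\<lambda>_. 0 :: real)"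
    by (intro ext) (simp add: has_derivative_partial[OF has_derivative_const])
  then show ?case by (simp add: real_polynomial_function.intros(2))
next
  case (add f g)
  have "partial k (\<lambda>x. f x + g x) = (\<lambda>x. partial k f x + partial k g x)"
    by (intro ext partial_add differentiable_at_real_polynomial_function add.hyps)
  then show ?case
    using real_polynomial_function.intros(3)[OF add.IH] by simp
next
  case (mult f g)
  have "partial k (\<lambda>x. f x * g x) = (\<lambda>x. f x * partial k g x + partial k f x * g x)"
    by (intro ext partial_mult differentiable_at_real_polynomial_function mult.hyps)
  then show ?case
    using real_polynomial_function.intros(3)[OF real_polynomial_function.intros(4)[OF mult.hyps(1) mult.IH(2)]
        real_polynomial_function.intros(4)[OF mult.IH(1) mult.hyps(2)]] by simp
qed

text \<open>A smooth function of one variable together with all of its derivatives.\<close>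

definition derivative_chain :: "(nat \<Rightarrow> real \<Rightarrow> real) \<Rightarrow> bool" where
  "derivative_chain \<phi> \<longleftrightarrow> (\<forall>n t. (\<phi> n has_real_derivative \<phi> (Suc n) t) (at t))"

definition partial_closed :: "(real^2 \<Rightarrow> 'b::real_normed_vector) set \<Rightarrow> bool" where
  "partial_closed V \<longleftrightarrow> (\<forall>e\<in>V. \<forall>x. e differentiable at x \<and> (\<forall>k. partial k e \<in> V))"

text \<open>Sums of terms (polynomial) times (a derivative of the profile at \<open>|x|\<^sup>2\<close>) times (an element of \<open>V\<close>).
  The set \<open>V\<close> consists of constants for the deformations and of multiples of one character for the wave
  packets, so that both are treated by the same closure argument.\<close>

inductive radial_span ::
    "(nat \<Rightarrow> real \<Rightarrow> real) \<Rightarrow> (real^2 \<Rightarrow> 'b::real_normed_vector) set \<Rightarrow> (real^2 \<Rightarrow> 'b) \<Rightarrow> bool"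
  for \<phi> V where
  gen: "real_polynomial_function p \<Longrightarrow> e \<in> V \<Longrightarrow> radial_span \<phi> V (\<lambda>x. (p x * \<phi> n (x \<bullet> x)) *\<^sub>R e x)"
| add: "radial_span \<phi> V f \<Longrightarrow> radial_span \<phi> V g \<Longrightarrow> radial_span \<phi> V (\<lambda>x. f x + g x)"

text \<open>The product rule yields three terms of the same shape: differentiating the profile produces the factor
  \<open>2 x\<^sub>k\<close> and the next member of the chain.\<close>

lemma radial_span_partial:
  assumes \<phi>: "derivative_chain \<phi>" and V: "partial_closed V" and f: "radial_span \<phi> V f"
  shows "(\<forall>x. f differentiable at x) \<and> radial_span \<phi> V (partial k f)"
  using f
proof induction
  case (gen p e n)
  let ?f = "\<lambda>x. (p x * \<phi> n (x \<bullet> x)) *\<^sub>R e x"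
  let ?p' = "\<lambda>x. frechet_derivative p (at x)" and ?e' = "\<lambda>x. frechet_derivative e (at x)"
  have p: "(p has_derivative ?p' x) (at x)" for x
    by (intro differentiable_has_partial differentiable_at_real_polynomial_function gen)
  have "e differentiable at x" for x
    using V gen(2) by (simp add: partial_closed_def)
  then have e: "(e has_derivative ?e' x) (at x)" for x
    by (rule differentiable_has_partial)
  have r: "((\<lambda>x. \<phi> n (x \<bullet> x)) has_derivative (\<lambda>v. \<phi> (Suc n) (x \<bullet> x) * (2 * (x \<bullet> v)))) (at x)" for x :: "real^2"
  proof -
    have 1: "(\<phi> n has_real_derivative \<phi> (Suc n) (x \<bullet> x)) (at (x \<bullet> x))"
      using \<phi> by (simp add: derivative_chain_def)
    have 2: "((\<lambda>x. x \<bullet> x) has_derivative (\<lambda>v. 2 * (x \<bullet> v))) (at x)"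
      by (auto intro!: derivative_eq_intros simp: inner_commute)
    show ?thesis
      using DERIV_compose_FDERIV[where g = "\<lambda>x. x \<bullet> x", OF 1 2] by (simp add: mult.commute)
  qed
  note D = has_derivative_scaleR[OF has_derivative_mult[OF p r] e]
  have "partial k ?f = (\<lambda>x. ((partial k p x) * \<phi> n (x \<bullet> x)) *\<^sub>R e x + (((p x * (2 * x $ k)) * \<phi> (Suc n) (x \<bullet> x)) *\<^sub>R e x
      + (p x * \<phi> n (x \<bullet> x)) *\<^sub>R partial k e x))"
    using has_derivative_partial[OF D, of k] by (simp add: fun_eq_iff partial_def inner_axis algebra_simps)
  moreover have "real_polynomial_function (\<lambda>x::real^2. p x * (2 * x $ k))"
    by (intro real_polynomial_function.intros(4) real_polynomial_function.intros(2) gen(1)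
        real_polynomial_function.intros(1)[OF bounded_linear_vec_nth])
  moreover have "partial k e \<in> V"
    using V gen(2) by (simp add: partial_closed_def)
  ultimately have "radial_span \<phi> V (partial k ?f)"
    by (simp only:) (rule radial_span.add radial_span.gen real_polynomial_function_partial gen | assumption)+
  moreover have "\<forall>x. ?f differentiable at x"
    using D by (auto simp: differentiable_def)
  ultimately show ?case by blast
next
  case (add f g)
  have "partial k (\<lambda>x. f x + g x) = (\<lambda>x. partial k f x + partial k g x)"
    using add.IH by (intro ext partial_add) auto
  then show ?case
    using add.IH radial_span.add[of \<phi> V "partial k f" "partial k g"] by simp
qed

lemma radial_span_foldr:
  assumes "derivative_chain \<phi>" "partial_closed V" "radial_span \<phi> V f"
  shows "radial_span \<phi> V (foldr partial ks f)"
  by (induction ks) (use assms radial_span_partial in auto)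

lemma smooth_radial_span:
  assumes "derivative_chain \<phi>" "partial_closed V" "radial_span \<phi> V f"
  shows "smooth f"
  unfolding smooth_def differentiable_on_def
  using radial_span_partial[OF assms(1,2) radial_span_foldr[OF assms]] by simp

lemma multi_partial_foldr:
  "multi_partial \<nu> f = foldr partial (replicate (fst \<nu>) 1 @ replicate (snd \<nu>) 2) f"
proof -
  have "(partial k ^^ n) g = foldr partial (replicate n k) g" for k n and g :: "real^2 \<Rightarrow> 'a"
    by (induction n) auto
  then show ?thesis by (simp add: multi_partial_def)
qed

lemma radial_span_continuous:
  assumes "derivative_chain \<phi>" "partial_closed V" "radial_span \<phi> V f"
  shows "continuous_on UNIV f"
  using radial_span_partial[OF assms]
  by (simp add: continuous_on_eq_continuous_at differentiable_imp_continuous_within)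

section \<open>Modulated Gaussians are Schwartz functions\<close>

text \<open>The weight \<open>1 + |x|\<^sup>2\<close> is at least 1, so that exponents may be enlarged when bounds are added.\<close>

lemma real_polynomial_function_growth:
  assumes "real_polynomial_function p"
  shows "\<exists>C N. \<forall>x::real^2. \<bar>p x\<bar> \<le> C * (1 + x \<bullet> x) ^ N"
  using assms
proof induction
  case (linear f)
  then obtain K where K: "\<And>x. \<bar>f x\<bar> \<le> norm x * K" "K > 0"
    using bounded_linear.pos_bounded by fastforce
  have "\<bar>f x\<bar> \<le> K * (1 + x \<bullet> x) ^ 1" for x
  proof -
    have "norm x \<le> 1 + (norm x)\<^sup>2"
      using sum_power2_ge_zero[of "norm x - 1/2" 0] by (simp add: power2_eq_square algebra_simps)
    then have "K * norm x \<le> K * (1 + (norm x)\<^sup>2)"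
      using K(2) by (intro mult_left_mono) auto
    with K(1)[of x] show ?thesis
      unfolding power2_norm_eq_inner[symmetric] power_one_right by (simp add: mult.commute[of _ K])
  qed
  then show ?case by blast
next
  case (const c)
  show ?case by (rule exI[of _ "\<bar>c\<bar>"], rule exI[of _ 0]) simp
next
  case (add f g)
  then obtain C N D M where CN: "\<And>x. \<bar>f x\<bar> \<le> C * (1 + x \<bullet> x) ^ N" "\<And>x. \<bar>g x\<bar> \<le> D * (1 + x \<bullet> x) ^ M"
    by blast
  have "C \<ge> 0" "D \<ge> 0"
    using CN[of 0] by (auto intro: order_trans[OF abs_ge_zero])
  have "\<bar>f x + g x\<bar> \<le> (C + D) * (1 + x \<bullet> x) ^ (N + M)" for x
  proof -
    have "C * (1 + x \<bullet> x) ^ N \<le> C * (1 + x \<bullet> x) ^ (N + M)" "D * (1 + x \<bullet> x) ^ M \<le> D * (1 + x \<bullet> x) ^ (N + M)"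
      using \<open>C \<ge> 0\<close> \<open>D \<ge> 0\<close> by (auto intro!: mult_left_mono power_increasing)
    then show ?thesis
      using CN[of x] by (simp add: distrib_right)
  qed
  then show ?case by blast
next
  case (mult f g)
  then obtain C N D M where CN: "\<And>x. \<bar>f x\<bar> \<le> C * (1 + x \<bullet> x) ^ N" "\<And>x. \<bar>g x\<bar> \<le> D * (1 + x \<bullet> x) ^ M"
    by blast
  have "\<bar>f x * g x\<bar> \<le> (C * D) * (1 + x \<bullet> x) ^ (N + M)" for x
    using mult_mono[OF CN[of x]] order_trans[OF abs_ge_zero CN(1)[of x]]
    by (simp add: abs_mult power_add mult_ac)
  then show ?case by blast
qed

text \<open>A single term of the exponential series.\<close>

lemma power_le_fact_exp:
  assumes "(x::real) \<ge> 0"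
  shows "x ^ n \<le> fact n * exp x"
proof -
  have "(\<Sum>k\<in>{n}. inverse (fact k) *\<^sub>R x ^ k) \<le> (\<Sum>k. inverse (fact k) *\<^sub>R x ^ k)"
    using assms by (intro sum_le_suminf summable_exp_generic) auto
  then have "x ^ n / fact n \<le> exp x"
    by (simp add: exp_def divide_inverse mult.commute)
  then show ?thesis
    by (simp add: field_simps)
qed

lemma power_exp_bounded:
  assumes b: "(b::real) > 0"
  shows "\<exists>K. \<forall>t\<ge>0. (1 + t) ^ N * exp (- (b * t)) \<le> K"
proof -
  have "(1 + t) ^ N * exp (- (b * t)) \<le> exp b * fact N / b ^ N" if t: "t \<ge> 0" for t
  proof -
    have "(b * (1 + t)) ^ N \<le> fact N * exp (b + b * t)"
      using power_le_fact_exp[of "b * (1 + t)" N] b t by (simp add: distrib_left)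
    then have "b ^ N * (1 + t) ^ N \<le> fact N * (exp b * exp (b * t))"
      by (simp only: power_mult_distrib exp_add)
    then show ?thesis
      using b by (simp add: exp_minus field_simps)
  qed
  then show ?thesis by blast
qed

definition gauss_profile :: "real \<Rightarrow> nat \<Rightarrow> real \<Rightarrow> real" where
  "gauss_profile b n t = (- b) ^ n * exp (- (b * t))"

lemma derivative_chain_gauss: "derivative_chain (gauss_profile b)"
  unfolding derivative_chain_def gauss_profile_def
  by (auto intro!: derivative_eq_intros)

definition phase_set :: "real^2 \<Rightarrow> (real^2 \<Rightarrow> complex) set" where
  "phase_set a = {\<lambda>x. c * cis (x \<bullet> a) | c. True}"

lemma partial_closed_phase: "partial_closed (phase_set a)"
proof -
  have D: "((\<lambda>x. c * cis (x \<bullet> a)) has_derivative (\<lambda>v. c * \<i> * complex_of_real (v \<bullet> a) * cis (x \<bullet> a))) (at x)" for c x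
  proof -
    have "((\<lambda>z. c * exp (\<i> * z)) has_field_derivative c * \<i> * exp (\<i> * complex_of_real (x \<bullet> a))) (at (complex_of_real (x \<bullet> a)))"
      by (auto intro!: derivative_eq_intros)
    from has_vector_derivative_real_field[OF this]
    have 1: "((\<lambda>t. c * cis t) has_derivative (\<lambda>h. h *\<^sub>R (c * \<i> * cis (x \<bullet> a)))) (at (x \<bullet> a))"
      by (simp add: has_vector_derivative_def cis_conv_exp)
    have 2: "((\<lambda>x. x \<bullet> a) has_derivative (\<lambda>v. v \<bullet> a)) (at x)"
      by (auto intro!: derivative_eq_intros)
    show ?thesis
      using has_derivative_compose[OF 2 1] by (simp add: scaleR_conv_of_real mult_ac)
  qed
  have "partial k (\<lambda>x. c * cis (x \<bullet> a)) = (\<lambda>x. (c * \<i> * complex_of_real (a $ k)) * cis (x \<bullet> a))" for c k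
    by (intro ext) (simp add: has_derivative_partial[OF D] inner_axis' )
  then show ?thesis
    using D differentiableI unfolding partial_closed_def phase_set_def by fastforce
qed

lemma radial_span_gauss_decay:
  assumes b: "b > 0" and f: "radial_span (gauss_profile b) (phase_set a) f"
  shows "\<exists>C N. \<forall>x. norm (f x) \<le> C * (1 + x \<bullet> x) ^ N * exp (- (b * (x \<bullet> x)))"
  using f
proof induction
  case (gen p e n)
  obtain C N where C: "\<And>x. \<bar>p x\<bar> \<le> C * (1 + x \<bullet> x) ^ N"
    using real_polynomial_function_growth[OF gen(1)] by blast
  obtain c where e: "e = (\<lambda>x. c * cis (x \<bullet> a))"
    using gen(2) by (auto simp: phase_set_def)
  have "norm ((p x * gauss_profile b n (x \<bullet> x)) *\<^sub>R e x)
     \<le> (C * b ^ n * norm c) * (1 + x \<bullet> x) ^ N * exp (- (b * (x \<bullet> x)))" for x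
  proof -
    have "norm ((p x * gauss_profile b n (x \<bullet> x)) *\<^sub>R e x) = \<bar>p x\<bar> * (b ^ n * norm c * exp (- (b * (x \<bullet> x))))"
      using b by (simp add: e gauss_profile_def norm_mult abs_mult power_abs)
    also have "\<dots> \<le> (C * (1 + x \<bullet> x) ^ N) * (b ^ n * norm c * exp (- (b * (x \<bullet> x))))"
      using C b by (intro mult_right_mono) auto
    finally show ?thesis by (simp add: mult_ac)
  qed
  then show ?case by blast
next
  case (add f g)
  then obtain C N D M where CN: "\<And>x. norm (f x) \<le> C * (1 + x \<bullet> x) ^ N * exp (- (b * (x \<bullet> x)))"
    "\<And>x. norm (g x) \<le> D * (1 + x \<bullet> x) ^ M * exp (- (b * (x \<bullet> x)))"
    by blast
  have "C \<ge> 0" "D \<ge> 0"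
    using CN[of 0] by (auto intro: order_trans[OF norm_ge_zero])
  have "norm (f x + g x) \<le> (C + D) * (1 + x \<bullet> x) ^ (N + M) * exp (- (b * (x \<bullet> x)))" for x
  proof -
    have "C * (1 + x \<bullet> x) ^ N * exp (- (b * (x \<bullet> x))) \<le> C * (1 + x \<bullet> x) ^ (N + M) * exp (- (b * (x \<bullet> x)))"
      "D * (1 + x \<bullet> x) ^ M * exp (- (b * (x \<bullet> x))) \<le> D * (1 + x \<bullet> x) ^ (N + M) * exp (- (b * (x \<bullet> x)))"
      using \<open>C \<ge> 0\<close> \<open>D \<ge> 0\<close> by (auto intro!: mult_left_mono mult_right_mono power_increasing)
    then show ?thesis
      using CN[of x] norm_triangle_ineq[of "f x" "g x"] by (simp add: distrib_right)
  qed
  then show ?case by blast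
qed

lemma schwartz_radial_span:
  assumes b: "b > 0" and f: "radial_span (gauss_profile b) (phase_set a) f"
  shows "schwartz f"
  unfolding schwartz_def
proof (intro conjI allI)
  show "smooth f"
    by (rule smooth_radial_span[OF derivative_chain_gauss partial_closed_phase f])
  fix n \<nu>
  have "radial_span (gauss_profile b) (phase_set a) (multi_partial \<nu> f)"
    unfolding multi_partial_foldr
    by (rule radial_span_foldr[OF derivative_chain_gauss partial_closed_phase f])
  then obtain C N where C: "\<And>x. norm (multi_partial \<nu> f x) \<le> C * (1 + x \<bullet> x) ^ N * exp (- (b * (x \<bullet> x)))"
    using radial_span_gauss_decay[OF b] by blast
  have "C \<ge> 0"
    using C[of 0] by (auto intro: order_trans[OF norm_ge_zero])
  obtain K where K: "\<And>t. t \<ge> 0 \<Longrightarrow> (1 + t) ^ (n + N) * exp (- (b * t)) \<le> K"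
    using power_exp_bounded[OF b, of "n + N"] by blast
  have "norm (norm x ^ n *\<^sub>R multi_partial \<nu> f x) \<le> C * K" for x
  proof -
    have "norm x \<le> 1 + x \<bullet> x"
      using sum_power2_ge_zero[of "norm x - 1/2" 0]
      by (simp add: power2_eq_square algebra_simps flip: power2_norm_eq_inner)
    then have "norm x ^ n * norm (multi_partial \<nu> f x)
        \<le> (1 + x \<bullet> x) ^ n * (C * (1 + x \<bullet> x) ^ N * exp (- (b * (x \<bullet> x))))"
      using C by (intro mult_mono power_mono) auto
    also have "\<dots> = C * ((1 + x \<bullet> x) ^ (n + N) * exp (- (b * (x \<bullet> x))))"
      by (simp add: power_add mult_ac)
    also have "\<dots> \<le> C * K"
      using K \<open>C \<ge> 0\<close> by (intro mult_left_mono) auto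
    finally show ?thesis by simp
  qed
  then show "bounded (range (\<lambda>x. norm x ^ n *\<^sub>R multi_partial \<nu> f x))"
    unfolding bounded_iff by blast
qed

section \<open>A smooth cutoff profile\<close>

text \<open>The bump is \<open>exp(-1/u)\<close> with \<open>u = t (1 - t)\<close> on the unit interval. Its \<open>n\<close>-th derivative is
  \<open>P\<^sub>n(t) u\<^sup>-\<^sup>2\<^sup>n exp(-1/u)\<close>, and the recursion for \<open>P\<^sub>n\<close> is what the quotient and chain rules give.\<close>

fun bump_poly :: "nat \<Rightarrow> real poly" where
  "bump_poly 0 = 1"
| "bump_poly (Suc n) = pderiv (bump_poly n) * [:0, 1, -1:]\<^sup>2
     - of_nat (2 * n) * bump_poly n * [:1, -2:] * [:0, 1, -1:] + bump_poly n * [:1, -2:]"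

definition bump :: "nat \<Rightarrow> real \<Rightarrow> real" where
  "bump n t = (if 0 < t \<and> t < 1 
     then poly (bump_poly n) t / (t * (1 - t)) ^ (2 * n) * exp (- (1 / (t * (1 - t)))) else 0)"

lemma inverse_power_exp_le:
  assumes "(u::real) > 0"
  shows "exp (- (1 / u)) / u ^ k \<le> fact (k + 2) * u\<^sup>2"
proof -
  have "(1 / u) ^ (k + 2) \<le> fact (k + 2) * exp (1 / u)"
    using assms by (intro power_le_fact_exp) auto
  then show ?thesis
    using assms by (simp add: exp_minus field_simps power_add power2_eq_square del: fact_Suc)
qed

text \<open>Since \<open>u\<^sup>-\<^sup>k exp(-1/u)\<close> is bounded by a multiple of \<open>u\<^sup>2\<close>, every member of the chain vanishes to second
  order at both endpoints, which makes the derivative there exist and equal 0.\<close>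

lemma bump_quadratic_bound:
  "\<exists>K. \<forall>t. \<bar>bump n t\<bar> \<le> K * t\<^sup>2 \<and> \<bar>bump n t\<bar> \<le> K * (t - 1)\<^sup>2"
proof -
  obtain B where B: "\<And>t. 0 \<le> t \<Longrightarrow> t \<le> 1 \<Longrightarrow> \<bar>poly (bump_poly n) t\<bar> \<le> B"
  proof -
    have "bounded (poly (bump_poly n) ` {0..1})"
      by (intro compact_imp_bounded compact_continuous_image continuous_intros) auto
    then show ?thesis
      using that unfolding bounded_iff by (metis atLeastAtMost_iff image_eqI real_norm_def)
  qed
  have B0: "B \<ge> 0"
    using B[of 0] by simp
  define K where "K = B * fact (2 * n + 2)"
  have K: "\<bar>bump n t\<bar> \<le> K * (t * (1 - t))\<^sup>2" if "0 < t" "t < 1" for t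
  proof -
    let ?u = "t * (1 - t)"
    have u: "?u > 0" using that by simp
    have "\<bar>bump n t\<bar> = \<bar>poly (bump_poly n) t\<bar> * (exp (- (1 / ?u)) / ?u ^ (2 * n))"
      using that u by (simp add: bump_def abs_mult power_abs)
    also have "\<dots> \<le> B * (fact (2 * n + 2) * ?u\<^sup>2)"
      using B[of t] B0 that u inverse_power_exp_le[OF u, of "2 * n"] by (intro mult_mono) auto
    finally show ?thesis by (simp add: K_def)
  qed
  have "K \<ge> 0" using B0 by (simp add: K_def)
  have "\<bar>bump n t\<bar> \<le> K * t\<^sup>2 \<and> \<bar>bump n t\<bar> \<le> K * (t - 1)\<^sup>2" for t
  proof (cases "0 < t \<and> t < 1")
    case True
    have "(t * (1 - t))\<^sup>2 \<le> t\<^sup>2" "(t * (1 - t))\<^sup>2 \<le> (t - 1)\<^sup>2"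
      using True by (auto simp: power_mult_distrib power2_commute[of t 1] intro!: mult_left_le mult_left_le_one_le power_le_one)
    then show ?thesis
      using K[of t] True \<open>K \<ge> 0\<close> by (meson mult_left_mono order_trans)
  next
    case False
    then have "bump n t = 0" by (auto simp: bump_def)
    then show ?thesis using \<open>K \<ge> 0\<close> by simp
  qed
  then show ?thesis by blast
qed

lemma has_derivative_zero_of_quadratic:
  fixes f :: "real \<Rightarrow> real"
  assumes "\<And>t. \<bar>f t\<bar> \<le> K * (t - c)\<^sup>2"
  shows "(f has_real_derivative 0) (at c)"
proof -
  have "f c = 0" using assms[of c] by simp
  have "((\<lambda>h. (f (c + h) - f c) / h) \<longlongrightarrow> 0) (at 0)"
  proof (rule Lim_null_comparison)
    show "\<forall>\<^sub>F h in at 0. norm ((f (c + h) - f c) / h) \<le> K * \<bar>h\<bar>"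
      using assms[of "c + h" for h] \<open>f c = 0\<close>
      by (auto simp: eventually_at_filter divide_le_eq power2_eq_square mult.assoc intro!: always_eventually)
    have "((\<lambda>h. K * \<bar>h\<bar>) \<longlongrightarrow> K * \<bar>0\<bar>) (at 0)"
      by (intro tendsto_intros)
    then show "((\<lambda>h. K * \<bar>h\<bar>) \<longlongrightarrow> 0) (at 0)" by simp
  qed
  then show ?thesis by (simp add: DERIV_def)
qed

text \<open>The algebra that matches the quotient rule for \<open>p / U * E\<close> with the recursion for the polynomials,
  where \<open>U = u\<^sup>2\<^sup>n\<close> and \<open>E = exp(-1/u)\<close>.\<close>

lemma bump_quotient_rule:
  fixes u U p p' N v E :: real
  assumes u: "u > 0" and U: "U \<noteq> 0"
  shows "(p' * U - p * (N * v * U / u)) / (U * U) * E + v / u\<^sup>2 * E * (p / U)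
         = (p' * u\<^sup>2 - N * p * v * u + p * v) / (U * u\<^sup>2) * E"
proof -
  have "(p' * U - p * (N * v * U / u)) / (U * U) = (p' - p * N * v / u) / U"
    using U by (simp add: field_simps)
  also have "\<dots> = (p' * u\<^sup>2 - N * p * v * u) / (U * u\<^sup>2)"
    using u U by (simp add: divide_simps) (simp add: power2_eq_square algebra_simps)
  finally show ?thesis
    using u U by (simp add: divide_simps) (simp add: algebra_simps)
qed

lemma derivative_chain_bump: "derivative_chain bump"
  unfolding derivative_chain_def
proof (intro allI)
  fix n :: nat and t :: real
  obtain K where K: "\<And>t. \<bar>bump n t\<bar> \<le> K * t\<^sup>2" "\<And>t. \<bar>bump n t\<bar> \<le> K * (t - 1)\<^sup>2"
    using bump_quadratic_bound by metis
  consider "0 < t" "t < 1" | "t < 0 \<or> 1 < t" | "t = 0" | "t = 1" by fastforce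
  then show "(bump n has_real_derivative bump (Suc n) t) (at t)"
  proof cases
    case 1
    let ?g = "\<lambda>t. poly (bump_poly n) t / (t * (1 - t)) ^ (2 * n) * exp (- (1 / (t * (1 - t))))"
    define u where "u = t * (1 - t)"
    have u: "u > 0" using 1 by (simp add: u_def)
    have du: "((\<lambda>t. t * (1 - t)) has_real_derivative (1 - 2 * t)) (at t)"
      by (auto intro!: derivative_eq_intros simp: algebra_simps)
    have dp: "((\<lambda>t. (t * (1 - t)) ^ (2 * n)) has_real_derivative (of_nat (2 * n) * (1 - 2 * t) * u ^ (2 * n) / u)) (at t)"
    proof (cases n)
      case (Suc m)
      show ?thesis
        by (rule DERIV_cong[OF DERIV_power[OF du, of "2 * n"]]) 
           (use u in \<open>simp add: Suc u_def[symmetric] field_simps\<close>)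
    qed simp
    have de: "((\<lambda>t. exp (- (1 / (t * (1 - t))))) has_real_derivative ((1 - 2 * t) / u\<^sup>2 * exp (- (1 / u)))) (at t)"
    proof -
      have "((\<lambda>t. - (1 / (t * (1 - t)))) has_real_derivative - ((0 * u - 1 * (1 - 2 * t)) / (u * u))) (at t)"
        unfolding u_def by (intro DERIV_minus DERIV_divide DERIV_const du) (use 1 in simp)
      moreover have "- ((0 * u - 1 * (1 - 2 * t)) / (u * u)) = (1 - 2 * t) / u\<^sup>2"
      proof -
        have "- ((0 * u - 1 * a) / (u * u)) = a / u\<^sup>2" for a :: real
          by (simp add: power2_eq_square)
        then show ?thesis .
      qed
      ultimately have "((\<lambda>t. - (1 / (t * (1 - t)))) has_real_derivative (1 - 2 * t) / u\<^sup>2) (at t)"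
        by (simp only:)
      from DERIV_fun_exp[OF this] show ?thesis
        by (simp only: u_def mult.commute)
    qed
    have "(?g has_real_derivative
        (poly (pderiv (bump_poly n)) t * u ^ (2 * n) - poly (bump_poly n) t * (of_nat (2 * n) * (1 - 2 * t) * u ^ (2 * n) / u)) / (u ^ (2 * n) * u ^ (2 * n)) * exp (- (1 / u))
        + (1 - 2 * t) / u\<^sup>2 * exp (- (1 / u)) * (poly (bump_poly n) t / u ^ (2 * n))) (at t)"
    proof -
      have "u ^ (2 * n) \<noteq> 0" using u by simp
      then show ?thesis
        by (rule DERIV_mult[OF DERIV_divide[OF poly_DERIV[of "bump_poly n"] dp] de, unfolded u_def[symmetric]])
    qed
    also have "(poly (pderiv (bump_poly n)) t * u ^ (2 * n) - poly (bump_poly n) t * (of_nat (2 * n) * (1 - 2 * t) * u ^ (2 * n) / u)) / (u ^ (2 * n) * u ^ (2 * n)) * exp (- (1 / u))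
        + (1 - 2 * t) / u\<^sup>2 * exp (- (1 / u)) * (poly (bump_poly n) t / u ^ (2 * n)) = bump (Suc n) t"
    proof -
      have pu: "poly [:0, 1, -1:] t = u" by (simp add: u_def algebra_simps)
      have "poly (bump_poly (Suc n)) t = poly (pderiv (bump_poly n)) t * u\<^sup>2 
          - of_nat (2 * n) * poly (bump_poly n) t * (1 - 2 * t) * u + poly (bump_poly n) t * (1 - 2 * t)"
        by (simp only: bump_poly.simps poly_add poly_diff poly_mult poly_power pu poly_of_nat) (simp add: algebra_simps)
      moreover have "u ^ (2 * Suc n) = u ^ (2 * n) * u\<^sup>2"
        by (simp add: power2_eq_square)
      ultimately have eq: "bump (Suc n) t = (poly (pderiv (bump_poly n)) t * u\<^sup>2
          - of_nat (2 * n) * poly (bump_poly n) t * (1 - 2 * t) * u + poly (bump_poly n) t * (1 - 2 * t))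
          / (u ^ (2 * n) * u\<^sup>2) * exp (- (1 / u))"
        using 1 by (simp only: bump_def u_def[symmetric] if_True conj_absorb simp_thms)
      show ?thesis
        unfolding eq by (rule bump_quotient_rule) (use u in simp_all)
    qed
    finally have g: "(?g has_real_derivative bump (Suc n) t) (at t)" .
    show ?thesis
    proof (rule has_field_derivative_transform_within_open[OF g, of "{0<..<1}"])
      show "?g x = bump n x" if "x \<in> {0<..<1}" for x
        using that by (simp only: bump_def greaterThanLessThan_iff) simp
    qed (use 1 in simp_all)
  next
    case 2
    have 0: "bump k x = 0" if "x \<in> - {0..1}" for k x
      using that by (auto simp: bump_def)
    have t: "t \<in> - {0..1}"
      using 2 by auto
    have "((\<lambda>_. 0) has_real_derivative 0) (at t)" by simp
    then have "(bump n has_real_derivative 0) (at t)"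
      by (rule has_field_derivative_transform_within_open[of _ _ _ "- {0..1}"]) (use t 0 in auto)
    then show ?thesis
      using 0[OF t] by simp
  next
    case 3
    have "bump (Suc n) 0 = 0" by (simp add: bump_def del: bump_poly.simps)
    moreover have "(bump n has_real_derivative 0) (at 0)"
      using K(1) by (intro has_derivative_zero_of_quadratic[of _ K]) simp
    ultimately show ?thesis by (simp only: 3)
  next
    case 4
    have "bump (Suc n) 1 = 0" by (simp add: bump_def del: bump_poly.simps)
    moreover have "(bump n has_real_derivative 0) (at 1)"
      using K(2) by (intro has_derivative_zero_of_quadratic[of _ K]) simp
    ultimately show ?thesis by (simp only: 4)
  qed
qed

text \<open>A normalised and reversed antiderivative of the bump; its further derivatives are translates of the
  derivatives of the bump. The cutoff equals 1 exactly up to \<open>r\<close>: an approximate plateau would not do,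
  because the phase of the packet varies at rate \<open>|\<zeta>\<^sub>j|\<close>, which is unbounded.\<close>

lemma smooth_cutoff_profile:
  obtains \<kappa> :: "nat \<Rightarrow> real \<Rightarrow> real" where "derivative_chain \<kappa>"
    "\<And>t. t \<le> r \<Longrightarrow> \<kappa> 0 t = 1" "\<And>t. t \<ge> r + 1 \<Longrightarrow> \<kappa> 0 t = 0" "\<And>t. 0 \<le> \<kappa> 0 t \<and> \<kappa> 0 t \<le> 1"
proof -
  have bump_D: "(bump n has_real_derivative bump (Suc n) t) (at t)" for n t
    using derivative_chain_bump by (simp add: derivative_chain_def)
  have "isCont (bump 0) t" for t
    using bump_D DERIV_isCont by blast
  then obtain F where "\<forall>x. - \<infinity> < ereal x \<longrightarrow> ereal x < \<infinity> \<longrightarrow> (F has_vector_derivative bump 0 x) (at x)"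
    using einterval_antiderivative[of "-\<infinity>" "\<infinity>" "bump 0"] by auto
  then have F: "(F has_real_derivative bump 0 x) (at x)" for x
    by (simp add: has_real_derivative_iff_has_vector_derivative)
  have bump_pos: "bump 0 t > 0" if "0 < t" "t < 1" for t
    using that by (simp add: bump_def)
  have bump_nonneg: "bump 0 t \<ge> 0" for t
    by (simp add: bump_def)
  have mono: "F s \<le> F t" if "s \<le> t" for s t
    using DERIV_nonneg_imp_nondecreasing[OF that] F bump_nonneg by blast
  have F0: "F t = F 0" if "t \<le> 0" for t
  proof (rule antisym[OF mono[OF that]])
    have "\<exists>y. (F has_real_derivative y) (at x) \<and> y \<le> 0" if "x \<le> 0" for x
      using F[of x] that by (intro exI[of _ "bump 0 x"]) (auto simp: bump_def)
    then show "F 0 \<le> F t"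
      using DERIV_nonpos_imp_nonincreasing[OF that] by blast
  qed
  have F1: "F t = F 1" if "t \<ge> 1" for t
  proof (rule antisym[OF _ mono[OF that]])
    have "\<exists>y. (F has_real_derivative y) (at x) \<and> y \<le> 0" if "x \<ge> 1" for x
      using F[of x] that by (intro exI[of _ "bump 0 x"]) (auto simp: bump_def)
    then show "F t \<le> F 1"
      using DERIV_nonpos_imp_nonincreasing[OF that] by blast
  qed
  have "F 0 < F 1"
  proof (rule DERIV_pos_imp_increasing_open[of 0 1 F])
    show "continuous_on {0..1} F"
      using F by (meson DERIV_continuous_on has_field_derivative_at_within)
  qed (use F bump_pos in auto)
  define \<kappa> where "\<kappa> n t = (case n of 0 \<Rightarrow> (F 1 - F (t - r)) / (F 1 - F 0)
     | Suc m \<Rightarrow> - bump m (t - r) / (F 1 - F 0))" for n t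
  show ?thesis
  proof
    show "derivative_chain \<kappa>"
      unfolding derivative_chain_def
    proof (intro allI)
      fix n :: nat and t :: real
      have sh: "((\<lambda>t. t - r) has_real_derivative 1) (at t)"
        by (auto intro!: derivative_eq_intros)
      have cF: "((\<lambda>t. F (t - r)) has_real_derivative bump 0 (t - r)) (at t)"
        using DERIV_chain2[OF F sh] by simp
      have cB: "((\<lambda>t. bump m (t - r)) has_real_derivative bump (Suc m) (t - r)) (at t)" for m
        using DERIV_chain2[OF bump_D sh] by simp
      show "(\<kappa> n has_real_derivative \<kappa> (Suc n) t) (at t)"
      proof (cases n)
        case 0
        have "((\<lambda>t. (F 1 - F (t - r)) / (F 1 - F 0)) has_real_derivative (0 - bump 0 (t - r)) / (F 1 - F 0)) (at t)"
          by (intro DERIV_cdivide DERIV_diff cF DERIV_const)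
        then show ?thesis by (simp add: 0 \<kappa>_def[abs_def])
      next
        case (Suc m)
        show ?thesis
          unfolding Suc \<kappa>_def[abs_def] by (auto intro!: DERIV_cdivide DERIV_minus cB)
      qed
    qed
    show "\<kappa> 0 t = 1" if "t \<le> r" for t
      using F0[of "t - r"] that \<open>F 0 < F 1\<close> by (simp add: \<kappa>_def)
    show "\<kappa> 0 t = 0" if "t \<ge> r + 1" for t
      using F1[of "t - r"] that by (simp add: \<kappa>_def)
    show "0 \<le> \<kappa> 0 t \<and> \<kappa> 0 t \<le> 1" for t
    proof -
      have "F 0 \<le> F (t - r)" using F0[of "t - r"] mono[of 0 "t - r"] by linarith
      moreover have "F (t - r) \<le> F 1" using F1[of "t - r"] mono[of "t - r" 1] by linarith
      ultimately show ?thesis using \<open>F 0 < F 1\<close> by (simp add: \<kappa>_def)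
    qed
  qed
qed

section \<open>Energy estimates\<close>

lemma sqrt_ennreal_power2: "(sqrt_ennreal x)\<^sup>2 = x"
  by (cases x) (auto simp: sqrt_ennreal_def ennreal_power)

lemma L2_norm_power2: "(L2_norm f)\<^sup>2 = sq_mass f"
  by (simp add: L2_norm_def sq_mass_def sqrt_ennreal_power2)

lemma le_sqrt_ennreal:
  assumes "ennreal (c\<^sup>2) \<le> x" "0 \<le> c"
  shows "ennreal c \<le> sqrt_ennreal x"
proof (cases x)
  case (real r)
  then have "c\<^sup>2 \<le> r" using assms by (simp add: ennreal_le_iff)
  then show ?thesis
    using real assms by (auto simp: sqrt_ennreal_def intro!: ennreal_leI real_le_rsqrt)
qed (simp add: sqrt_ennreal_def)

text \<open>One component bounds the whole family from below, so it suffices to look at the active index.\<close>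

lemma l2L2_norm_ge:
  assumes p: "p \<in> J" and c: "0 \<le> c" "ennreal (c\<^sup>2) \<le> sq_mass (q p)"
  shows "ennreal c \<le> l2L2_norm J q"
  unfolding l2L2_norm_def
proof (rule le_sqrt_ennreal[OF _ c(1)])
  have "(L2_norm (q p))\<^sup>2 = (\<Sum>\<^sub>\<infinity>p\<in>{p}. (L2_norm (q p))\<^sup>2)"
    by simp
  also have "\<dots> \<le> (\<Sum>\<^sub>\<infinity>p\<in>J. (L2_norm (q p))\<^sup>2)"
    using p by (intro infsum_mono_neutral nonneg_summable_on_complete) auto
  finally show "ennreal (c\<^sup>2) \<le> (\<Sum>\<^sub>\<infinity>p\<in>J. (L2_norm (q p))\<^sup>2)"
    using c by (simp add: L2_norm_power2)
qed

lemma sq_mass_alt: "sq_mass f = (\<integral>\<^sup>+x. ennreal ((norm (f x))\<^sup>2) \<partial>lborel)"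
  by (simp add: sq_mass_def ennreal_power)

text \<open>The triangle inequality squared. The factor 2 is harmless and keeps the estimates additive in the
  energies, without square roots.\<close>

lemma sq_mass_le_diff:
  assumes [measurable]: "f \<in> borel_measurable borel" "g \<in> borel_measurable borel"
  shows "sq_mass f \<le> 2 * sq_mass (\<lambda>x. f x - g x :: complex) + 2 * sq_mass g"
proof -
  have pt: "(norm (f x))\<^sup>2 \<le> 2 * (norm (f x - g x))\<^sup>2 + 2 * (norm (g x))\<^sup>2" for x
  proof -
    have "norm (f x) \<le> norm (f x - g x) + norm (g x)"
      using norm_triangle_ineq[of "f x - g x" "g x"] by simp
    then have "(norm (f x))\<^sup>2 \<le> (norm (f x - g x) + norm (g x))\<^sup>2"
      by (intro power_mono) auto
    also have "\<dots> \<le> 2 * (norm (f x - g x))\<^sup>2 + 2 * (norm (g x))\<^sup>2"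
      using sum_squares_bound[of "norm (f x - g x)" "norm (g x)"] by (simp add: power2_sum)
    finally show ?thesis .
  qed
  have "sq_mass f \<le> (\<integral>\<^sup>+x. 2 * ennreal ((norm (f x - g x))\<^sup>2) + 2 * ennreal ((norm (g x))\<^sup>2) \<partial>lborel)"
    unfolding sq_mass_alt
  proof (rule nn_integral_mono)
    fix x
    have "ennreal ((norm (f x))\<^sup>2) \<le> ennreal (2 * (norm (f x - g x))\<^sup>2 + 2 * (norm (g x))\<^sup>2)"
      by (rule ennreal_leI[OF pt])
    then show "ennreal ((norm (f x))\<^sup>2) \<le> 2 * ennreal ((norm (f x - g x))\<^sup>2) + 2 * ennreal ((norm (g x))\<^sup>2)"
      by (simp add: ennreal_plus ennreal_mult)
  qed
  also have "\<dots> = 2 * sq_mass (\<lambda>x. f x - g x) + 2 * sq_mass g"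
    by (simp add: nn_integral_add nn_integral_cmult sq_mass_alt)
  finally show ?thesis .
qed

lemma sq_mass_conv:
  assumes u: "tame u" and g: "integrable lborel g"
  shows "sq_mass (conv u g) = (\<integral>\<^sup>+\<xi>. ennreal ((norm (fourier u \<xi>))\<^sup>2 * (norm (fourier g \<xi>))\<^sup>2) \<partial>lborel)"
  using plancherel[OF tame_conv[OF u g]]
  by (simp add: sq_mass_alt fourier_conv[OF tame_integrable[OF u] g] norm_mult power_mult_distrib)

lemma sq_mass_conv_le:
  assumes u: "tame u" and g: "integrable lborel g"
    and le: "AE \<xi> in lborel. norm (fourier g \<xi>) \<le> 1"
  shows "sq_mass (conv u g) \<le> sq_mass u"
proof -
  have "sq_mass (conv u g) \<le> (\<integral>\<^sup>+\<xi>. ennreal ((norm (fourier u \<xi>))\<^sup>2) \<partial>lborel)"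
    unfolding sq_mass_conv[OF u g]
    by (rule nn_integral_mono_AE, rule eventually_mono[OF le])
       (auto intro!: ennreal_leI mult_right_le_one_le power_le_one)
  then show ?thesis
    using plancherel[OF u] by (simp add: sq_mass_alt)
qed

lemma fourier_cmult: "fourier (\<lambda>x. c * f x) \<xi> = c * fourier f \<xi>"
proof -
  have "fourier (\<lambda>x. c * f x) \<xi> = (LINT x|lborel. c * (wave (- \<xi>) x * f x))"
    unfolding fourier_wave by (simp add: mult_ac)
  then show ?thesis by (simp add: fourier_wave)
qed

lemma gauss_power2: "(gauss a x)\<^sup>2 = gauss (2 * a) x"
  by (simp add: power2_eq_square gauss_mult)

text \<open>The kernel \<open>G\<close> below is nonnegative with Fourier transform \<open>exp(- \<pi> s |\<xi>|\<^sup>2)\<close>, and \<open>H\<close> is its modulation to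
  frequency \<open>\<zeta>\<close>. Because \<open>G \<ge> 0\<close>, the convolution of \<open>F\<close> with \<open>H\<close> is dominated by that of \<open>|F|\<close> with \<open>G\<close>.
  On the Fourier side the first has the energy on the left-hand side of the claim. The second is
  compared with the convolution of \<open>|F|\<close> with \<open>chi\<close>: inside the ball of radius \<open>r\<close> the transform of \<open>chi\<close>
  has modulus 1, outside it the Gaussian is at most \<open>exp(- \<pi> s r\<^sup>2)\<close>.\<close>

lemma modulus_lowpass_lower_bound:
  assumes F: "tame F" and chi: "integrable lborel chi" and s: "0 < s" and r: "0 \<le> r"
    and flat: "AE \<xi> in lborel. norm \<xi> < r \<longrightarrow> norm (fourier chi \<xi>) = 1"
  shows "(\<integral>\<^sup>+\<xi>. ennreal ((norm (fourier F \<xi>))\<^sup>2 * gauss (2 * s) (\<xi> - \<zeta>)) \<partial>lborel)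
     \<le> sq_mass (conv (\<lambda>x. complex_of_real (norm (F x))) chi)
        + ennreal (exp (- (2 * pi * s * r\<^sup>2))) * sq_mass F"
proof -
  let ?A = "\<lambda>x. complex_of_real (norm (F x))"
  have A: "tame ?A" by (rule tame_norm[OF F])
  define g where "g x = gauss (1 / s) x / s" for x
  define G where "G x = complex_of_real (g x)" for x
  define H where "H x = wave \<zeta> x * G x" for x
  have g0: "0 \<le> g x" for x using s by (simp add: g_def)
  have G_alt: "G = (\<lambda>x. complex_of_real (1 / s) * complex_of_real (gauss (1 / s) x))"
    by (simp add: G_def g_def fun_eq_iff)
  have intG: "integrable lborel G"
    unfolding G_alt using integrable_gauss_complex[of "1 / s"] s by simp
  have intH: "integrable lborel H"
    unfolding H_def by (rule integrable_wave_mult[OF intG])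
  have fG: "fourier G \<xi> = complex_of_real (gauss s \<xi>)" for \<xi>
    unfolding G_alt fourier_cmult using s by (simp add: fourier_gauss)
  have fH: "fourier H \<xi> = complex_of_real (gauss s (\<xi> - \<zeta>))" for \<xi>
    unfolding H_def fourier_modulate by (rule fG)
  have pt: "norm (conv F H x) \<le> norm (conv ?A G x)" for x
  proof -
    have "norm (conv F H x) \<le> (LINT y|lborel. norm (F (x - y)) * g y)"
      unfolding conv_def by (rule order_trans[OF integral_norm_bound])
        (simp add: norm_mult H_def G_def g0)
    moreover have "conv ?A G x = complex_of_real (LINT y|lborel. norm (F (x - y)) * g y)"
      unfolding conv_def G_def by (simp flip: of_real_mult add: integral_complex_of_real)
    ultimately show ?thesis by simp
  qed
  have "(\<integral>\<^sup>+\<xi>. ennreal ((norm (fourier F \<xi>))\<^sup>2 * gauss (2 * s) (\<xi> - \<zeta>)) \<partial>lborel) = sq_mass (conv F H)"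
    unfolding sq_mass_conv[OF F intH] fH by (simp add: gauss_power2)
  also have "\<dots> \<le> sq_mass (conv ?A G)"
    unfolding sq_mass_alt by (intro nn_integral_mono ennreal_leI power_mono pt) simp
  also have "\<dots> = (\<integral>\<^sup>+\<xi>. ennreal ((norm (fourier ?A \<xi>))\<^sup>2 * gauss (2 * s) \<xi>) \<partial>lborel)"
    unfolding sq_mass_conv[OF A intG] fG by (simp add: gauss_power2)
  also have "\<dots> \<le> (\<integral>\<^sup>+\<xi>. ennreal ((norm (fourier ?A \<xi>))\<^sup>2 * (norm (fourier chi \<xi>))\<^sup>2)
      + ennreal (exp (- (2 * pi * s * r\<^sup>2))) * ennreal ((norm (fourier ?A \<xi>))\<^sup>2) \<partial>lborel)"
  proof (rule nn_integral_mono_AE, rule eventually_mono[OF flat])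
    fix \<xi> assume flat: "norm \<xi> < r \<longrightarrow> norm (fourier chi \<xi>) = 1"
    let ?a = "(norm (fourier ?A \<xi>))\<^sup>2" and ?e = "exp (- (2 * pi * s * r\<^sup>2))" and ?c = "(norm (fourier chi \<xi>))\<^sup>2"
    have "?a * gauss (2 * s) \<xi> \<le> ?a * ?c + ?e * ?a"
    proof (cases "norm \<xi> < r")
      case True
      have "gauss (2 * s) \<xi> \<le> 1" using s by (simp add: gauss_def)
      then have "?a * gauss (2 * s) \<xi> \<le> ?a * 1" by (intro mult_left_mono) auto
      then show ?thesis using flat True by (simp add: add_increasing2)
    next
      case False
      then have "r\<^sup>2 \<le> \<xi> \<bullet> \<xi>"
        using r by (simp add: power_mono flip: power2_norm_eq_inner)
      then have "gauss (2 * s) \<xi> \<le> ?e"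
        using s by (simp add: gauss_def mult_ac mult_left_mono)
      then have "?a * gauss (2 * s) \<xi> \<le> ?a * ?e" by (intro mult_left_mono) auto
      moreover have "0 \<le> ?a * ?c" by simp
      ultimately show ?thesis unfolding mult.commute[of ?e] by linarith
    qed
    then have "ennreal (?a * gauss (2 * s) \<xi>) \<le> ennreal (?a * ?c + ?e * ?a)" by (rule ennreal_leI)
    then show "ennreal (?a * gauss (2 * s) \<xi>) \<le> ennreal (?a * ?c) + ennreal ?e * ennreal ?a"
      by (simp add: ennreal_plus ennreal_mult)
  qed
  also have "\<dots> = sq_mass (conv ?A chi) + ennreal (exp (- (2 * pi * s * r\<^sup>2))) * sq_mass ?A"
  proof -
    have [measurable]: "fourier ?A \<in> borel_measurable borel" "fourier chi \<in> borel_measurable borel"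
      using measurable_fourier tame_integrable[OF A] chi by auto
    show ?thesis
      unfolding sq_mass_conv[OF A chi] plancherel[OF A, symmetric] unfolding sq_mass_alt
      by (simp add: nn_integral_add nn_integral_cmult)
  qed
  also have "sq_mass ?A = sq_mass F"
    by (simp add: sq_mass_alt)
  finally show ?thesis .
qed

section \<open>Wave packets\<close>

definition packet :: "real \<Rightarrow> real^2 \<Rightarrow> real^2 \<Rightarrow> complex" where
  "packet a \<zeta> x = complex_of_real (sqrt (2 * a)) * (wave \<zeta> x * complex_of_real (gauss a x))"

lemma norm_packet: "0 < a \<Longrightarrow> norm (packet a \<zeta> x) = sqrt (2 * a) * gauss a x"
  by (simp add: packet_def norm_mult)

lemma continuous_gauss: "continuous_on S f \<Longrightarrow> continuous_on S (\<lambda>x. gauss a (f x))"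
  unfolding gauss_def by (intro continuous_intros)

lemma continuous_packet: "continuous_on S f \<Longrightarrow> continuous_on S (\<lambda>x. packet a \<zeta> (f x))"
  unfolding packet_def by (intro continuous_intros continuous_gauss)

lemma tame_if_gauss_bound:
  assumes cont: "continuous_on UNIV u" and b: "0 < b" and C: "\<And>x. norm (u x) \<le> C * gauss b x"
  shows "tame u"
  unfolding tame_def
proof (intro conjI)
  have "C \<ge> 0" using order_trans[OF norm_ge_zero C[of 0]] by (simp add: gauss_def)
  have "norm (u x) \<le> C" for x
  proof -
    have "gauss b x \<le> 1" using b by (simp add: gauss_def)
    then show ?thesis using C[of x] \<open>C \<ge> 0\<close> mult_left_mono[of "gauss b x" 1 C] by simp
  qed
  then show "bounded (range u)" unfolding bounded_iff by blast
  show "integrable lborel u"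
    by (rule Bochner_Integration.integrable_bound[of _ "\<lambda>x. C * gauss b x"])
       (use C \<open>C \<ge> 0\<close> integrable_gauss[OF b] borel_measurable_continuous_onI[OF cont] in auto)
qed fact

lemma tame_packet: "0 < a \<Longrightarrow> tame (packet a \<zeta>)"
  by (rule tame_if_gauss_bound[of _ a "sqrt (2 * a)"]) (auto intro: continuous_packet simp: norm_packet)

lemma sq_mass_packet: "0 < a \<Longrightarrow> sq_mass (packet a \<zeta>) = 1"
proof -
  assume a: "0 < a"
  have "sq_mass (packet a \<zeta>) = (\<integral>\<^sup>+x. ennreal (2 * a) * ennreal (gauss (2 * a) x) \<partial>lborel)"
    using a by (simp add: sq_mass_alt norm_packet power_mult_distrib gauss_power2 ennreal_mult'' flip: ennreal_mult)
  also have "\<dots> = ennreal (2 * a) * ennreal (1 / (2 * a))"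
    using a nn_integral_gauss[of "2 * a"] by (simp add: nn_integral_cmult)
  finally show ?thesis
    using a by (simp flip: ennreal_mult)
qed

lemma L2_norm_packet: "0 < a \<Longrightarrow> L2_norm (packet a \<zeta>) = 1"
  using sq_mass_packet[of a \<zeta>] by (simp add: L2_norm_def sq_mass_def sqrt_ennreal_def)

lemma norm_fourier_packet:
  assumes "0 < a"
  shows "(norm (fourier (packet a \<zeta>) \<xi>))\<^sup>2 = 2 / a * gauss (2 / a) (\<xi> - \<zeta>)"
proof -
  have "norm (fourier (packet a \<zeta>) \<xi>) = sqrt (2 * a) * (gauss (1 / a) (\<xi> - \<zeta>) / a)"
    using assms unfolding packet_def fourier_cmult fourier_modulate
    by (simp add: fourier_gauss norm_mult norm_divide)
  then show ?thesis
    using assms by (simp add: power_mult_distrib power_divide gauss_power2, simp add: power2_eq_square)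
qed

text \<open>Outside the ball one half of the exponent of \<open>exp(- 2 \<pi> |\<xi> - \<zeta>|\<^sup>2 / a)\<close> supplies the small factor and the
  other half is integrated.\<close>

lemma packet_spectral_tail:
  assumes a: "0 < a" and \<rho>: "0 \<le> \<rho>"
  shows "(\<integral>\<^sup>+\<xi>. ennreal ((norm (fourier (packet a \<zeta>) \<xi>))\<^sup>2) * indicator (- ball \<zeta> \<rho>) \<xi> \<partial>lborel)
    \<le> ennreal (2 * exp (- (pi * \<rho>\<^sup>2 / a)))"
proof -
  let ?e = "exp (- (pi * \<rho>\<^sup>2 / a))"
  have "(\<integral>\<^sup>+\<xi>. ennreal ((norm (fourier (packet a \<zeta>) \<xi>))\<^sup>2) * indicator (- ball \<zeta> \<rho>) \<xi> \<partial>lborel)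
     \<le> (\<integral>\<^sup>+\<xi>. ennreal (2 / a * ?e) * ennreal (gauss (1 / a) (\<xi> - \<zeta>)) \<partial>lborel)"
  proof (rule nn_integral_mono)
    fix \<xi>
    show "ennreal ((norm (fourier (packet a \<zeta>) \<xi>))\<^sup>2) * indicator (- ball \<zeta> \<rho>) \<xi>
      \<le> ennreal (2 / a * ?e) * ennreal (gauss (1 / a) (\<xi> - \<zeta>))"
    proof (cases "\<xi> \<in> ball \<zeta> \<rho>")
      case False
      then have "\<rho>\<^sup>2 \<le> (\<xi> - \<zeta>) \<bullet> (\<xi> - \<zeta>)"
        using \<rho> by (simp add: dist_norm norm_minus_commute power_mono flip: power2_norm_eq_inner)
      then have "gauss (1 / a) (\<xi> - \<zeta>) \<le> ?e"
        using a by (simp add: gauss_def divide_right_mono mult_left_mono)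
      then have "gauss (1 / a) (\<xi> - \<zeta>) * gauss (1 / a) (\<xi> - \<zeta>) \<le> ?e * gauss (1 / a) (\<xi> - \<zeta>)"
        by (intro mult_right_mono) auto
      then have "2 / a * gauss (2 / a) (\<xi> - \<zeta>) \<le> 2 / a * (?e * gauss (1 / a) (\<xi> - \<zeta>))"
        using a by (intro mult_left_mono) (auto simp: gauss_mult)
      then show ?thesis
        using a False by (simp add: norm_fourier_packet mult.assoc flip: ennreal_mult)
    qed simp
  qed
  also have "\<dots> = ennreal (2 / a * ?e) * (\<integral>\<^sup>+\<xi>. ennreal (gauss (1 / a) \<xi>) \<partial>lborel)"
    using nn_integral_lborel_shift[of "\<lambda>\<xi>. ennreal (gauss (1 / a) \<xi>)" "- \<zeta>"]
    by (simp add: nn_integral_cmult)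
  also have "\<dots> = ennreal (2 * ?e)"
    using a by (simp add: nn_integral_gauss flip: ennreal_mult)
  finally show ?thesis .
qed

lemma schwartz_packet:
  assumes a: "0 < a"
  shows "schwartz (packet a \<zeta>)"
proof -
  define e where "e x = complex_of_real (sqrt (2 * a)) * cis (x \<bullet> ((2 * pi) *\<^sub>R \<zeta>))" for x
  have e: "e \<in> phase_set ((2 * pi) *\<^sub>R \<zeta>)"
    unfolding phase_set_def e_def by blast
  have "packet a \<zeta> = (\<lambda>x. (1 * gauss_profile (pi * a) 0 (x \<bullet> x)) *\<^sub>R e x)"
  proof
    fix x
    have "x \<bullet> ((2 * pi) *\<^sub>R \<zeta>) = 2 * pi * (x \<bullet> \<zeta>)"
      by (rule inner_scaleR_right)
    then show "packet a \<zeta> x = (1 * gauss_profile (pi * a) 0 (x \<bullet> x)) *\<^sub>R e x"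
      unfolding e_def packet_def wave_def gauss_def gauss_profile_def by (simp add: scaleR_conv_of_real mult_ac)
  qed
  moreover have "radial_span (gauss_profile (pi * a)) (phase_set ((2 * pi) *\<^sub>R \<zeta>)) \<dots>"
    by (rule radial_span.gen[OF _ e]) (rule real_polynomial_function.intros)
  ultimately show ?thesis
    using schwartz_radial_span[of "pi * a"] a by simp
qed

section \<open>Localised linear deformations\<close>

lemma partial_zero_outside:
  assumes K: "closed K" and f: "\<And>x. x \<notin> K \<Longrightarrow> f x = 0" and x: "x \<notin> K"
  shows "partial k f x = 0"
proof -
  have "(f has_derivative (\<lambda>_. 0)) (at x)"
    by (rule has_derivative_transform_within_open[of "\<lambda>_. 0" _ x UNIV "- K"])
       (use K f x in auto)
  then show ?thesis by (simp add: has_derivative_partial)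
qed

lemma foldr_partial_zero_outside:
  assumes "closed K" "\<And>x. x \<notin> K \<Longrightarrow> f x = 0"
  shows "x \<notin> K \<Longrightarrow> foldr partial ks f x = 0"
  using assms by (induction ks arbitrary: x) (auto intro: partial_zero_outside)

text \<open>Partial derivatives commute with a constant matrix. Hence all bounds for \<open>x \<mapsto> T (\<sigma> x)\<close> are those of the
  fixed field \<open>\<sigma>\<close> times the norm of \<open>T\<close>.\<close>

lemma foldr_partial_matrix:
  fixes T :: "real^2^2"
  assumes "smooth f"
  shows "foldr partial ks (\<lambda>x. T *v f x) = (\<lambda>x. T *v foldr partial ks f x)"
proof (induction ks)
  case (Cons k ks)
  have "foldr partial ks f differentiable at x" for x
    using assms by (simp add: smooth_def differentiable_on_def)
  then have "partial k (\<lambda>x. T *v foldr partial ks f x) = (\<lambda>x. T *v partial k (foldr partial ks f) x)"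
  proof (intro ext)
    fix x
    have "((\<lambda>x. T *v foldr partial ks f x) has_derivative (\<lambda>v. T *v frechet_derivative (foldr partial ks f) (at x) v)) (at x)"
      by (rule bounded_linear.has_derivative[OF matrix_vector_mul_bounded_linear differentiable_has_partial(1)]) fact
    from has_derivative_partial[OF this]
    show "partial k (\<lambda>x. T *v foldr partial ks f x) x = T *v partial k (foldr partial ks f) x"
      by (simp add: partial_def)
  qed
  with Cons show ?case by simp
qed simp

lemma test_function_matrix:
  fixes T :: "real^2^2"
  assumes f: "smooth f" and K: "compact K" "\<And>x. x \<notin> K \<Longrightarrow> f x = 0"
  shows "test_function (\<lambda>x. T *v f x)"
  unfolding test_function_def
proof
  have "foldr partial ks f differentiable at x" for ks x
    using f by (simp add: smooth_def differentiable_on_def)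
  then show "smooth (\<lambda>x. T *v f x)"
    unfolding smooth_def foldr_partial_matrix[OF f] differentiable_on_def
    using bounded_linear.has_derivative[OF matrix_vector_mul_bounded_linear differentiable_has_partial(1)]
    by (metis UNIV_I differentiableI)
  have "{x. T *v f x \<noteq> 0} \<subseteq> K"
    using K(2) by (metis (mono_tags, lifting) matrix_vector_mult_0_right mem_Collect_eq subsetI)
  then have "supp (\<lambda>x. T *v f x) \<subseteq> K"
    unfolding supp_def using K(1) by (simp add: closure_minimal compact_imp_closed)
  then show "compact (supp (\<lambda>x. T *v f x))"
    using K(1) by (metis supp_def closed_closure closed_Int_compact inf.absorb1)
qed

text \<open>The field \<open>\<sigma>(x) = \<kappa>(|x|\<^sup>2) x\<close>. Its derivatives are continuous with compact support, hence bounded.\<close>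

lemma localised_identity:
  assumes R: "0 \<le> R"
  obtains \<sigma> :: "real^2 \<Rightarrow> real^2" and K :: "nat \<times> nat \<Rightarrow> real" where
    "smooth \<sigma>" "\<And>x. norm x \<le> R \<Longrightarrow> \<sigma> x = x" "\<And>x. norm (\<sigma> x) \<le> norm x"
    "\<And>T :: real^2^2. test_function (\<lambda>x. T *v \<sigma> x)"
    "\<And>\<nu>. 0 \<le> K \<nu>" "\<And>\<nu> x. norm (multi_partial \<nu> \<sigma> x) \<le> K \<nu>"
    "\<And>\<nu>. continuous_on UNIV (multi_partial \<nu> \<sigma>)"
proof -
  obtain \<kappa> :: "nat \<Rightarrow> real \<Rightarrow> real" where \<kappa>: "derivative_chain \<kappa>"
    "\<And>t. t \<le> R\<^sup>2 \<Longrightarrow> \<kappa> 0 t = 1" "\<And>t. t \<ge> R\<^sup>2 + 1 \<Longrightarrow> \<kappa> 0 t = 0" "\<And>t. 0 \<le> \<kappa> 0 t \<and> \<kappa> 0 t \<le> 1"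
    using smooth_cutoff_profile[of "R\<^sup>2"] by metis
  define V where "V = range (\<lambda>(v :: real^2) (_ :: real^2). v)"
  have V: "partial_closed V"
  proof -
    have "partial k (\<lambda>_. v) = (\<lambda>_. 0)" for k and v :: "real^2"
      by (simp add: fun_eq_iff has_derivative_partial[OF has_derivative_const])
    then show ?thesis
      unfolding partial_closed_def V_def by auto
  qed
  define \<sigma> where "\<sigma> x = \<kappa> 0 (x \<bullet> x) *\<^sub>R x" for x :: "real^2"
  have "\<sigma> = (\<lambda>x. (x $ 1 * \<kappa> 0 (x \<bullet> x)) *\<^sub>R axis 1 1 + (x $ 2 * \<kappa> 0 (x \<bullet> x)) *\<^sub>R axis 2 1)"
    by (auto simp: \<sigma>_def fun_eq_iff vec_eq_iff forall_2 axis_def)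
  moreover have "radial_span \<kappa> V (\<lambda>x. (x $ k * \<kappa> 0 (x \<bullet> x)) *\<^sub>R axis k 1)" for k
  proof (rule radial_span.gen[of "\<lambda>x. x $ k" "\<lambda>_. axis k 1" V \<kappa> 0])
    show "real_polynomial_function (\<lambda>x::real^2. x $ k)"
      by (rule real_polynomial_function.intros(1)[OF bounded_linear_vec_nth])
  qed (auto simp: V_def)
  ultimately have span: "radial_span \<kappa> V \<sigma>"
    by (simp only: radial_span.add)
  have smooth: "smooth \<sigma>"
    by (rule smooth_radial_span[OF \<kappa>(1) V span])
  define B where "B = cball (0::real^2) (sqrt (R\<^sup>2 + 1))"
  have zero: "\<sigma> x = 0" if "x \<notin> B" for x
  proof -
    have "sqrt (R\<^sup>2 + 1) < norm x" using that by (simp add: B_def)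
    then have "R\<^sup>2 + 1 < (norm x)\<^sup>2"
      using power_strict_mono[of "sqrt (R\<^sup>2 + 1)" "norm x" 2] by simp
    then have "R\<^sup>2 + 1 \<le> x \<bullet> x" by (simp add: power2_norm_eq_inner)
    then show ?thesis by (simp add: \<sigma>_def \<kappa>(3))
  qed
  have cont: "continuous_on UNIV (multi_partial \<nu> \<sigma>)" for \<nu>
    unfolding multi_partial_foldr by (rule radial_span_continuous[OF \<kappa>(1) V radial_span_foldr[OF \<kappa>(1) V span]])
  have "\<exists>C\<ge>0. \<forall>x. norm (multi_partial \<nu> \<sigma> x) \<le> C" for \<nu>
  proof -
    have "bounded (multi_partial \<nu> \<sigma> ` B)"
      using continuous_on_subset[OF cont]
      by (intro compact_imp_bounded compact_continuous_image) (auto simp: B_def)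
    then obtain C where C: "\<And>x. x \<in> B \<Longrightarrow> norm (multi_partial \<nu> \<sigma> x) \<le> C" "C > 0"
      unfolding bounded_pos by auto
    have "multi_partial \<nu> \<sigma> x = 0" if "x \<notin> B" for x
      unfolding multi_partial_foldr
      by (rule foldr_partial_zero_outside[OF _ zero that]) (auto simp: B_def)
    then have "norm (multi_partial \<nu> \<sigma> x) \<le> C" for x
      using C by (cases "x \<in> B") auto
    then show ?thesis using C(2) by (intro exI[of _ C]) auto
  qed
  then obtain K where K: "\<And>\<nu>. 0 \<le> K \<nu>" "\<And>\<nu> x. norm (multi_partial \<nu> \<sigma> x) \<le> K \<nu>"
    by metis
  show ?thesis
  proof (rule that[of \<sigma> K])
    show "\<sigma> x = x" if "norm x \<le> R" for x
    proof -
      have "x \<bullet> x \<le> R\<^sup>2" using that by (simp add: power_mono flip: power2_norm_eq_inner)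
      then show ?thesis by (simp add: \<sigma>_def \<kappa>(2))
    qed
    show "norm (\<sigma> x) \<le> norm x" for x
      using \<kappa>(4)[of "x \<bullet> x"] by (simp add: \<sigma>_def mult_left_le_one_le)
    show "test_function (\<lambda>x. T *v \<sigma> x)" for T :: "real^2^2"
    proof (rule test_function_matrix[OF smooth])
      show "compact B" by (simp add: B_def)
    qed (rule zero)
  qed (use smooth K cont in auto)
qed

lemma C_norm_matrix_le:
  fixes T :: "real^2^2"
  assumes \<sigma>: "smooth \<sigma>" and K: "\<And>\<nu> x. norm (multi_partial \<nu> \<sigma> x) \<le> K \<nu>"
    and cont: "\<And>\<nu>. continuous_on UNIV (multi_partial \<nu> \<sigma>)"
    and T: "\<And>v. norm (T *v v) \<le> c * norm v" and c: "0 \<le> c"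
  shows "C_norm m (\<lambda>x. T *v \<sigma> x) \<le> ennreal ((\<Sum>\<nu> | fst \<nu> + snd \<nu> \<le> m. K \<nu>) * c)"
proof -
  have "Linf_norm UNIV (multi_partial \<nu> (\<lambda>x. T *v \<sigma> x)) \<le> ennreal (K \<nu> * c)" for \<nu>
  proof -
    have eq: "multi_partial \<nu> (\<lambda>x. T *v \<sigma> x) = (\<lambda>x. T *v multi_partial \<nu> \<sigma> x)"
      unfolding multi_partial_foldr by (rule foldr_partial_matrix[OF \<sigma>])
    have [measurable]: "multi_partial \<nu> \<sigma> \<in> borel_measurable borel"
      by (rule borel_measurable_continuous_onI[OF cont])
    have [measurable]: "(*v) T \<in> borel_measurable borel"
      by (intro borel_measurable_continuous_onI linear_continuous_on matrix_vector_mul_bounded_linear)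
    have "norm (T *v multi_partial \<nu> \<sigma> x) \<le> K \<nu> * c" for x
      using order_trans[OF T mult_left_mono[OF K c]] by (simp add: mult.commute)
    then show ?thesis
      unfolding Linf_norm_def eq
      by (intro esssup_I AE_I2 ennreal_leI) (auto simp: measurable_restrict_space1)
  qed
  moreover have K0: "0 \<le> K \<nu>" for \<nu>
    by (rule order_trans[OF norm_ge_zero K])
  ultimately show ?thesis
    unfolding C_norm_def sum_distrib_right
    by (subst sum_ennreal[symmetric]) (auto intro!: sum_mono mult_nonneg_nonneg c)
qed

section \<open>Deforming a wave packet\<close>

lemma norm_deformed_ge:
  fixes \<tau> :: "real^2 \<Rightarrow> real^2"
  assumes "norm (\<tau> x) \<le> norm x / 10"
  shows "norm x / 2 \<le> norm (x - \<tau> x)"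
  using norm_triangle_ineq2[of x "\<tau> x"] assms norm_ge_zero[of x] by linarith

text \<open>The deformed point satisfies \<open>|x - \<tau> x| \<ge> |x| / 2\<close>, so deforming at most halves the radius in the
  Gaussian. The bound does not involve the frequency \<open>\<zeta>\<close>.\<close>

lemma norm_packet_deformed_le:
  assumes a: "0 < a" and \<tau>: "norm (\<tau> x) \<le> norm x / 10"
  shows "norm (packet a \<zeta> (x - \<tau> x)) \<le> sqrt (2 * a) * gauss (a / 4) x"
proof -
  have "(norm x / 2)\<^sup>2 \<le> (norm (x - \<tau> x))\<^sup>2"
    by (intro power_mono norm_deformed_ge \<tau>) simp
  then have "x \<bullet> x / 4 \<le> (x - \<tau> x) \<bullet> (x - \<tau> x)"
    by (simp add: power_divide power2_norm_eq_inner)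
  then have "pi * a * (x \<bullet> x / 4) \<le> pi * a * ((x - \<tau> x) \<bullet> (x - \<tau> x))"
    using a by (intro mult_left_mono) auto
  then have "gauss a (x - \<tau> x) \<le> gauss (a / 4) x"
    by (simp add: gauss_def)
  then show ?thesis
    using a by (simp add: norm_packet)
qed

lemma tame_packet_deformed:
  assumes a: "0 < a" and \<tau>: "\<And>x. norm (\<tau> x) \<le> norm x / 10" and cont: "continuous_on UNIV \<tau>"
  shows "tame (\<lambda>x. packet a \<zeta> (x - \<tau> x))"
  using a by (intro tame_if_gauss_bound[OF _ _ norm_packet_deformed_le] \<tau> continuous_packet continuous_intros cont) auto

text \<open>Pulling back by the transpose of \<open>N\<close> moves frequencies by \<open>N\<close> itself, which is why the deformations
  use transposed matrices.\<close>

lemma fourier_linear_pullback: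
  fixes N :: "real^2^2"
  assumes N: "invertible N" and [measurable]: "f \<in> borel_measurable borel"
  shows "fourier (\<lambda>x. f (transpose N *v x)) (N *v \<xi>) = fourier f \<xi> /\<^sub>R \<bar>det N\<bar>"
proof -
  have T: "invertible (transpose N)" "det (transpose N) = det N"
    using N by (simp_all add: invertible_det_nz det_transpose)
  have "wave (- \<xi>) (transpose N *v x) = wave (- (N *v \<xi>)) x" for x
    by (simp add: wave_def dot_lmul_matrix)
  then have "fourier f \<xi> = \<bar>det N\<bar> *\<^sub>R fourier (\<lambda>x. f (transpose N *v x)) (N *v \<xi>)"
    unfolding fourier_wave using integral_linear[OF T(1), of "\<lambda>x. wave (- \<xi>) x * f x"] T(2) by simp
  then show ?thesis
    using N by (simp add: invertible_det_nz)
qed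

text \<open>The transform of the pulled back packet at \<open>N \<eta>\<close> is that of the packet at \<open>\<eta>\<close> divided by the determinant
  of \<open>N = Id - M\<close>. Frequencies \<open>N \<eta>\<close> with \<open>\<eta>\<close> in the ball are not seen by the filter, and the others carry
  only the spectral tail of the packet.\<close>

lemma packet_linear_pullback_leak:
  fixes M :: "real^2^2"
  assumes a: "0 < a" and \<rho>: "0 \<le> \<rho>" and M: "\<And>x. norm (M *v x) \<le> norm x / 10"
    and inv: "invertible (mat 1 - M)" and \<psi>: "integrable lborel \<psi>"
    and le: "AE \<xi> in lborel. norm (fourier \<psi> \<xi>) \<le> 1"
    and vanish: "\<And>\<xi>. \<xi> \<in> (*v) (mat 1 - M) ` ball \<zeta> \<rho> \<Longrightarrow> fourier \<psi> \<xi> = 0"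
  shows "sq_mass (conv (\<lambda>x. packet a \<zeta> (x - transpose M *v x)) \<psi>) \<le> ennreal (4 * exp (- (pi * \<rho>\<^sup>2 / a)))"
proof -
  let ?N = "mat 1 - M"
  define h where "h x = packet a \<zeta> (x - transpose M *v x)" for x
  have tr: "norm (transpose M *v x) \<le> norm x / 10" for x
    using norm_transpose_le[of M "1/10" x] M by simp
  have h: "tame h"
    unfolding h_def using a by (intro tame_packet_deformed tr linear_continuous_on matrix_vector_mul_bounded_linear)
  have "transpose ?N *v x = x - transpose M *v x" for x
    by (simp add: transpose_def mat_def matrix_vector_mult_def vec_eq_iff sum_2 forall_2 algebra_simps)
  then have h_alt: "h = (\<lambda>x. packet a \<zeta> (transpose ?N *v x))"
    by (simp add: h_def fun_eq_iff)
  have pm [measurable]: "packet a \<zeta> \<in> borel_measurable borel"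
    by (rule tame_measurable[OF tame_packet[OF a]])
  have fm [measurable]: "fourier (packet a \<zeta>) \<in> borel_measurable borel" "fourier \<psi> \<in> borel_measurable borel"
     "fourier h \<in> borel_measurable borel"
    using measurable_fourier tame_integrable[OF tame_packet[OF a]] tame_integrable[OF h] \<psi> by auto
  have det: "\<bar>det ?N\<bar> \<ge> 1 / 2"
    by (rule abs_det_id_minus_ge[OF M])
  let ?d = "\<bar>det ?N\<bar>"
  let ?U = "(*v) ?N ` ball \<zeta> \<rho>"
  have "sq_mass (conv h \<psi>) \<le> (\<integral>\<^sup>+\<xi>. ennreal ((norm (fourier h \<xi>))\<^sup>2) * indicator (- ?U) \<xi> \<partial>lborel)"
    unfolding sq_mass_conv[OF h \<psi>]
  proof (rule nn_integral_mono_AE, rule eventually_mono[OF le])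
    fix \<xi> assume "norm (fourier \<psi> \<xi>) \<le> 1"
    then have "(norm (fourier h \<xi>))\<^sup>2 * (norm (fourier \<psi> \<xi>))\<^sup>2 \<le> (norm (fourier h \<xi>))\<^sup>2"
      by (intro mult_right_le_one_le power_le_one) auto
    then show "ennreal ((norm (fourier h \<xi>))\<^sup>2 * (norm (fourier \<psi> \<xi>))\<^sup>2)
       \<le> ennreal ((norm (fourier h \<xi>))\<^sup>2) * indicator (- ?U) \<xi>"
      using vanish[of \<xi>] by (cases "\<xi> \<in> ?U") (auto intro: ennreal_leI)
  qed
  also have "\<dots> = ennreal ?d * (\<integral>\<^sup>+\<eta>. ennreal ((norm (fourier h (?N *v \<eta>)))\<^sup>2) * indicator (- ?U) (?N *v \<eta>) \<partial>lborel)"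
  proof (rule nn_integral_linear[OF inv])
    have "open ?U"
      using inv by (intro open_bijective_linear_image_eq[THEN iffD2]) (auto simp: invertible_eq_bij)
    then show "(\<lambda>\<xi>. ennreal ((norm (fourier h \<xi>))\<^sup>2) * indicator (- ?U) \<xi>) \<in> borel_measurable borel"
      by (intro borel_measurable_times_ennreal borel_measurable_indicator) auto
  qed
  also have "\<dots> = ennreal ?d * (\<integral>\<^sup>+\<eta>. ennreal (1 / ?d\<^sup>2) * (ennreal ((norm (fourier (packet a \<zeta>) \<eta>))\<^sup>2) * indicator (- ball \<zeta> \<rho>) \<eta>) \<partial>lborel)"
  proof (intro arg_cong[where f = "\<lambda>t. ennreal ?d * t"] nn_integral_cong)
    fix \<eta>
    have 1: "indicator (- ?U) (?N *v \<eta>) = (indicator (- ball \<zeta> \<rho>) \<eta> :: ennreal)"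
    proof -
      have "inj ((*v) ?N)" using inv by (simp add: invertible_eq_bij bij_def)
      then have "?N *v \<eta> \<in> ?U \<longleftrightarrow> \<eta> \<in> ball \<zeta> \<rho>" by (simp add: inj_image_mem_iff)
      then show ?thesis by (simp add: indicator_def)
    qed
    have "(norm (fourier h (?N *v \<eta>)))\<^sup>2 = 1 / ?d\<^sup>2 * (norm (fourier (packet a \<zeta>) \<eta>))\<^sup>2"
      unfolding h_alt fourier_linear_pullback[OF inv pm] by (simp add: power_mult_distrib divide_simps)
    then have 2: "ennreal ((norm (fourier h (?N *v \<eta>)))\<^sup>2) = ennreal (1 / ?d\<^sup>2) * ennreal ((norm (fourier (packet a \<zeta>) \<eta>))\<^sup>2)"
      by (simp only: ennreal_mult zero_le_power2 divide_nonneg_nonneg zero_le_one)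
    show "ennreal ((norm (fourier h (?N *v \<eta>)))\<^sup>2) * indicator (- ?U) (?N *v \<eta>)
       = ennreal (1 / ?d\<^sup>2) * (ennreal ((norm (fourier (packet a \<zeta>) \<eta>))\<^sup>2) * indicator (- ball \<zeta> \<rho>) \<eta>)"
      by (simp only: 1 2 mult.assoc)
  qed
  also have "\<dots> = ennreal (1 / ?d) * (\<integral>\<^sup>+\<eta>. ennreal ((norm (fourier (packet a \<zeta>) \<eta>))\<^sup>2) * indicator (- ball \<zeta> \<rho>) \<eta> \<partial>lborel)"
  proof -
    have [measurable]: "ball \<zeta> \<rho> \<in> sets borel" by simp
    have "ennreal ?d * ennreal (1 / ?d\<^sup>2) = ennreal (1 / ?d)"
    proof -
      have "x * (1 / x\<^sup>2) = 1 / x" for x :: real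
        by (simp add: power2_eq_square)
      then show ?thesis
        by (metis abs_ge_zero ennreal_mult' zero_le_power2 zero_le_divide_1_iff)
    qed
    moreover have "(\<integral>\<^sup>+\<eta>. ennreal (1 / ?d\<^sup>2) * (ennreal ((norm (fourier (packet a \<zeta>) \<eta>))\<^sup>2) * indicator (- ball \<zeta> \<rho>) \<eta>) \<partial>lborel)
       = ennreal (1 / ?d\<^sup>2) * (\<integral>\<^sup>+\<eta>. ennreal ((norm (fourier (packet a \<zeta>) \<eta>))\<^sup>2) * indicator (- ball \<zeta> \<rho>) \<eta> \<partial>lborel)"
      by (rule nn_integral_cmult) measurable
    ultimately show ?thesis
      by (simp only: mult.assoc[symmetric])
  qed
  also have "\<dots> \<le> ennreal 2 * ennreal (2 * exp (- (pi * \<rho>\<^sup>2 / a)))"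
  proof (rule mult_mono)
    have "1 / ?d \<le> 1 / (1 / 2)" using det by (intro divide_left_mono) auto
    then show "ennreal (1 / ?d) \<le> ennreal 2" by (intro ennreal_leI) simp
  qed (use packet_spectral_tail[OF a \<rho>] in auto)
  also have "\<dots> = ennreal (4 * exp (- (pi * \<rho>\<^sup>2 / a)))"
    by (subst ennreal_mult[symmetric]) auto
  finally show ?thesis
    by (simp only: h_def[abs_def])
qed

text \<open>The deformed packet agrees with the linear pullback for \<open>|x| \<le> R\<close>. Beyond that radius both are bounded
  by a Gaussian, so their difference has exponentially small energy, and the filter does not increase
  it.\<close>

lemma deformed_packet_leak:
  fixes M :: "real^2^2"
  assumes a: "0 < a" and \<rho>: "0 \<le> \<rho>" and M: "\<And>x. norm (M *v x) \<le> norm x / 10"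
    and inv: "invertible (mat 1 - M)" and \<psi>: "integrable lborel \<psi>"
    and le: "AE \<xi> in lborel. norm (fourier \<psi> \<xi>) \<le> 1"
    and vanish: "\<And>\<xi>. \<xi> \<in> (*v) (mat 1 - M) ` ball \<zeta> \<rho> \<Longrightarrow> fourier \<psi> \<xi> = 0"
    and R: "0 \<le> R" and \<sigma>: "continuous_on UNIV \<sigma>" "\<And>x. norm x \<le> R \<Longrightarrow> \<sigma> x = x" "\<And>x. norm (\<sigma> x) \<le> norm x"
  shows "sq_mass (conv (deform (\<lambda>x. transpose M *v \<sigma> x) (packet a \<zeta>)) \<psi>)
    \<le> ennreal (8 * exp (- (pi * \<rho>\<^sup>2 / a)) + 64 * exp (- (pi * a * R\<^sup>2 / 4)))"
proof -
  let ?T = "transpose M"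
  define u where "u x = packet a \<zeta> (x - ?T *v \<sigma> x)" for x
  define h where "h x = packet a \<zeta> (x - ?T *v x)" for x
  have tr: "norm (?T *v x) \<le> norm x / 10" for x
    using norm_transpose_le[of M "1/10" x] M by simp
  have tr': "norm (?T *v \<sigma> x) \<le> norm x / 10" for x
    using tr[of "\<sigma> x"] \<sigma>(3)[of x] by simp
  have cT: "continuous_on UNIV ((*v) ?T)"
    by (intro linear_continuous_on matrix_vector_mul_bounded_linear)
  have h: "tame h"
    unfolding h_def using a by (intro tame_packet_deformed tr cT)
  have u: "tame u"
    unfolding u_def using a continuous_on_compose2[OF cT \<sigma>(1)] by (intro tame_packet_deformed tr') auto
  have uh: "tame (\<lambda>x. u x - h x)" by (rule tame_diff[OF u h])
  have conv_diff: "conv u \<psi> x - conv h \<psi> x = conv (\<lambda>x. u x - h x) \<psi> x" for x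
  proof -
    have I: "integrable lborel (\<lambda>y. v (x - y) * \<psi> y)" if v: "tame v" for v
    proof -
      obtain B where B: "\<And>x. norm (v x) \<le> B" using tame_bound[OF v] by metis
      have [measurable]: "v \<in> borel_measurable borel" "\<psi> \<in> borel_measurable borel"
        using tame_measurable[OF v] \<psi> by auto
      show ?thesis
        by (rule Bochner_Integration.integrable_bound[of _ "\<lambda>y. B *\<^sub>R \<psi> y"])
           (use \<psi> B order_trans[OF norm_ge_zero B] in \<open>auto simp: norm_mult intro!: mult_right_mono\<close>)
    qed
    show ?thesis
      unfolding conv_def by (simp add: I[OF u] I[OF h] left_diff_distrib)
  qed
  have pt: "(norm (u x - h x))\<^sup>2 \<le> 8 * a * exp (- (pi * a * R\<^sup>2 / 4)) * gauss (a / 4) x" for x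
  proof (cases "norm x \<le> R")
    case True
    then show ?thesis using a by (simp add: u_def h_def \<sigma>(2))
  next
    case False
    have "norm (u x - h x) \<le> norm (u x) + norm (h x)" by (rule norm_triangle_ineq4)
    also have "\<dots> \<le> 2 * (sqrt (2 * a) * gauss (a / 4) x)"
      unfolding u_def h_def
      using norm_packet_deformed_le[of a "\<lambda>x. ?T *v \<sigma> x" x \<zeta>] norm_packet_deformed_le[of a "\<lambda>x. ?T *v x" x \<zeta>] a tr tr' by simp
    finally have "(norm (u x - h x))\<^sup>2 \<le> (2 * (sqrt (2 * a) * gauss (a / 4) x))\<^sup>2"
      by (intro power_mono) auto
    also have "\<dots> = 8 * a * (gauss (a / 4) x * gauss (a / 4) x)"
      using a by (simp add: power_mult_distrib, simp add: power2_eq_square)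
    also have "\<dots> \<le> 8 * a * (exp (- (pi * a * R\<^sup>2 / 4)) * gauss (a / 4) x)"
    proof (intro mult_left_mono mult_right_mono)
      have "R\<^sup>2 \<le> x \<bullet> x"
        using False R by (simp add: power_mono flip: power2_norm_eq_inner)
      then show "gauss (a / 4) x \<le> exp (- (pi * a * R\<^sup>2 / 4))"
        using a by (simp add: gauss_def divide_right_mono mult_left_mono)
    qed (use a in auto)
    finally show ?thesis by (simp add: mult.assoc)
  qed
  have "sq_mass (\<lambda>x. u x - h x) \<le> (\<integral>\<^sup>+x. ennreal (8 * a * exp (- (pi * a * R\<^sup>2 / 4))) * ennreal (gauss (a / 4) x) \<partial>lborel)"
    unfolding sq_mass_alt using a by (intro nn_integral_mono) (simp add: pt ennreal_leI flip: ennreal_mult)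
  also have "\<dots> = ennreal (32 * exp (- (pi * a * R\<^sup>2 / 4)))"
    using a nn_integral_gauss[of "a / 4"] by (subst nn_integral_cmult) (auto simp flip: ennreal_mult)
  finally have E: "sq_mass (\<lambda>x. u x - h x) \<le> ennreal (32 * exp (- (pi * a * R\<^sup>2 / 4)))" .
  have "sq_mass (conv u \<psi>) \<le> 2 * sq_mass (\<lambda>x. conv u \<psi> x - conv h \<psi> x) + 2 * sq_mass (conv h \<psi>)"
    by (intro sq_mass_le_diff tame_measurable tame_conv u h \<psi>)
  also have "sq_mass (\<lambda>x. conv u \<psi> x - conv h \<psi> x) \<le> sq_mass (\<lambda>x. u x - h x)"
    unfolding conv_diff by (rule sq_mass_conv_le[OF uh \<psi> le])
  also note E
  also have "sq_mass (conv h \<psi>) \<le> ennreal (4 * exp (- (pi * \<rho>\<^sup>2 / a)))"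
    unfolding h_def by (rule packet_linear_pullback_leak[OF a \<rho> M inv \<psi> le vanish])
  finally have "sq_mass (conv u \<psi>) \<le> 2 * ennreal (32 * exp (- (pi * a * R\<^sup>2 / 4))) + 2 * ennreal (4 * exp (- (pi * \<rho>\<^sup>2 / a)))"
    by (simp add: mult_left_mono add_mono)
  also have "\<dots> = ennreal (8 * exp (- (pi * \<rho>\<^sup>2 / a)) + 64 * exp (- (pi * a * R\<^sup>2 / 4)))"
    by (simp add: ennreal_plus ennreal_mult add.commute)
  finally show ?thesis
    by (simp add: u_def[abs_def] deform_def[abs_def])
qed

text \<open>The Jacobian of \<open>x \<mapsto> x - \<tau>(x)\<close> is at most 8, and the map is a bijection of the plane because \<open>\<tau>\<close> is a
  contraction.\<close>

lemma sq_mass_le_deform: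
  assumes diff: "\<And>x. \<tau> differentiable at x" and cont: "\<And>k. continuous_on UNIV (partial k \<tau>)"
    and small: "\<And>k x. norm (partial k \<tau> x) \<le> 1 / 20" and [measurable]: "F \<in> borel_measurable borel"
  shows "sq_mass F \<le> 8 * sq_mass (deform \<tau> F)"
proof -
  define D where "D x v = (\<Sum>k\<in>UNIV. (v $ k) *\<^sub>R partial k \<tau> x)" for x v
  have der: "(\<tau> has_derivative D x) (at x)" for x
    unfolding D_def by (rule has_derivative_plane[OF diff])
  have D_le: "norm (D x v) \<le> 1 / 10 * norm v" for x v
  proof -
    have "norm (D x v) \<le> \<bar>v $ 1\<bar> * norm (partial 1 \<tau> x) + \<bar>v $ 2\<bar> * norm (partial 2 \<tau> x)"
      unfolding D_def sum_2 by (rule order_trans[OF norm_triangle_ineq]) simp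
    also have "\<dots> \<le> norm v * (1 / 20) + norm v * (1 / 20)"
      by (intro add_mono mult_mono small component_le_norm_cart) auto
    finally show ?thesis by simp
  qed
  have lip: "norm (\<tau> x - \<tau> y) \<le> 1 / 10 * norm (x - y)" for x y
  proof (rule differentiable_bound[of UNIV \<tau> D])
    show "onorm (D x) \<le> 1 / 10" for x
      by (rule onorm_bound[OF _ D_le]) simp
  qed (auto intro: der)
  have bij: "bij (\<lambda>x. x - \<tau> x)"
    by (rule bij_id_minus_contraction[OF lip]) auto
  define \<phi>' where "\<phi>' x = (\<lambda>v. v - D x v)" for x
  have der': "((\<lambda>x. x - \<tau> x) has_derivative \<phi>' x) (at x)" for x
    unfolding \<phi>'_def by (intro has_derivative_diff has_derivative_ident der)
  have entry: "matrix (\<phi>' x) $ i $ k = (if i = k then 1 else 0) - partial k \<tau> x $ i" for x i k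
  proof -
    have "D x (axis k 1) = partial k \<tau> x"
      using exhaust_2[of k] by (auto simp: D_def sum_2 axis_def)
    then show ?thesis
      by (simp add: matrix_def \<phi>'_def axis_def eq_commute)
  qed
  have [measurable]: "(\<lambda>x. partial k \<tau> x $ i) \<in> borel_measurable borel" for k i
    by (intro borel_measurable_continuous_onI continuous_intros cont)
  have meas [measurable]: "(\<lambda>x. det (matrix (\<phi>' x))) \<in> borel_measurable borel"
    unfolding det_2 entry by measurable
  have det: "\<bar>det (matrix (\<phi>' x))\<bar> \<le> 8" for x
  proof (rule abs_det_le)
    fix v
    have "matrix (\<phi>' x) *v v = \<phi>' x v"
      using fun_cong[OF matrix_vector_mul(2)[OF has_derivative_linear[OF der']]] by blast
    moreover have "norm (v - D x v) \<le> 2 * norm v"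
      using norm_triangle_ineq4[of v "D x v"] D_le[of x v] norm_ge_zero[of v] by linarith
    ultimately show "norm (matrix (\<phi>' x) *v v) \<le> 2 * norm v"
      by (simp add: \<phi>'_def)
  qed
  have [measurable]: "\<tau> \<in> borel_measurable borel"
    using has_derivative_continuous[OF der]
    by (intro borel_measurable_continuous_onI) (simp add: continuous_on_eq_continuous_at)
  have "sq_mass F = (\<integral>\<^sup>+x. ennreal \<bar>det (matrix (\<phi>' x))\<bar> * ennreal ((norm (F (x - \<tau> x)))\<^sup>2) \<partial>lborel)"
    unfolding sq_mass_alt
    by (subst distr_density_diffeo[OF der' bij meas, symmetric]) (simp add: nn_integral_distr nn_integral_density)
  also have "\<dots> \<le> (\<integral>\<^sup>+x. 8 * ennreal ((norm (F (x - \<tau> x)))\<^sup>2) \<partial>lborel)"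
    using det ennreal_leI[OF det] by (intro nn_integral_mono mult_right_mono) auto
  also have "\<dots> = 8 * sq_mass (deform \<tau> F)"
    unfolding sq_mass_alt deform_def by (rule nn_integral_cmult) measurable
  finally show ?thesis .
qed

section \<open>The instability estimate\<close>

lemma ennreal_le_from_linear:
  assumes "ennreal q \<le> ennreal k * X + ennreal p" "0 < k" "0 \<le> p"
  shows "ennreal ((q - p) / k) \<le> X"
proof (cases X)
  case (real x)
  then have "q \<le> k * x + p"
    using assms by (simp add: ennreal_le_iff flip: ennreal_mult ennreal_plus)
  then have "(q - p) / k \<le> x" using assms by (simp add: field_simps)
  then show ?thesis using real by (simp add: ennreal_leI)
qed simp

text \<open>At least half of the energy of the packet lies in the ball, where the multiplier is at least \<open>c\<close> and the
  modulated Gaussian of \<open>modulus_lowpass_lower_bound\<close> is at least its value on the boundary.\<close>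

lemma core_modulus_lower_bound:
  assumes a: "0 < a" and s: "0 < s" and c: "0 \<le> c" and \<rho>: "0 \<le> \<rho>" and r: "0 \<le> r"
    and chi: "integrable lborel chi" and \<psi>: "integrable lborel \<psi>"
    and flat: "AE \<xi> in lborel. norm \<xi> < r \<longrightarrow> norm (fourier chi \<xi>) = 1"
    and le: "AE \<xi> in lborel. norm (fourier \<psi> \<xi>) \<le> 1"
    and core: "\<And>\<xi>. \<xi> \<in> ball \<zeta> \<rho> \<Longrightarrow> c \<le> norm (fourier \<psi> \<xi>)"
    and tail: "2 * exp (- (pi * \<rho>\<^sup>2 / a)) \<le> 1 / 2"
  shows "ennreal (c\<^sup>2 * exp (- (2 * pi * s * \<rho>\<^sup>2)) / 2)
    \<le> sq_mass (conv (\<lambda>x. complex_of_real (norm (conv (packet a \<zeta>) \<psi> x))) chi)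
       + ennreal (exp (- (2 * pi * s * r\<^sup>2)))"
proof -
  let ?f = "packet a \<zeta>"
  let ?F = "conv ?f \<psi>"
  let ?k = "c\<^sup>2 * exp (- (2 * pi * s * \<rho>\<^sup>2))"
  have f: "tame ?f" by (rule tame_packet[OF a])
  have F: "tame ?F" by (rule tame_conv[OF f \<psi>])
  have [measurable]: "fourier ?f \<in> borel_measurable borel"
    by (rule measurable_fourier[OF tame_integrable[OF f]])
  have [measurable]: "ball \<zeta> \<rho> \<in> sets borel"
    by simp
  let ?in = "\<integral>\<^sup>+\<xi>. ennreal ((norm (fourier ?f \<xi>))\<^sup>2) * indicator (ball \<zeta> \<rho>) \<xi> \<partial>lborel"
  let ?out = "\<integral>\<^sup>+\<xi>. ennreal ((norm (fourier ?f \<xi>))\<^sup>2) * indicator (- ball \<zeta> \<rho>) \<xi> \<partial>lborel"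
  have "1 = (\<integral>\<^sup>+\<xi>. ennreal ((norm (fourier ?f \<xi>))\<^sup>2) \<partial>lborel)"
    using plancherel[OF f] sq_mass_packet[OF a] by (simp add: sq_mass_alt)
  also have "\<dots> = (\<integral>\<^sup>+\<xi>. ennreal ((norm (fourier ?f \<xi>))\<^sup>2) * indicator (ball \<zeta> \<rho>) \<xi>
      + ennreal ((norm (fourier ?f \<xi>))\<^sup>2) * indicator (- ball \<zeta> \<rho>) \<xi> \<partial>lborel)"
    by (intro nn_integral_cong) (auto simp: indicator_def)
  also have "\<dots> = ?in + ?out"
    by (rule nn_integral_add; measurable)
  also have "\<dots> \<le> ?in + ennreal (1 / 2)"
    using order_trans[OF packet_spectral_tail[OF a \<rho>] ennreal_leI[OF tail]] by (intro add_left_mono) auto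
  finally have "ennreal 1 \<le> ennreal 1 * ?in + ennreal (1 / 2)"
    by simp
  from ennreal_le_from_linear[OF this] have inside: "ennreal (1 / 2) \<le> ?in"
    by simp
  have "ennreal (?k / 2) = ennreal ?k * ennreal (1 / 2)"
    by (subst ennreal_mult[symmetric]) auto
  also have "\<dots> \<le> ennreal ?k * ?in"
    by (intro mult_left_mono inside) simp
  also have "\<dots> = (\<integral>\<^sup>+\<xi>. ennreal ?k * (ennreal ((norm (fourier ?f \<xi>))\<^sup>2) * indicator (ball \<zeta> \<rho>) \<xi>) \<partial>lborel)"
    by (rule nn_integral_cmult[symmetric]) measurable
  also have "\<dots> \<le> (\<integral>\<^sup>+\<xi>. ennreal ((norm (fourier ?F \<xi>))\<^sup>2 * gauss (2 * s) (\<xi> - \<zeta>)) \<partial>lborel)"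
  proof (rule nn_integral_mono)
    fix \<xi>
    show "ennreal ?k * (ennreal ((norm (fourier ?f \<xi>))\<^sup>2) * indicator (ball \<zeta> \<rho>) \<xi>)
      \<le> ennreal ((norm (fourier ?F \<xi>))\<^sup>2 * gauss (2 * s) (\<xi> - \<zeta>))"
    proof (cases "\<xi> \<in> ball \<zeta> \<rho>")
      case True
      then have "(\<xi> - \<zeta>) \<bullet> (\<xi> - \<zeta>) \<le> \<rho>\<^sup>2"
        by (simp add: dist_norm norm_minus_commute power_mono flip: power2_norm_eq_inner)
      then have "exp (- (2 * pi * s * \<rho>\<^sup>2)) \<le> gauss (2 * s) (\<xi> - \<zeta>)"
        using s by (simp add: gauss_def mult_ac mult_left_mono)
      moreover have "c\<^sup>2 \<le> (norm (fourier \<psi> \<xi>))\<^sup>2"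
        using core[OF True] c by (intro power_mono) auto
      ultimately have "?k * (norm (fourier ?f \<xi>))\<^sup>2
         \<le> ((norm (fourier \<psi> \<xi>))\<^sup>2 * gauss (2 * s) (\<xi> - \<zeta>)) * (norm (fourier ?f \<xi>))\<^sup>2"
        by (intro mult_right_mono mult_mono) auto
      then show ?thesis
        using True by (simp add: fourier_conv[OF tame_integrable[OF f] \<psi>] norm_mult power_mult_distrib mult_ac
            ennreal_leI flip: ennreal_mult)
    qed simp
  qed
  also have "\<dots> \<le> sq_mass (conv (\<lambda>x. complex_of_real (norm (?F x))) chi)
        + ennreal (exp (- (2 * pi * s * r\<^sup>2))) * sq_mass ?F"
    by (rule modulus_lowpass_lower_bound[OF F chi s r flat])
  also have "\<dots> \<le> sq_mass (conv (\<lambda>x. complex_of_real (norm (?F x))) chi)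
        + ennreal (exp (- (2 * pi * s * r\<^sup>2))) * 1"
    using sq_mass_conv_le[OF f \<psi> le] by (intro add_left_mono mult_left_mono) (auto simp: sq_mass_packet[OF a])
  finally show ?thesis by simp
qed

lemma sq_mass_diff_commute: "sq_mass (\<lambda>x. f x - g x) = sq_mass (\<lambda>x. g x - f x)"
  by (simp add: sq_mass_alt norm_minus_commute)

lemma sq_mass_norm: "sq_mass (\<lambda>x. complex_of_real (norm (f x))) = sq_mass f"
  by (simp add: sq_mass_alt)

text \<open>Both low-pass filtering and taking the modulus do not increase energy, so the coefficient of \<open>g\<close> inherits the
  smallness of the leak.\<close>

lemma scattering_gap:
  assumes f: "tame f" and g: "tame g" and \<psi>: "integrable lborel \<psi>" and chi: "integrable lborel chi"
    and le: "AE \<xi> in lborel. norm (fourier chi \<xi>) \<le> 1"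
    and lower: "ennreal q \<le> sq_mass (conv (\<lambda>x. complex_of_real (norm (conv f \<psi> x))) chi)"
    and leak: "sq_mass (conv g \<psi>) \<le> ennreal (q / 32)" and q: "0 \<le> q"
  shows "ennreal (q / 32) \<le> sq_mass (\<lambda>x. conv (\<lambda>x. complex_of_real (norm (conv g \<psi> x))) chi x
      - conv (\<lambda>x. complex_of_real (norm (conv f \<psi> x))) chi x)"
proof -
  define A where "A = conv (\<lambda>x. complex_of_real (norm (conv f \<psi> x))) chi"
  define B where "B = conv (\<lambda>x. complex_of_real (norm (conv g \<psi> x))) chi"
  have t: "tame (\<lambda>x. complex_of_real (norm (conv f \<psi> x)))" "tame (\<lambda>x. complex_of_real (norm (conv g \<psi> x)))"
    by (intro tame_norm tame_conv f g \<psi>)+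
  have "ennreal q \<le> 2 * sq_mass (\<lambda>x. A x - B x) + 2 * sq_mass B"
    using lower sq_mass_le_diff[of A B] tame_measurable[OF tame_conv[OF t(1) chi]] tame_measurable[OF tame_conv[OF t(2) chi]]
    unfolding A_def B_def by (meson order_trans)
  also have "sq_mass B \<le> ennreal (q / 32)"
    using order_trans[OF sq_mass_conv_le[OF t(2) chi le]] leak unfolding B_def sq_mass_norm by blast
  finally have "ennreal q \<le> ennreal 2 * sq_mass (\<lambda>x. A x - B x) + ennreal (q / 16)"
    using q by (simp add: mult_left_mono add_mono ennreal_mult[of 2 "q / 32", simplified, symmetric])
  from ennreal_le_from_linear[OF this] q have "ennreal ((q - q / 16) / 2) \<le> sq_mass (\<lambda>x. B x - A x)"
    by (simp add: sq_mass_diff_commute[of B A])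
  moreover have "ennreal (q / 32) \<le> ennreal ((q - q / 16) / 2)"
    using q by (intro ennreal_leI) simp
  ultimately show ?thesis
    unfolding A_def B_def by (meson order_trans)
qed

text \<open>Deforming after filtering keeps at least an eighth of the energy, while filtering after deforming leaves
  only the leak.\<close>

lemma commutator_gap:
  assumes f: "tame f" and g: "tame (deform \<tau> f)" and \<psi>: "integrable lborel \<psi>"
    and lower: "ennreal q \<le> sq_mass (conv f \<psi>)"
    and leak: "sq_mass (conv (deform \<tau> f) \<psi>) \<le> ennreal (q / 32)" and q: "0 \<le> q"
    and \<tau>: "\<And>x. \<tau> differentiable at x" "\<And>k. continuous_on UNIV (partial k \<tau>)" "\<And>k x. norm (partial k \<tau> x) \<le> 1 / 20"
  shows "ennreal (q / 32) \<le> sq_mass (\<lambda>x. conv (deform \<tau> f) \<psi> x - deform \<tau> (conv f \<psi>) x)"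
proof -
  let ?F = "conv f \<psi>" and ?C = "conv (deform \<tau> f) \<psi>"
  have F [measurable]: "?F \<in> borel_measurable borel"
    by (intro tame_measurable tame_conv f \<psi>)
  have C [measurable]: "?C \<in> borel_measurable borel"
    by (intro tame_measurable tame_conv g \<psi>)
  have [measurable]: "\<tau> \<in> borel_measurable borel"
    using \<tau>(1) by (intro borel_measurable_continuous_onI)
      (simp add: continuous_on_eq_continuous_at differentiable_imp_continuous_within)
  have D [measurable]: "deform \<tau> ?F \<in> borel_measurable borel"
    unfolding deform_def[abs_def] by measurable
  have "ennreal q \<le> 8 * sq_mass (deform \<tau> ?F)"
    by (rule order_trans[OF lower sq_mass_le_deform[OF \<tau> F]])
  also have "\<dots> \<le> 8 * (2 * sq_mass (\<lambda>x. deform \<tau> ?F x - ?C x) + 2 * sq_mass ?C)"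
    by (intro mult_left_mono sq_mass_le_diff D C) simp
  also have "\<dots> \<le> 8 * (2 * sq_mass (\<lambda>x. deform \<tau> ?F x - ?C x) + 2 * ennreal (q / 32))"
    by (intro mult_left_mono add_left_mono leak) auto
  also have "\<dots> = ennreal 16 * sq_mass (\<lambda>x. deform \<tau> ?F x - ?C x) + ennreal (q / 2)"
  proof -
    have "8 * (2 * ennreal (q / 32)) = ennreal (q / 2)"
      using q by (simp add: mult.assoc[symmetric] ennreal_mult[of 16 "q / 32", simplified, symmetric])
    then show ?thesis by (simp add: distrib_left mult.assoc[symmetric])
  qed
  finally have "ennreal ((q - q / 2) / 16) \<le> sq_mass (\<lambda>x. deform \<tau> ?F x - ?C x)"
    using q by (intro ennreal_le_from_linear) auto
  then show ?thesis
    by (simp add: sq_mass_diff_commute[of ?C])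
qed

theorem theorem1p1:
  fixes \<alpha> \<beta> \<epsilon>0 r0 :: real and j0 :: nat
    and chi :: "real^2 \<Rightarrow> complex" and \<psi> :: "tile \<Rightarrow> real^2 \<Rightarrow> complex"
    and idx :: "nat \<Rightarrow> tile" and \<zeta> :: "nat \<Rightarrow> real^2" and M :: "nat \<Rightarrow> real^2^2"
  assumes "0 \<le> \<beta>" and "\<beta> \<le> \<alpha>" and "\<alpha> \<le> 1" and "\<beta> < 1"
    and "0 < \<epsilon>0" and "\<epsilon>0 < 1 / 32"
    and "scattering_bank \<alpha> \<beta> \<epsilon>0 chi \<psi>"
    and "active_core_system \<alpha> \<beta> \<epsilon>0 j0 r0 idx \<zeta> M"
    and "active_core_condition j0 r0 idx \<zeta> \<psi>"
    and "active_core_regularity j0 r0 idx \<zeta> \<psi>"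
  shows "\<exists>(f :: nat \<Rightarrow> real^2 \<Rightarrow> complex) (\<tau> :: nat \<Rightarrow> real^2 \<Rightarrow> real^2) (c :: real) (C :: nat \<Rightarrow> real).
    (\<forall>j. schwartz (f j) \<and> L2_norm (f j) = 1) \<and>
    (\<forall>j. test_function (\<tau> j)) \<and>
    0 < c \<and>
    (\<forall>\<^sub>F j in sequentially.
       (\<forall>m. C_norm m (\<tau> j) \<le> ennreal (C m * 2 powr (- (1 - \<beta>) * real j))) \<and>
       l2L2_norm (I_star \<alpha> \<beta>)
         (\<lambda>i x. scat1 chi \<psi> (deform (\<tau> j) (f j)) i x - scat1 chi \<psi> (f j) i x) \<ge> ennreal c \<and>
       l2L2_norm (I_all \<alpha> \<beta>) (filter_commutator chi \<psi> (\<tau> j) (f j)) \<ge> ennreal c)"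
proof -
  note bank = \<open>scattering_bank \<alpha> \<beta> \<epsilon>0 chi \<psi>\<close>
  note core_sys = \<open>active_core_system \<alpha> \<beta> \<epsilon>0 j0 r0 idx \<zeta> M\<close>
  have r0: "0 < r0"
    using core_sys by (simp add: active_core_system_def)
  obtain c1 where c1: "0 < c1" "\<And>j \<xi>. j0 \<le> j \<Longrightarrow> \<xi> \<in> ball (\<zeta> j) r0 \<Longrightarrow> c1 \<le> norm (fourier (\<psi> (idx j)) \<xi>)"
    using \<open>active_core_condition j0 r0 idx \<zeta> \<psi>\<close> unfolding active_core_condition_def by metis
  obtain b where b: "0 < b" "\<And>j. j0 \<le> j \<Longrightarrow> onorm ((*v) (M j)) \<le> b * 2 powr (- (1 - \<beta>) * real j)"
    using core_sys unfolding active_core_system_def comparable_from_def by metis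
  have chi: "integrable lborel chi"
    using bank by (simp add: scattering_bank_def in_L1_L2_def)
  have \<psi>: "integrable lborel (\<psi> i)" if "i \<in> I_star \<alpha> \<beta>" for i
    using bank that by (simp add: scattering_bank_def in_L1_L2_def)
  have bounds: "AE \<xi> in lborel. norm (fourier chi \<xi>) \<le> 1 \<and>
       (\<forall>i\<in>I_star \<alpha> \<beta>. norm (fourier (\<psi> i) \<xi>) \<le> 1) \<and>
       (norm \<xi> < 15 / 16 \<longrightarrow> norm (fourier chi \<xi>) = 1)"
    by (rule bank_multiplier_bounds) fact+
  define c where "c = min c1 1"
  have c: "0 < c" "c \<le> 1" "c \<le> c1" using c1 by (auto simp: c_def)
  define \<rho> where "\<rho> = min r0 (1 / 2)"
  have \<rho>: "0 < \<rho>" "\<rho> \<le> r0" "\<rho> \<le> 1 / 2" using r0 by (auto simp: \<rho>_def)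
  \<comment> \<open>The quantity \<open>q\<close> is the lower bound for the energy of the averaged modulus: \<open>core_modulus_lower_bound\<close>
    yields \<open>2 q\<close> up to an error \<open>q\<close>.\<close>
  define q where "q = c ^ 4 / 16"
  have q: "0 < q" "q \<le> 1 / 16"
    using c power_le_one[of c 4] by (auto simp: q_def)
  \<comment> \<open>The Gaussian kernel must be nearly flat at distance \<open>\<rho> \<le> 1/2\<close> compared with its decay at distance
    15/16: the main term is at least \<open>c\<^sup>2 exp(- \<pi> s / 2) / 2\<close> and the error is at most \<open>exp(- \<pi> s)\<close>. The choice
    \<open>exp(- \<pi> s / 2) = c\<^sup>2 / 4\<close> makes the first bound twice the second.\<close>
  define s where "s = - (2 / pi) * ln (c\<^sup>2 / 4)"
  have c4: "0 < c\<^sup>2 / 4" "c\<^sup>2 / 4 < 1"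
    using c power_le_one[of c 2] by auto
  have s: "0 < s" "exp (- (pi * s / 2)) = c\<^sup>2 / 4"
  proof -
    have "0 < (2 / pi) * - ln (c\<^sup>2 / 4)"
      using ln_less_zero[OF c4] by (intro mult_pos_pos) auto
    then show "0 < s" by (simp add: s_def)
    have "- (pi * s / 2) = ln (c\<^sup>2 / 4)" by (simp add: s_def)
    then show "exp (- (pi * s / 2)) = c\<^sup>2 / 4" using c4 by simp
  qed
  \<comment> \<open>The two error terms of \<open>deformed_packet_leak\<close> are made equal to \<open>q / 64\<close>: the spectral tail by the
    choice of \<open>a\<close>, and then the spatial tail by the choice of \<open>R\<close>.\<close>
  define a where "a = pi * \<rho>\<^sup>2 / ln (512 / q)"
  have a: "0 < a" "exp (- (pi * \<rho>\<^sup>2 / a)) = q / 512"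
  proof -
    have "0 < ln (512 / q)" using q by (intro ln_gt_zero) (simp add: field_simps)
    then show "0 < a" using \<rho> by (simp add: a_def)
    have "pi * \<rho>\<^sup>2 / a = ln (512 / q)" using \<rho> by (simp add: a_def)
    then show "exp (- (pi * \<rho>\<^sup>2 / a)) = q / 512" using q by (simp add: exp_minus)
  qed
  define R where "R = sqrt (4 * ln (4096 / q) / (pi * a))"
  have R: "0 \<le> R" "exp (- (pi * a * R\<^sup>2 / 4)) = q / 4096"
  proof -
    have l: "0 < ln (4096 / q)" using q by (intro ln_gt_zero) (simp add: field_simps)
    then show "0 \<le> R" using a(1) by (simp add: R_def)
    have "R\<^sup>2 = 4 * ln (4096 / q) / (pi * a)" using l a(1) by (simp add: R_def)
    then have "pi * a * R\<^sup>2 / 4 = ln (4096 / q)" using a(1) by simp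
    then show "exp (- (pi * a * R\<^sup>2 / 4)) = q / 4096" using q by (simp add: exp_minus)
  qed
  obtain \<sigma> K where \<sigma>: "smooth \<sigma>" "\<And>x. norm x \<le> R \<Longrightarrow> \<sigma> x = x" "\<And>x. norm (\<sigma> x) \<le> norm x"
    "\<And>T :: real^2^2. test_function (\<lambda>x. T *v \<sigma> x)"
    "\<And>\<nu>. 0 \<le> K \<nu>" "\<And>\<nu> x. norm (multi_partial \<nu> \<sigma> x) \<le> K \<nu>"
    "\<And>\<nu>. continuous_on UNIV (multi_partial \<nu> \<sigma>)"
    using localised_identity[OF R(1)] by metis
  have \<sigma>_cont: "continuous_on UNIV \<sigma>"
    using \<sigma>(7)[of "(0, 0)"] by (simp add: multi_partial_def)
  have \<sigma>_diff: "\<sigma> differentiable at x" for x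
    using \<sigma>(1)[unfolded smooth_def, rule_format, of "[]"] by (simp add: differentiable_on_def)
  define \<tau> where "\<tau> j x = transpose (M j) *v \<sigma> x" for j x
  \<comment> \<open>A common bound for the first partial derivatives; the summand 1 keeps it positive.\<close>
  define K1 where "K1 = 1 + K (1, 0) + K (0, 1)"
  have K1: "1 \<le> K1" "norm (partial k \<sigma> x) \<le> K1" "continuous_on UNIV (partial k \<sigma>)" for k x
  proof -
    show "1 \<le> K1" using \<sigma>(5) by (simp add: K1_def)
    have "partial 1 \<sigma> = multi_partial (1, 0) \<sigma>" "partial 2 \<sigma> = multi_partial (0, 1) \<sigma>"
      by (simp_all add: multi_partial_def)
    then show "norm (partial k \<sigma> x) \<le> K1" "continuous_on UNIV (partial k \<sigma>)"
      using exhaust_2[of k] \<sigma>(5)[of "(1, 0)"] \<sigma>(5)[of "(0, 1)"] \<sigma>(6)[of "(1, 0)" x] \<sigma>(6)[of "(0, 1)" x]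
        \<sigma>(7)[of "(1, 0)"] \<sigma>(7)[of "(0, 1)"] by (auto simp: K1_def)
  qed
  define e where "e j = b * 2 powr (- (1 - \<beta>) * real j)" for j
  have e_pos: "0 < e j" for j using b by (simp add: e_def)
  have "((\<lambda>j. 2 powr (- (1 - \<beta>) * real j)) \<longlongrightarrow> 0) sequentially"
  proof -
    have "(\<lambda>j. (2 powr (- (1 - \<beta>))) ^ j) \<longlonglongrightarrow> 0"
      using \<open>\<beta> < 1\<close> by (intro LIMSEQ_power_zero) (simp add: powr_less_one)
    moreover have "(2 powr (- (1 - \<beta>))) ^ j = 2 powr (- (1 - \<beta>) * real j)" for j
      by (simp add: powr_powr[symmetric] powr_realpow)
    ultimately show ?thesis by simp
  qed
  then have "e \<longlonglongrightarrow> b * 0"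
    unfolding e_def by (intro tendsto_intros)
  then have "\<forall>\<^sub>F j in sequentially. e j < 1 / (20 * K1)"
    using K1(1) by (intro order_tendstoD) auto
  then have "\<forall>\<^sub>F j in sequentially. e j < 1 / (20 * K1) \<and> j0 \<le> j"
    using eventually_ge_at_top[of j0] by eventually_elim simp
  moreover have "(\<forall>m. C_norm m (\<tau> j) \<le> ennreal ((\<Sum>\<nu> | fst \<nu> + snd \<nu> \<le> m. K \<nu>) * b * 2 powr (- (1 - \<beta>) * real j))) \<and>
       l2L2_norm (I_star \<alpha> \<beta>)
         (\<lambda>i x. scat1 chi \<psi> (deform (\<tau> j) (packet a (\<zeta> j))) i x - scat1 chi \<psi> (packet a (\<zeta> j)) i x) \<ge> ennreal (sqrt (q / 32)) \<and>
       l2L2_norm (I_all \<alpha> \<beta>) (filter_commutator chi \<psi> (\<tau> j) (packet a (\<zeta> j))) \<ge> ennreal (sqrt (q / 32))"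
    if j: "e j < 1 / (20 * K1) \<and> j0 \<le> j" for j
  proof -
    let ?f = "packet a (\<zeta> j)" and ?i = "idx j" and ?\<psi> = "\<psi> (idx j)"
    have i: "?i \<in> I_star \<alpha> \<beta>" and inv: "invertible (mat 1 - M j)"
      using core_sys j by (auto simp: active_core_system_def)
    have M: "norm (M j *v x) \<le> e j * norm x" for x
      using order_trans[OF onorm[OF matrix_vector_mul_bounded_linear] mult_right_mono[OF b(2)]] j
      by (simp add: e_def)
    have "1 / (20 * K1) \<le> 1 / 20" using K1(1) by (simp add: field_simps)
    then have e10: "e j \<le> 1 / 10" using j by linarith
    have M10: "norm (M j *v x) \<le> norm x / 10" for x
      using M[of x] mult_right_mono[OF e10, of "norm x"] by simp
    have T: "norm (transpose (M j) *v x) \<le> e j * norm x" for x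
      by (rule norm_transpose_le[OF M])
    have T10: "norm (transpose (M j) *v x) \<le> norm x / 10" for x
      using norm_transpose_le[of "M j" "1 / 10" x] M10 by simp
    have \<tau>10: "norm (\<tau> j x) \<le> norm x / 10" for x
      using T10[of "\<sigma> x"] \<sigma>(3)[of x] by (simp add: \<tau>_def)
    have \<tau>_cont: "continuous_on UNIV (\<tau> j)"
      unfolding \<tau>_def
      by (rule continuous_on_compose2[OF linear_continuous_on[OF matrix_vector_mul_bounded_linear] \<sigma>_cont]) auto
    have f: "tame ?f" and g: "tame (deform (\<tau> j) ?f)"
      using a(1) tame_packet_deformed[OF a(1) \<tau>10 \<tau>_cont] by (simp_all add: tame_packet deform_def[abs_def])
    have \<psi>_int: "integrable lborel ?\<psi>" by (rule \<psi>[OF i])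
    have \<psi>_le: "AE \<xi> in lborel. norm (fourier ?\<psi> \<xi>) \<le> 1"
      using bounds i by (auto elim: eventually_mono)
    have chi_le: "AE \<xi> in lborel. norm (fourier chi \<xi>) \<le> 1"
      and chi_flat: "AE \<xi> in lborel. norm \<xi> < 15 / 16 \<longrightarrow> norm (fourier chi \<xi>) = 1"
      using bounds by (auto elim: eventually_mono)
    have vanish: "fourier ?\<psi> \<xi> = 0" if "\<xi> \<in> (*v) (mat 1 - M j) ` ball (\<zeta> j) \<rho>" for \<xi>
    proof (rule zero_outside_supp[of \<xi> "fourier ?\<psi>"])
      \<comment> \<open>The tile contains \<open>\<zeta> j\<close>, so the separation property applies to it.\<close>
      let ?Q = "Q_set \<alpha> \<beta> \<epsilon>0 (Some ?i)"
      have sys: "\<zeta> j \<in> P_set \<alpha> \<beta> (Some ?i)" "P_set \<alpha> \<beta> (Some ?i) \<subseteq> ?Q"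
        "\<And>\<rho> p. 0 < \<rho> \<and> \<rho> \<le> r0 \<and> p \<in> I_all \<alpha> \<beta> \<and> Q_set \<alpha> \<beta> \<epsilon>0 p \<inter> ball (\<zeta> j) \<rho> \<noteq> {} \<Longrightarrow>
           Q_set \<alpha> \<beta> \<epsilon>0 p \<inter> (*v) (mat 1 - M j) ` ball (\<zeta> j) \<rho> = {}"
        using core_sys j unfolding active_core_system_def by blast+
      have "\<zeta> j \<in> ?Q \<inter> ball (\<zeta> j) \<rho>" using sys(1,2) \<rho> by auto
      then have "?Q \<inter> (*v) (mat 1 - M j) ` ball (\<zeta> j) \<rho> = {}"
        using \<rho> i by (intro sys(3)) (auto simp: I_all_def)
      moreover have "supp (fourier ?\<psi>) \<subseteq> ?Q"
        using bank i unfolding scattering_bank_def by blast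
      ultimately show "\<xi> \<notin> supp (fourier ?\<psi>)" using that by blast
    qed
    have leak: "sq_mass (conv (deform (\<tau> j) ?f) ?\<psi>) \<le> ennreal (q / 32)"
    proof -
      have "sq_mass (conv (deform (\<lambda>x. transpose (M j) *v \<sigma> x) ?f) ?\<psi>)
          \<le> ennreal (8 * exp (- (pi * \<rho>\<^sup>2 / a)) + 64 * exp (- (pi * a * R\<^sup>2 / 4)))"
        by (rule deformed_packet_leak[OF a(1) _ M10 inv \<psi>_int \<psi>_le vanish R(1) \<sigma>_cont \<sigma>(2,3)])
           (use \<rho> in auto)
      also have "8 * exp (- (pi * \<rho>\<^sup>2 / a)) + 64 * exp (- (pi * a * R\<^sup>2 / 4)) = q / 32"
        by (simp add: a(2) R(2))
      finally show ?thesis by (simp add: \<tau>_def[abs_def])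
    qed
    let ?A = "conv (\<lambda>x. complex_of_real (norm (conv ?f ?\<psi> x))) chi"
    have lower: "ennreal q \<le> sq_mass ?A"
    proof -
      have core: "ennreal (c\<^sup>2 * exp (- (2 * pi * s * \<rho>\<^sup>2)) / 2) \<le> sq_mass ?A + ennreal (exp (- (2 * pi * s * (15 / 16)\<^sup>2)))"
      proof (rule core_modulus_lower_bound[OF a(1) s(1) _ _ _ chi \<psi>_int chi_flat \<psi>_le])
        show "c \<le> norm (fourier ?\<psi> \<xi>)" if "\<xi> \<in> ball (\<zeta> j) \<rho>" for \<xi>
          using c1(2)[of j \<xi>] j that \<rho>(2) c(3) by force
        show "2 * exp (- (pi * \<rho>\<^sup>2 / a)) \<le> 1 / 2"
          unfolding a(2) using q by simp
      qed (use c \<rho> in auto)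
      have main: "2 * q \<le> c\<^sup>2 * exp (- (2 * pi * s * \<rho>\<^sup>2)) / 2"
      proof -
        have "\<rho>\<^sup>2 \<le> (1 / 2)\<^sup>2" using \<rho> by (intro power_mono) auto
        then have "2 * pi * s * \<rho>\<^sup>2 \<le> 2 * pi * s * (1 / 4)"
          using s(1) by (intro mult_left_mono) (auto simp: power2_eq_square)
        then have "exp (- (pi * s / 2)) \<le> exp (- (2 * pi * s * \<rho>\<^sup>2))" by simp
        then have "c\<^sup>2 * (c\<^sup>2 / 4) \<le> c\<^sup>2 * exp (- (2 * pi * s * \<rho>\<^sup>2))"
          unfolding s(2) by (intro mult_left_mono) auto
        then show ?thesis by (simp add: q_def power4_eq_xxxx power2_eq_square)
      qed
      have error: "exp (- (2 * pi * s * (15 / 16)\<^sup>2)) \<le> q"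
      proof -
        have "exp (- (2 * pi * s * (15 / 16)\<^sup>2)) \<le> exp (- (pi * s / 2) + - (pi * s / 2))"
          using s(1) by (simp add: power2_eq_square)
        also have "\<dots> = q"
          unfolding exp_add s(2) by (simp add: q_def power4_eq_xxxx power2_eq_square)
        finally show ?thesis .
      qed
      have "ennreal (2 * q) \<le> sq_mass ?A + ennreal (exp (- (2 * pi * s * (15 / 16)\<^sup>2)))"
        by (rule order_trans[OF ennreal_leI[OF main] core])
      also have "\<dots> \<le> ennreal 1 * sq_mass ?A + ennreal q"
        using add_left_mono[OF ennreal_leI[OF error]] by simp
      finally have "ennreal (2 * q) \<le> ennreal 1 * sq_mass ?A + ennreal q" .
      from ennreal_le_from_linear[OF this] show ?thesis using q by simp
    qed
    have scat: "ennreal (q / 32) \<le> sq_mass (\<lambda>x. scat1 chi \<psi> (deform (\<tau> j) ?f) ?i x - scat1 chi \<psi> ?f ?i x)"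
      unfolding scat1_def using scattering_gap[OF f g \<psi>_int chi chi_le lower leak] q by simp
    have comm: "ennreal (q / 32) \<le> sq_mass (filter_commutator chi \<psi> (\<tau> j) ?f (Some ?i))"
    proof -
      have part: "partial k (\<tau> j) = (\<lambda>x. transpose (M j) *v partial k \<sigma> x)" for k
        using foldr_partial_matrix[OF \<sigma>(1), of "[k]" "transpose (M j)"] by (simp add: \<tau>_def[abs_def])
      have "norm (partial k (\<tau> j) x) \<le> 1 / 20" for k x
      proof -
        have "norm (partial k (\<tau> j) x) \<le> e j * K1"
          unfolding part using e_pos[of j]
          by (intro order_trans[OF T mult_left_mono[OF K1(2)]]) simp
        also have "\<dots> \<le> 1 / (20 * K1) * K1" using j K1(1) by (intro mult_right_mono) auto
        finally show ?thesis using K1(1) by simp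
      qed
      moreover have "continuous_on UNIV (partial k (\<tau> j))" for k
        unfolding part
        by (rule continuous_on_compose2[OF linear_continuous_on[OF matrix_vector_mul_bounded_linear] K1(3)]) auto
      moreover have "\<tau> j differentiable at x" for x
        unfolding \<tau>_def
        by (rule differentiableI[OF bounded_linear.has_derivative[OF matrix_vector_mul_bounded_linear
              differentiable_has_partial(1)[OF \<sigma>_diff]]])
      moreover have "ennreal q \<le> sq_mass (conv ?f ?\<psi>)"
        using order_trans[OF lower sq_mass_conv_le[OF tame_norm[OF tame_conv[OF f \<psi>_int]] chi chi_le]]
        by (simp add: sq_mass_norm)
      ultimately show ?thesis
        unfolding filter_commutator_def filter_transform_def
        using commutator_gap[OF f g \<psi>_int _ leak] q by simp
    qed
    show ?thesis
    proof (intro conjI allI)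
      show "C_norm m (\<tau> j) \<le> ennreal ((\<Sum>\<nu> | fst \<nu> + snd \<nu> \<le> m. K \<nu>) * b * 2 powr (- (1 - \<beta>) * real j))" for m
        using C_norm_matrix_le[OF \<sigma>(1,6,7) T] e_pos[of j]
        by (simp add: \<tau>_def[abs_def] e_def mult.assoc less_imp_le)
      show "ennreal (sqrt (q / 32)) \<le> l2L2_norm (I_star \<alpha> \<beta>)
         (\<lambda>i x. scat1 chi \<psi> (deform (\<tau> j) ?f) i x - scat1 chi \<psi> ?f i x)"
        by (rule l2L2_norm_ge[OF i]) (use scat q in auto)
      show "ennreal (sqrt (q / 32)) \<le> l2L2_norm (I_all \<alpha> \<beta>) (filter_commutator chi \<psi> (\<tau> j) ?f)"
        by (rule l2L2_norm_ge[of "Some ?i"]) (use comm q i in \<open>auto simp: I_all_def\<close>)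
    qed
  qed
  ultimately have ev: "\<forall>\<^sub>F j in sequentially.
       (\<forall>m. C_norm m (\<tau> j) \<le> ennreal ((\<Sum>\<nu> | fst \<nu> + snd \<nu> \<le> m. K \<nu>) * b * 2 powr (- (1 - \<beta>) * real j))) \<and>
       l2L2_norm (I_star \<alpha> \<beta>)
         (\<lambda>i x. scat1 chi \<psi> (deform (\<tau> j) (packet a (\<zeta> j))) i x - scat1 chi \<psi> (packet a (\<zeta> j)) i x) \<ge> ennreal (sqrt (q / 32)) \<and>
       l2L2_norm (I_all \<alpha> \<beta>) (filter_commutator chi \<psi> (\<tau> j) (packet a (\<zeta> j))) \<ge> ennreal (sqrt (q / 32))"
    by (rule eventually_mono)
  show ?thesis
  proof (intro exI conjI allI)
    show "schwartz (packet a (\<zeta> j))" "L2_norm (packet a (\<zeta> j)) = 1" for j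
      by (intro schwartz_packet L2_norm_packet a(1))+
    show "test_function (\<tau> j)" for j
      unfolding \<tau>_def by (rule \<sigma>(4))
    show "0 < sqrt (q / 32)" using q by simp
  qed (fact ev)
qed

end
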